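(* Consider a two-dimensional ($d=2$) random walk with internal states $\xi_n=(\eta_n,\varepsilon_n)$ satisfying the basic assumptions (i)–(iv), and assume that fourth moments exist, i.e. $\sum_{y\in\mathbb{Z}^2}\|y\|^4A_y$ converges. Then there is a constant $C$ such that for every $n\ge1$, every $x\in\mathbb{Z}^2$ and every $1\le j,k\le s$, $$\left|P\bigl(\xi_n=(x,k)\mid\xi_0=(0,j)\bigr)-\mu_k\frac1n g_\sigma\left(\frac{x}{\sqrt n}\right)\right|\le C\left(\frac{1}{n^{3/2}}\left(\frac{\|x\|}{n^{1/2}}+\frac{\|x\|^3}{n^{3/2}}\right)\exp\left(-\frac{x^T\sigma^{-1}x}{2n}\right)+\frac{1}{n^2}\right),$$ where $g_\sigma$ is the density of the Gaussian distribution on $\mathbb{R}^2$ with mean $0$ and covariance matrix $\sigma$.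
   Context: Random walk with internal states (RWwIS). $E=\{1,\dots,s\}$ is a finite set, $d\ge1$ (here $d=2$), and $p_{y,j,k}\ge 0$ ($y\in\mathbb{Z}^d$, $j,k\in E$) satisfy $\sum_{y,k}p_{y,j,k}=1$ for each $j$. The RWwIS is the Markov chain $\xi_n=(\eta_n,\varepsilon_n)$ on $\mathbb{Z}^d\times E$ with $P(\xi_{n+1}=(x',k)\mid \xi_n=(x,j))=p_{x'-x,j,k}$. Put $A_y=(p_{y,j,k})_{j,k}$, $Q=\sum_y A_y$, $M_l=\sum_y y_lA_y$, $\Sigma_{l,m}=\sum_y y_ly_mA_y$, $\underline{1}=(1,\dots,1)^T\in\mathbb{R}^s$. Basic assumptions: (i) the Markov chain $(\varepsilon_n)$ on $E$, whose transition matrix is $Q$, is irreducible and aperiodic; $\mu$ is its unique stationary distribution. (ii) Trivial arithmetic: for $j\in E$ the subgroup of $\mathbb{Z}^d$ generated by all differences $y-y'$ such that for some $n\geq 1$ both $P(\xi_n=(y,j)\mid\xi_0=(0,j))>0$ and $P(\xi_n=(y',j)\mid\xi_0=(0,j))>0$ is $\mathbb{Z}^d$. (iii) Zero mean: $\langle\mu,M_l\underline{1}\rangle=0$ for all $l$. (iv) The second moments $\sum_y\|y\|^2A_y$ converge and the covariance matrix $\sigma=(\sigma_{l,m})_{1\le l,m\le d}$, $\sigma_{l,m}=\langle\mu,\Sigma_{l,m}\underline{1}\rangle-\langle\mu,M_l(Q-1)^{-1}M_m\underline{1}\rangle-\langle\mu,M_m(Q-1)^{-1}M_l\underline{1}\rangle$,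 is nonsingular (positive definite); here $(Q-1)^{-1}M_m\underline{1}$ is the unique vector $v$ with $\langle\mu,v\rangle=0$ and $Qv-v=M_m\underline{1}$. *)

theory Defs
  imports "HOL-Probability.Probability" "HOL-Computational_Algebra.Group_Closure"
begin

text \<open>
  The step probabilities of a random walk with internal states in a finite type \<open>'s\<close> are
  given by a family \<open>p :: 's \<Rightarrow> ((int ^ 'd) \<times> 's) pmf\<close> with
  \<open>p\<^bsub>y,j,k\<^esub> = pmf (p j) (y, k)\<close>; the type \<open>pmf\<close> supplies nonnegativity and
  \<open>\<Sum>\<^bsub>y,k\<^esub> p\<^bsub>y,j,k\<^esub> = 1\<close> for each \<open>j\<close>.
\<close>

type_synonym ('d, 's) rw_steps = "'s \<Rightarrow> ((int ^ 'd) \<times> 's) pmf"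

definition rw_kernel ::
  "('d::finite, 's) rw_steps \<Rightarrow> (int ^ 'd) \<times> 's \<Rightarrow> ((int ^ 'd) \<times> 's) pmf" where
  "rw_kernel p = (\<lambda>(x, j). map_pmf (\<lambda>(y, k). (x + y, k)) (p j))"

text \<open>\<open>rw_law p n z\<close> is the law of \<open>\<xi>\<^sub>n\<close> given \<open>\<xi>\<^sub>0 = z\<close>.\<close>

primrec rw_law ::
  "('d::finite, 's) rw_steps \<Rightarrow> nat \<Rightarrow> (int ^ 'd) \<times> 's \<Rightarrow> ((int ^ 'd) \<times> 's) pmf" where
  "rw_law p 0 z = return_pmf z"
| "rw_law p (Suc n) z = bind_pmf (rw_law p n z) (rw_kernel p)"

lemma pmf_rw_kernel: "pmf (rw_kernel p (x, j)) (x', k) = pmf (p j) (x' - x, k)"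
proof -
  have "inj (\<lambda>(y, k). (x + y, k))"
    by (auto simp: inj_on_def)
  from pmf_map_inj'[OF this, of "p j" "(x' - x, k)"] show ?thesis
    by (simp add: rw_kernel_def)
qed

definition real_vec :: "int ^ 'd \<Rightarrow> real ^ 'd" where
  "real_vec y = (\<chi> i. real_of_int (y $ i))"

definition rw_A :: "('d::finite, 's::finite) rw_steps \<Rightarrow> int ^ 'd \<Rightarrow> real ^ 's ^ 's" where
  "rw_A p y = (\<chi> j k. pmf (p j) (y, k))"

definition rw_Q :: "('d::finite, 's::finite) rw_steps \<Rightarrow> real ^ 's ^ 's" where
  "rw_Q p = (\<Sum>\<^sub>\<infinity>y. rw_A p y)"

definition rw_M :: "('d::finite, 's::finite) rw_steps \<Rightarrow> 'd \<Rightarrow> real ^ 's ^ 's" where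
  "rw_M p l = (\<Sum>\<^sub>\<infinity>y. (real_vec y $ l) *\<^sub>R rw_A p y)"

definition rw_Sigma :: "('d::finite, 's::finite) rw_steps \<Rightarrow> 'd \<Rightarrow> 'd \<Rightarrow> real ^ 's ^ 's" where
  "rw_Sigma p l m = (\<Sum>\<^sub>\<infinity>y. (real_vec y $ l * real_vec y $ m) *\<^sub>R rw_A p y)"

definition moment_converges :: "nat \<Rightarrow> ('d::finite, 's::finite) rw_steps \<Rightarrow> bool" where
  "moment_converges r p \<longleftrightarrow> (\<lambda>y. norm (real_vec y) ^ r *\<^sub>R rw_A p y) summable_on UNIV"

text \<open>On \<open>real ^ 's ^ 's\<close> the operations \<open>*\<close> and \<open>^\<close> act entrywise, so matrix powers need
  \<open>**\<close>.\<close>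

primrec mat_power :: "real ^ 's ^ 's \<Rightarrow> nat \<Rightarrow> real ^ 's ^ 's::finite" where
  "mat_power A 0 = mat 1"
| "mat_power A (Suc n) = mat_power A n ** A"

definition irreducible_matrix :: "real ^ 's ^ 's::finite \<Rightarrow> bool" where
  "irreducible_matrix T \<longleftrightarrow> (\<forall>j k. \<exists>n. mat_power T n $ j $ k > 0)"

definition aperiodic_matrix :: "real ^ 's ^ 's::finite \<Rightarrow> bool" where
  "aperiodic_matrix T \<longleftrightarrow> (\<forall>j. Gcd {n. n \<ge> 1 \<and> mat_power T n $ j $ j > 0} = (1::nat))"

definition stationary_distribution :: "real ^ 's ^ 's::finite \<Rightarrow> real ^ 's \<Rightarrow> bool" where
  "stationary_distribution T \<mu> \<longleftrightarrow>
     (\<forall>k. \<mu> $ k \<ge> 0) \<and> (\<Sum>k\<in>UNIV. \<mu> $ k) = 1 \<and> \<mu> v* T = \<mu>"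

definition trivial_arithmetic :: "('d::finite, 's::finite) rw_steps \<Rightarrow> bool" where
  "trivial_arithmetic p \<longleftrightarrow>
     (\<forall>j. group_closure {y - y' | y y'. \<exists>n\<ge>1.
            pmf (rw_law p n (0, j)) (y, j) > 0 \<and> pmf (rw_law p n (0, j)) (y', j) > 0} = UNIV)"

definition zero_mean :: "('d::finite, 's::finite) rw_steps \<Rightarrow> real ^ 's \<Rightarrow> bool" where
  "zero_mean p \<mu> \<longleftrightarrow> (\<forall>l. \<mu> \<bullet> (rw_M p l *v vec 1) = 0)"

text \<open>\<open>Q - 1\<close> is singular; its inverse is taken on the hyperplane orthogonal to \<open>\<mu>\<close>.\<close>

definition Q_minus_one_inv ::
  "('d::finite, 's::finite) rw_steps \<Rightarrow> real ^ 's \<Rightarrow> real ^ 's \<Rightarrow> real ^ 's" where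
  "Q_minus_one_inv p \<mu> b = (THE v. \<mu> \<bullet> v = 0 \<and> rw_Q p *v v - v = b)"

definition rw_covariance ::
  "('d::finite, 's::finite) rw_steps \<Rightarrow> real ^ 's \<Rightarrow> real ^ 'd ^ 'd" where
  "rw_covariance p \<mu> = (\<chi> l m.
     \<mu> \<bullet> (rw_Sigma p l m *v vec 1)
     - \<mu> \<bullet> (rw_M p l *v Q_minus_one_inv p \<mu> (rw_M p m *v vec 1))
     - \<mu> \<bullet> (rw_M p m *v Q_minus_one_inv p \<mu> (rw_M p l *v vec 1)))"

definition gaussian_density :: "real ^ 'd ^ 'd::finite \<Rightarrow> real ^ 'd \<Rightarrow> real" where
  "gaussian_density S x =
     exp (- (x \<bullet> (matrix_inv S *v x)) / 2) / sqrt ((2 * pi) ^ CARD('d) * det S)"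

end

theory Submission
  imports Defs
begin

text \<open>
  Put \<open>(T\<^sub>t v) j = \<Sum>\<^bsub>y,k\<^esub> p\<^bsub>y,j,k\<^esub> exp (i t\<cdot>y) v k\<close>. Then \<open>P(\<xi>\<^sub>n = (x, k) | \<xi>\<^sub>0 = (0, j))\<close> is the
  Fourier coefficient at \<open>x\<close> of the function \<open>t \<mapsto> (T\<^sub>t\<^sup>n e\<^sub>k) j\<close> on the torus \<open>[-\<pi>, \<pi>]\<^sup>2\<close>
  (lemma \<open>rw_law_fourier_inversion\<close>). For small \<open>t\<close> the leading eigenvalue of \<open>T\<^sub>t\<close> is
  \<open>1 - \<sigma>(t)/2 + i \<kappa>(t)\<close> up to order four, where \<open>\<sigma>(t)\<close> is the quadratic form of the covariance matrix
  and \<open>\<kappa>\<close> is a cubic form. This suggests the expansion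
  \<open>(T\<^sub>t\<^sup>n e\<^sub>k) j = exp (-n \<sigma>(t)/2) (\<mu>\<^sub>k + i \<ell>\<^bsub>jk\<^esub>(t) + i n \<mu>\<^sub>k \<kappa>(t)) + error\<close>,
  with a linear form \<open>\<ell>\<^bsub>jk\<^esub>\<close> that depends on the initial and the final state (lemma
  \<open>char_op_pow_expansion\<close>). The inverse Fourier transform of the first summand is the Gaussian density.
  Those of the other two are odd polynomials of degree at most three in \<open>x/\<surd>n\<close> times the same
  exponential, hence vanish at \<open>x = 0\<close>, and are of size \<open>n\<^sup>-\<^sup>3\<^sup>/\<^sup>2\<close>: this is the explicit error
  term of the theorem. The error of the expansion is of size
  \<open>(|t|\<^sup>2 + n |t|\<^sup>4 + n\<^sup>2 |t|\<^sup>6) exp (-c n |t|\<^sup>2)\<close> plus something exponentially small in \<open>n\<close>, and integrates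
  to \<open>O(n\<^sup>-\<^sup>2)\<close>.

  No perturbation theory of eigenvalues is used. It is replaced by two ingredients.

  The first is the bound \<open>\<parallel>T\<^sub>t\<^sup>n\<parallel> \<le> C exp (-c n |t|\<^sup>2)\<close> on the whole torus (lemma
  \<open>char_op_torus_decay\<close>). If two displacements \<open>y, y'\<close> are possible for a loop of length \<open>N\<close> at \<open>j\<close>, then
  the waves \<open>exp (i t\<cdot>y)\<close> and \<open>exp (i t\<cdot>y')\<close> cancel in part, by an amount proportional to
  \<open>|1 - exp (i t\<cdot>(y - y'))|\<^sup>2\<close>. The displacements that are controlled in this way form a subgroup, which
  is everything by trivial arithmetic, so the two unit vectors are among them.

  The second is an approximate eigenvector \<open>u = 1 + i f\<^sub>1 + f\<^sub>2 + i f\<^sub>3\<close>, found order by order from Poisson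
  equations \<open>(1 - Q) f = b\<close> and exact up to \<open>O(|t|\<^sup>4)\<close> (lemma \<open>eigenvec_residual\<close>). Duhamel's formula and
  the decay bound turn this into an approximation of \<open>T\<^sub>t\<^sup>n u\<close>. What remains of \<open>e\<^sub>k\<close> is, up to a multiple
  of the constant function, \<open>\<mu>\<close>-centred; there \<open>T\<^sub>t\<^sup>n\<close> is compared with \<open>Q\<^sup>n\<close>, which contracts
  geometrically by Doeblin's argument (lemmas \<open>mean_zero_relaxation\<close> and
  \<open>mean_zero_relaxation_corrected\<close>).

  That \<open>\<sigma>\<close> is positive semidefinite, hence positive definite when it is invertible, holds because
  \<open>\<sigma>(t)\<close> is the stationary variance of the martingale increment \<open>t\<cdot>y + f\<^sub>1(k) - f\<^sub>1(j)\<close> (lemma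
  \<open>variance_form_nonneg\<close>).
\<close>

section \<open>Homogeneous polynomials in two variables\<close>

text \<open>
  The forms \<open>\<sigma>\<close>, \<open>\<kappa>\<close>, the vectors \<open>f\<^sub>i\<close> and the matrices of moments are all homogeneous polynomials in
  \<open>t\<close>. Writing a form of degree \<open>n + 1\<close> as \<open>t\<^sub>1 g + t\<^sub>2 h\<close> avoids coefficients and allows values in any
  real vector space; \<open>g\<close> and \<open>h\<close> are not unique, which does no harm.
\<close>

fun hpoly :: "nat \<Rightarrow> (real \<times> real \<Rightarrow> 'v::real_vector) \<Rightarrow> bool" where
  "hpoly 0 f \<longleftrightarrow> (\<exists>c. f = (\<lambda>_. c))"
| "hpoly (Suc n) f \<longleftrightarrow>
     (\<exists>g h. hpoly n g \<and> hpoly n h \<and> f = (\<lambda>t. fst t *\<^sub>R g t + snd t *\<^sub>R h t))"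

declare hpoly.simps [simp del]

lemma hpoly_const: "hpoly 0 (\<lambda>_. c)"
  by (auto simp: hpoly.simps)

lemma hpoly_0E:
  assumes "hpoly 0 f"
  obtains c where "f = (\<lambda>_. c)"
  using assms by (auto simp: hpoly.simps)

lemma hpoly_SucE:
  assumes "hpoly (Suc n) f"
  obtains g h where "hpoly n g" "hpoly n h" "f = (\<lambda>t. fst t *\<^sub>R g t + snd t *\<^sub>R h t)"
  using assms unfolding hpoly.simps by blast

lemma hpoly_SucI:
  assumes "hpoly n g" "hpoly n h" "\<And>t. f t = fst t *\<^sub>R g t + snd t *\<^sub>R h t"
  shows "hpoly (Suc n) f"
  unfolding hpoly.simps using assms by blast

lemma hpoly_add: "hpoly n f \<Longrightarrow> hpoly n g \<Longrightarrow> hpoly n (\<lambda>t. f t + g t)"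
proof (induction n arbitrary: f g)
  case (Suc n)
  from Suc.prems obtain a b c d where
    "hpoly n a" "hpoly n b" "f = (\<lambda>t. fst t *\<^sub>R a t + snd t *\<^sub>R b t)"
    "hpoly n c" "hpoly n d" "g = (\<lambda>t. fst t *\<^sub>R c t + snd t *\<^sub>R d t)"
    by (elim hpoly_SucE)
  with Suc.IH show ?case
    by (intro hpoly_SucI[of n "\<lambda>t. a t + c t" "\<lambda>t. b t + d t"])
      (auto simp: algebra_simps)
qed (auto elim!: hpoly_0E intro: hpoly_const)

lemma hpoly_linear:
  assumes "linear L"
  shows "hpoly n f \<Longrightarrow> hpoly n (\<lambda>t. L (f t))"
proof (induction n arbitrary: f)
  case (Suc n)
  from Suc.prems obtain a b where
    "hpoly n a" "hpoly n b" "f = (\<lambda>t. fst t *\<^sub>R a t + snd t *\<^sub>R b t)"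
    by (elim hpoly_SucE)
  with Suc.IH assms show ?case
    by (intro hpoly_SucI[of n "\<lambda>t. L (a t)" "\<lambda>t. L (b t)"])
      (auto simp: linear_add linear_scale)
qed (auto elim!: hpoly_0E intro: hpoly_const)

lemma hpoly_scaleR: "hpoly n f \<Longrightarrow> hpoly n (\<lambda>t. c *\<^sub>R f t)"
  by (rule hpoly_linear) (auto intro!: linearI simp: algebra_simps)

lemma hpoly_diff: "hpoly n f \<Longrightarrow> hpoly n g \<Longrightarrow> hpoly n (\<lambda>t. f t - g t)"
  using hpoly_add[of n f "\<lambda>t. (-1) *\<^sub>R g t"] hpoly_scaleR[of n g "-1"] by simp

lemma hpoly_bilinear:
  assumes "bounded_bilinear b"
  shows "hpoly m f \<Longrightarrow> hpoly n g \<Longrightarrow> hpoly (m + n) (\<lambda>t. b (f t) (g t))"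
proof (induction m arbitrary: f)
  case 0
  then obtain c where c: "f = (\<lambda>_. c)" by (elim hpoly_0E)
  have "linear (b c)"
    using assms by (intro bounded_linear.linear bounded_bilinear.bounded_linear_right)
  from hpoly_linear[OF this 0(2)] show ?case by (simp add: c)
next
  case (Suc m)
  from Suc.prems obtain u v where
    "hpoly m u" "hpoly m v" "f = (\<lambda>t. fst t *\<^sub>R u t + snd t *\<^sub>R v t)"
    by (elim hpoly_SucE)
  note uv = this
  interpret b: bounded_bilinear b by fact
  have "hpoly (Suc (m + n)) (\<lambda>t. b (f t) (g t))"
    by (rule hpoly_SucI[OF Suc.IH[OF uv(1) Suc.prems(2)] Suc.IH[OF uv(2) Suc.prems(2)]])
      (simp add: uv(3) b.add_left b.scaleR_left)
  then show ?case by simp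
qed

lemma hpoly_scale: "hpoly n f \<Longrightarrow> f (r *\<^sub>R t) = r ^ n *\<^sub>R f t"
proof (induction n arbitrary: f)
  case (Suc n)
  from Suc.prems obtain u v where uv: "hpoly n u" "hpoly n v"
    and f: "f = (\<lambda>t. fst t *\<^sub>R u t + snd t *\<^sub>R v t)" by (elim hpoly_SucE)
  show ?case by (simp add: f Suc.IH[OF uv(1)] Suc.IH[OF uv(2)] algebra_simps)
qed (auto elim!: hpoly_0E)

lemma hpoly_bound:
  fixes f :: "real \<times> real \<Rightarrow> 'v::real_normed_vector"
  shows "hpoly n f \<Longrightarrow> \<exists>C\<ge>0. \<forall>t. norm (f t) \<le> C * norm t ^ n"
proof (induction n arbitrary: f)
  case 0
  then obtain c where "f = (\<lambda>_. c)" by (elim hpoly_0E)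
  then show ?case by (intro exI[of _ "norm c"]) auto
next
  case (Suc n)
  from Suc.prems obtain u v where uv: "hpoly n u" "hpoly n v"
    and f: "f = (\<lambda>t. fst t *\<^sub>R u t + snd t *\<^sub>R v t)" by (elim hpoly_SucE)
  from Suc.IH uv obtain A B where A: "A \<ge> 0" "\<And>t. norm (u t) \<le> A * norm t ^ n"
    and B: "B \<ge> 0" "\<And>t. norm (v t) \<le> B * norm t ^ n"
    by meson
  show ?case
  proof (intro exI[of _ "A + B"] conjI allI)
    fix t :: "real \<times> real"
    have "norm (f t) \<le> \<bar>fst t\<bar> * norm (u t) + \<bar>snd t\<bar> * norm (v t)"
      unfolding f by (rule norm_triangle_le) auto
    also have "\<dots> \<le> norm t * (A * norm t ^ n) + norm t * (B * norm t ^ n)"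
      using norm_fst_le[of "fst t" "snd t"] norm_snd_le[of "snd t" "fst t"] A B
      by (intro add_mono mult_mono) auto
    finally show "norm (f t) \<le> (A + B) * norm t ^ Suc n" by (simp add: algebra_simps)
  qed (use A B in auto)
qed

lemma hpoly_measurable:
  fixes f :: "real \<times> real \<Rightarrow> real"
  shows "hpoly n f \<Longrightarrow> f \<in> borel_measurable borel"
proof (induction n arbitrary: f)
  case (Suc n)
  from Suc.prems obtain u v where uv: "hpoly n u" "hpoly n v"
    and f: "f = (\<lambda>t. fst t *\<^sub>R u t + snd t *\<^sub>R v t)" by (elim hpoly_SucE)
  then have [measurable]: "u \<in> borel_measurable borel" "v \<in> borel_measurable borel"
    using Suc.IH by auto
  have [measurable]: "fst \<in> borel_measurable (borel :: (real\<times>real) measure)"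
     "snd \<in> borel_measurable (borel :: (real\<times>real) measure)"
    by (auto intro!: borel_measurable_continuous_onI continuous_intros)
  show ?case unfolding f by simp
qed (auto elim!: hpoly_0E intro: hpoly_const)

text \<open>
Gaussian integrals are evaluated after a linear change of variables, which must preserve the degree.
\<close>

lemma hpoly_linear_subst:
  shows "hpoly n f \<Longrightarrow> hpoly n (\<lambda>s. f (a * fst s + b * snd s, c * fst s + d * snd s))"
proof (induction n arbitrary: f)
  case (Suc n)
  from Suc.prems obtain u v where uv: "hpoly n u" "hpoly n v"
    and f: "f = (\<lambda>t. fst t *\<^sub>R u t + snd t *\<^sub>R v t)" by (elim hpoly_SucE)
  let ?L = "\<lambda>s. (a * fst s + b * snd s, c * fst s + d * snd s)"
  have "hpoly n (\<lambda>s. u (?L s))" "hpoly n (\<lambda>s. v (?L s))"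
    using uv Suc.IH by auto
  then show ?case unfolding f
    by (intro hpoly_SucI[of n "\<lambda>s. a *\<^sub>R u (?L s) + c *\<^sub>R v (?L s)" "\<lambda>s. b *\<^sub>R u (?L s) + d *\<^sub>R v (?L s)"]
        hpoly_add hpoly_scaleR) (auto simp: algebra_simps)
qed (auto elim!: hpoly_0E intro: hpoly_const)

section \<open>Gaussian integrals in one variable\<close>

definition gauss_wave :: "real \<Rightarrow> real \<Rightarrow> complex" where
  "gauss_wave y s = of_real (exp (- s\<^sup>2 / 2)) * cis (- (s * y))"

lemma gauss_wave_measurable [measurable]: "gauss_wave y \<in> borel_measurable borel"
  unfolding gauss_wave_def cis_conv_exp by simp

lemma norm_gauss_wave: "norm (gauss_wave y s) = exp (- s\<^sup>2 / 2)"
  by (simp add: gauss_wave_def norm_mult)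

lemma integrable_gauss_moment: "integrable lborel (\<lambda>s::real. s ^ k * exp (- s\<^sup>2 / 2))"
proof -
  have "integrable lborel (\<lambda>x. std_normal_density x * x ^ k)"
    by (rule integrable_std_normal_moment)
  then have "integrable lborel (\<lambda>x. sqrt (2*pi) * (std_normal_density x * x ^ k))"
    by (rule integrable_mult_right)
  then show ?thesis by (simp add: std_normal_density_def mult.commute)
qed

lemma integrable_gauss_wave: "integrable lborel (\<lambda>s. of_real (s ^ k) * gauss_wave y s)"
  by (rule Bochner_Integration.integrable_bound[OF integrable_gauss_moment[of k]])
    (auto simp: norm_mult norm_power norm_gauss_wave abs_mult power_abs)

definition gauss_wave_moment :: "nat \<Rightarrow> real \<Rightarrow> complex" where
  "gauss_wave_moment k y = (LINT s|lborel. of_real (s ^ k) * gauss_wave y s)"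

lemma gauss_wave_moment_0: "gauss_wave_moment 0 y = of_real (sqrt (2 * pi) * exp (- y\<^sup>2 / 2))"
proof -
  have "gauss_wave_moment 0 y = (LINT s|lborel. of_real (sqrt (2*pi)) * (std_normal_density s *\<^sub>R iexp (- y * s)))"
    unfolding gauss_wave_moment_def gauss_wave_def
    by (intro Bochner_Integration.integral_cong refl)
      (auto simp: std_normal_density_def cis_conv_exp scaleR_conv_of_real mult_ac real_sqrt_mult)
  also have "\<dots> = of_real (sqrt (2*pi)) * (LINT s|lborel. (std_normal_density s *\<^sub>R iexp (- y * s)))"
    by (rule integral_mult_right_zero)
  also have "(LINT s|lborel. (std_normal_density s *\<^sub>R iexp (- y * s))) = char std_normal_distribution (-y)"
    unfolding char_def by (subst integral_density) auto
  finally show ?thesis by (simp add: char_std_normal_distribution)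
qed

lemma gauss_tendsto_0:
  shows "((\<lambda>s::real. s ^ k * exp (- s\<^sup>2 / 2)) \<longlongrightarrow> 0) at_top"
    and "((\<lambda>s::real. s ^ k * exp (- s\<^sup>2 / 2)) \<longlongrightarrow> 0) at_bot"
proof -
  show 1: "((\<lambda>s::real. s ^ k * exp (- s\<^sup>2 / 2)) \<longlongrightarrow> 0) at_top"
  proof (rule Lim_null_comparison[OF _ tendsto_power_div_exp_0[of k]])
    show "\<forall>\<^sub>F s in at_top. norm (s ^ k * exp (- s\<^sup>2 / 2)) \<le> s ^ k / exp s"
      using eventually_ge_at_top[of "2::real"]
    proof eventually_elim
      case (elim s)
      then have "s \<le> s\<^sup>2 / 2" by (simp add: power2_eq_square)
      then have "exp (- s\<^sup>2 / 2) \<le> exp (- s)" by simp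
      with elim have "s ^ k * exp (- s\<^sup>2 / 2) \<le> s ^ k * exp (- s)"
        by (intro mult_left_mono) auto
      also have "s ^ k * exp (- s) = s ^ k / exp s" by (simp only: exp_minus divide_inverse)
      finally have "s ^ k * exp (- s\<^sup>2 / 2) \<le> s ^ k / exp s" .
      moreover have "0 \<le> s ^ k * exp (- s\<^sup>2 / 2)" using elim by (intro mult_nonneg_nonneg) auto
      ultimately show ?case by (metis abs_of_nonneg real_norm_def)
    qed
  qed
  have mirror: "(\<lambda>s::real. (-1) ^ k * (s ^ k * exp (- s\<^sup>2 / 2))) = (\<lambda>s. (- s) ^ k * exp (- (- s)\<^sup>2 / 2))"
    by (rule ext, subst (2) power_minus) simp
  have "((\<lambda>s::real. (-1) ^ k * (s ^ k * exp (- s\<^sup>2 / 2))) \<longlongrightarrow> (-1) ^ k * 0) at_top"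
    by (intro tendsto_intros 1)
  then have "((\<lambda>s::real. (- s) ^ k * exp (- (- s)\<^sup>2 / 2)) \<longlongrightarrow> 0) at_top"
    unfolding mirror by simp
  then show "((\<lambda>s::real. s ^ k * exp (- s\<^sup>2 / 2)) \<longlongrightarrow> 0) at_bot"
    by (simp add: filterlim_at_bot_mirror)
qed

text \<open>
  The derivative of \<open>s\<^sup>k exp (-s\<^sup>2/2 - i s y)\<close> has integral \<open>0\<close>. The resulting recursion is that of the
  Hermite polynomials.
\<close>

lemma gauss_wave_moment_parts:
  "of_nat k * gauss_wave_moment (k - 1) y - gauss_wave_moment (Suc k) y - \<i> * y * gauss_wave_moment k y = 0"
proof -
  let ?F = "\<lambda>s. of_real (s ^ k) * gauss_wave y s"
  let ?f = "\<lambda>s. of_nat k * (of_real (s ^ (k - 1)) * gauss_wave y s)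
      - of_real (s ^ Suc k) * gauss_wave y s - \<i> * y * (of_real (s ^ k) * gauss_wave y s)"
  have int: "integrable lborel ?f"
    by (intro Bochner_Integration.integrable_diff integrable_mult_right integrable_gauss_wave)
  have gw: "((\<lambda>s. exp (of_real (- s\<^sup>2 / 2) + \<i> * (of_real (- (s * y))))) has_vector_derivative
       (- of_real s - \<i> * y) * exp (of_real (- s\<^sup>2 / 2) + \<i> * (of_real (- (s * y))))) (at s)" for s
  proof -
    have "((\<lambda>s. of_real (- s\<^sup>2 / 2)) has_vector_derivative complex_of_real (- s)) (at s)"
      by (rule has_vector_derivative_of_real) (auto intro!: derivative_eq_intros)
    moreover have "((\<lambda>s. of_real (- (s * y))) has_vector_derivative complex_of_real (- y)) (at s)"
      by (rule has_vector_derivative_of_real) (auto intro!: derivative_eq_intros)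
    ultimately have "((\<lambda>s. of_real (- s\<^sup>2 / 2) + \<i> * (of_real (- (s * y)))) has_vector_derivative
        complex_of_real (- s) + \<i> * of_real (- y)) (at s)"
      by (intro has_vector_derivative_add has_vector_derivative_mult_right)
    from field_vector_diff_chain_at[OF this DERIV_exp] show ?thesis
      by (simp add: o_def)
  qed
  have gweq: "gauss_wave y = (\<lambda>s. exp (of_real (- s\<^sup>2 / 2) + \<i> * (of_real (- (s * y)))))"
    unfolding gauss_wave_def by (rule ext, simp only: exp_add cis_conv_exp exp_of_real)
  have deriv: "(?F has_vector_derivative ?f s) (at s)" for s
  proof -
    have 1: "((\<lambda>s. complex_of_real (s ^ k)) has_vector_derivative of_real (real k * s ^ (k - 1))) (at s)"
      by (rule has_vector_derivative_of_real) (auto intro!: derivative_eq_intros)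
    show ?thesis
      by (rule has_vector_derivative_eq_rhs[OF has_vector_derivative_mult[OF 1 gw[of s, folded gweq]]])
        (simp add: algebra_simps gweq)
  qed
  have cont: "isCont ?f s" for s
    unfolding gweq by (intro continuous_intros) auto
  have "(LBINT s=-\<infinity>..\<infinity>. ?f s) = 0 - 0"
  proof (rule interval_integral_FTC_integrable[where F="?F"])
    show "set_integrable lborel (einterval (-\<infinity>) \<infinity>) ?f"
      using int by (simp add: set_integrable_def)
    have n: "norm (?F s) = norm (s ^ k * exp (- s\<^sup>2 / 2))" for s
      by (auto simp: norm_mult norm_power norm_gauss_wave abs_mult power_abs)
    have "(?F \<longlongrightarrow> 0) at_top" "(?F \<longlongrightarrow> 0) at_bot"
      using gauss_tendsto_0[of k]
      by (subst tendsto_norm_zero_iff[symmetric], subst n, simp only: tendsto_norm_zero_iff)+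
    then show "((?F \<circ> real_of_ereal) \<longlongrightarrow> 0) (at_right (-\<infinity>))"
      "((?F \<circ> real_of_ereal) \<longlongrightarrow> 0) (at_left \<infinity>)"
      by (simp_all add: ereal_tendsto_simps)
  qed (use deriv cont in auto)
  then have "(LINT s|lborel. ?f s) = 0"
    by (simp add: interval_integral_to_infinity_eq interval_lebesgue_integral_def set_lebesgue_integral_def)
  then show ?thesis
    unfolding gauss_wave_moment_def
    using integrable_gauss_wave by (simp add: Bochner_Integration.integral_diff del: power_Suc of_real_power)
qed

lemma gauss_wave_moment_123:
  "gauss_wave_moment 1 y = - \<i> * y * gauss_wave_moment 0 y"
  "gauss_wave_moment 2 y = of_real (1 - y\<^sup>2) * gauss_wave_moment 0 y"
  "gauss_wave_moment 3 y = - \<i> * of_real (3 * y - y ^ 3) * gauss_wave_moment 0 y"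
proof -
  show 1: "gauss_wave_moment 1 y = - \<i> * y * gauss_wave_moment 0 y"
    using gauss_wave_moment_parts[of 0 y] by (simp add: algebra_simps add_eq_0_iff) (metis minus_minus)
  show 2: "gauss_wave_moment 2 y = of_real (1 - y\<^sup>2) * gauss_wave_moment 0 y"
    using gauss_wave_moment_parts[of 1 y] unfolding numeral_2_eq_2[symmetric]
    by (simp add: 1 algebra_simps power2_eq_square del: One_nat_def)
  have "gauss_wave_moment 3 y = 2 * gauss_wave_moment 1 y - \<i> * y * gauss_wave_moment 2 y"
    using gauss_wave_moment_parts[of 2 y] by (simp add: algebra_simps numeral_3_eq_3 numeral_2_eq_2)
  then show "gauss_wave_moment 3 y = - \<i> * of_real (3 * y - y ^ 3) * gauss_wave_moment 0 y"
    by (simp add: 1 2 algebra_simps power2_eq_square power3_eq_cube del: One_nat_def)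
qed

section \<open>Gaussian integrals in two variables\<close>

lemma lborel2_integral_times:
  fixes f g :: "real \<Rightarrow> complex"
  assumes f: "integrable lborel f" and g: "integrable lborel g"
  shows "integrable lborel (\<lambda>s::real\<times>real. f (fst s) * g (snd s))"
    and "(LINT s|lborel. f (fst s) * g (snd s)) = (LINT x|lborel. f x) * (LINT x|lborel. g x)"
proof -
  have [measurable]: "f \<in> borel_measurable borel" "g \<in> borel_measurable borel"
    using f g by auto
  have "integrable (lborel \<Otimes>\<^sub>M lborel) (\<lambda>s::real\<times>real. f (fst s) * g (snd s))"
    by (rule lborel_pair.Fubini_integrable)
      (use f g in \<open>auto simp: norm_mult\<close>)
  then show i: "integrable lborel (\<lambda>s::real\<times>real. f (fst s) * g (snd s))"
    by (simp add: lborel_prod)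
  show "(LINT s|lborel. f (fst s) * g (snd s)) = (LINT x|lborel. f x) * (LINT x|lborel. g x)"
    using lborel_pair.integral_fst'[of "\<lambda>s. f (fst s) * g (snd s)"] i
    by (simp add: lborel_prod)
qed

text \<open>
  Completing the square diagonalises a binary quadratic form by an upper triangular substitution, so
  translations and dilations of one variable at a time suffice.
\<close>

lemma lborel2_nn_integral_shear:
  fixes g :: "real \<times> real \<Rightarrow> ennreal"
  assumes [measurable]: "g \<in> borel_measurable borel" and "a \<noteq> 0" "d \<noteq> 0"
  shows "(\<integral>\<^sup>+t. g t \<partial>lborel)
    = ennreal \<bar>a * d\<bar> * (\<integral>\<^sup>+s. g (a * fst s + b * snd s, d * snd s) \<partial>lborel)"
proof -
  have [measurable]: "g \<in> borel_measurable (lborel \<Otimes>\<^sub>M lborel)"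
    unfolding lborel_prod by simp
  have [measurable]: "(\<lambda>s. g (a * fst s + b * snd s, d * snd s)) \<in> borel_measurable (lborel \<Otimes>\<^sub>M lborel)"
    by measurable
  have "(\<integral>\<^sup>+t. g t \<partial>lborel) = (\<integral>\<^sup>+y. \<integral>\<^sup>+x. g (x, y) \<partial>lborel \<partial>lborel)"
    using lborel_pair.nn_integral_snd[of g] by (simp add: lborel_prod)
  also have "\<dots> = ennreal \<bar>d\<bar> * (\<integral>\<^sup>+y. \<integral>\<^sup>+x. g (x, 0 + d * y) \<partial>lborel \<partial>lborel)"
    using assms by (intro nn_integral_real_affine) auto
  also have "(\<integral>\<^sup>+y. \<integral>\<^sup>+x. g (x, 0 + d * y) \<partial>lborel \<partial>lborel)
     = (\<integral>\<^sup>+y. ennreal \<bar>a\<bar> * \<integral>\<^sup>+x. g (b * y + a * x, 0 + d * y) \<partial>lborel \<partial>lborel)"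
    using assms by (intro nn_integral_cong nn_integral_real_affine) auto
  also have "\<dots> = ennreal \<bar>a\<bar> * (\<integral>\<^sup>+y. \<integral>\<^sup>+x. g (b * y + a * x, 0 + d * y) \<partial>lborel \<partial>lborel)"
    by (intro nn_integral_cmult) measurable
  also have "(\<integral>\<^sup>+y. \<integral>\<^sup>+x. g (b * y + a * x, 0 + d * y) \<partial>lborel \<partial>lborel)
     = (\<integral>\<^sup>+s. g (a * fst s + b * snd s, d * snd s) \<partial>(lborel \<Otimes>\<^sub>M lborel))"
    by (subst lborel_pair.nn_integral_snd[symmetric]) (auto simp: add.commute)
  finally show ?thesis
    by (simp add: lborel_prod abs_mult ennreal_mult' mult.assoc[symmetric] mult.commute)
qed

lemma lborel2_integral_shear:
  fixes f :: "real \<times> real \<Rightarrow> complex"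
  assumes [measurable]: "f \<in> borel_measurable borel" and "a \<noteq> 0" "d \<noteq> 0"
  shows "(LINT t|lborel. f t)
    = \<bar>a * d\<bar> *\<^sub>R (LINT s|lborel. f (a * fst s + b * snd s, d * snd s))"
    and "integrable lborel (\<lambda>s. f (a * fst s + b * snd s, d * snd s)) \<Longrightarrow> integrable lborel f"
proof -
  let ?L = "\<lambda>s::real\<times>real. (a * fst s + b * snd s, d * snd s)"
  have [measurable]: "?L \<in> borel \<rightarrow>\<^sub>M borel"
    by (auto intro!: borel_measurable_continuous_onI continuous_intros)
  have eq: "lborel = density (distr lborel borel ?L) (\<lambda>_. ennreal \<bar>a * d\<bar>)"
  proof (rule measure_eqI)
    fix A :: "(real\<times>real) set" assume "A \<in> sets lborel"
    then have [measurable]: "A \<in> sets borel" by simp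
    have "emeasure lborel A = (\<integral>\<^sup>+t. indicator A t \<partial>lborel)" by simp
    also have "\<dots> = ennreal \<bar>a * d\<bar> * (\<integral>\<^sup>+s. indicator A (?L s) \<partial>lborel)"
      using assms by (intro lborel2_nn_integral_shear) auto
    also have "\<dots> = emeasure (density (distr lborel borel ?L) (\<lambda>_. ennreal \<bar>a * d\<bar>)) A"
      by (simp add: emeasure_density nn_integral_cmult nn_integral_distr del: nn_integral_indicator)
    finally show "emeasure lborel A = \<dots>" .
  qed simp
  show "(LINT t|lborel. f t) = \<bar>a * d\<bar> *\<^sub>R (LINT s|lborel. f (?L s))"
    by (subst eq) (simp add: integral_density integral_distr)
  show "integrable lborel (\<lambda>s. f (?L s)) \<Longrightarrow> integrable lborel f"
    by (subst eq) (simp add: integrable_density integrable_distr_eq)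
qed

definition gauss_wave2 :: "real \<times> real \<Rightarrow> real \<times> real \<Rightarrow> complex" where
  "gauss_wave2 y s = gauss_wave (fst y) (fst s) * gauss_wave (snd y) (snd s)"

lemma gauss_wave2_monomial:
  shows "integrable lborel (\<lambda>s. of_real (fst s ^ a * snd s ^ b) * gauss_wave2 y s)"
    and "(LINT s|lborel. of_real (fst s ^ a * snd s ^ b) * gauss_wave2 y s)
      = gauss_wave_moment a (fst y) * gauss_wave_moment b (snd y)"
  using lborel2_integral_times[OF integrable_gauss_wave[of a "fst y"] integrable_gauss_wave[of b "snd y"]]
  by (simp_all add: gauss_wave2_def gauss_wave_moment_def mult_ac)

lemma gauss_wave2_hpoly_integrable:
  "hpoly n f \<Longrightarrow> integrable lborel (\<lambda>s. of_real (fst s ^ a * snd s ^ b * f s) * gauss_wave2 y s)"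
proof (induction n arbitrary: f a b)
  case 0
  then obtain c where c: "f = (\<lambda>_. c)" by (elim hpoly_0E)
  show ?case
    using integrable_mult_right[OF gauss_wave2_monomial(1)[of a b y], of "of_real c"]
    by (simp add: c mult_ac)
next
  case (Suc n)
  from Suc.prems obtain u v where uv: "hpoly n u" "hpoly n v"
    and f: "f = (\<lambda>t. fst t *\<^sub>R u t + snd t *\<^sub>R v t)" by (elim hpoly_SucE)
  show ?case
    using Bochner_Integration.integrable_add[OF Suc.IH[OF uv(1), of "Suc a" b] Suc.IH[OF uv(2), of a "Suc b"]]
    by (simp add: f algebra_simps)
qed

text \<open>
  The Hermite polynomials of odd total degree have no constant term. This is where the factor
  \<open>|y| + |y|\<^sup>3\<close> of the theorem comes from.
\<close>

lemma gauss_wave_moment_odd_product_bound: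
  assumes "a + b = 1 \<or> a + b = 3"
  shows "norm (gauss_wave_moment a (fst y) * gauss_wave_moment b (snd y))
     \<le> 8 * pi * (norm y + norm y ^ 3) * exp (- (norm y)\<^sup>2 / 2)"
proof -
  define N where "N = norm y"
  obtain y1 y2 where y: "y = (y1, y2)" by (cases y)
  have N0: "N \<ge> 0" and le1: "\<bar>y1\<bar> \<le> N" and le2: "\<bar>y2\<bar> \<le> N" and N2: "N\<^sup>2 = y1\<^sup>2 + y2\<^sup>2"
    using norm_fst_le[of y1 y2] norm_snd_le[of y2 y1] by (auto simp: N_def y norm_Pair)
  define H :: "nat \<Rightarrow> real \<Rightarrow> real" where
    "H k x = (if k = 0 then 1 else if k = 1 then x else if k = 2 then 1 - x\<^sup>2 else 3 * x - x ^ 3)" for k x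
  have norm_gw: "norm (gauss_wave_moment k x) = \<bar>H k x\<bar> * (sqrt (2*pi) * exp (- x\<^sup>2 / 2))" if "k \<le> 3" for k x
  proof -
    have 0: "norm (gauss_wave_moment 0 x) = sqrt (2*pi) * exp (- x\<^sup>2 / 2)"
      unfolding gauss_wave_moment_0 norm_of_real by simp
    have "k = 0 \<or> k = 1 \<or> k = 2 \<or> k = 3" using that by auto
    then show ?thesis
      by (elim disjE) (simp_all only: gauss_wave_moment_123 norm_mult norm_of_real norm_ii norm_minus_cancel 0,
         simp_all add: H_def)
  qed
  have bnd: "\<bar>H 0 x\<bar> \<le> 1" "\<bar>H 1 x\<bar> \<le> N" "\<bar>H 2 x\<bar> \<le> 1 + N\<^sup>2" "\<bar>H 3 x\<bar> \<le> 3 * N + N ^ 3"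
    if "\<bar>x\<bar> \<le> N" for x
  proof -
    have 2: "x\<^sup>2 \<le> N\<^sup>2" using that N0 by (metis abs_le_square_iff abs_of_nonneg)
    have 3: "\<bar>x ^ 3\<bar> \<le> N ^ 3" using that by (simp add: power_abs power_mono)
    show "\<bar>H 0 x\<bar> \<le> 1" "\<bar>H 1 x\<bar> \<le> N" using that by (auto simp: H_def)
    show "\<bar>H 2 x\<bar> \<le> 1 + N\<^sup>2" using 2 zero_le_power2[of x] by (simp add: H_def abs_le_iff)
    show "\<bar>H 3 x\<bar> \<le> 3 * N + N ^ 3" using 3 that by (simp add: H_def abs_le_iff)
  qed
  have H: "\<bar>H a y1\<bar> * \<bar>H b y2\<bar> \<le> 4 * (N + N ^ 3)"
  proof -
    note b1 = bnd[OF le1] and b2 = bnd[OF le2]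
    have pos: "0 \<le> (1::real)" "0 \<le> 1 + N\<^sup>2" "0 \<le> 3 * N + N ^ 3" using N0 by auto
    have "\<bar>H 0 y1\<bar> * \<bar>H 1 y2\<bar> \<le> 1 * N" "\<bar>H 1 y1\<bar> * \<bar>H 0 y2\<bar> \<le> N * 1"
      "\<bar>H 0 y1\<bar> * \<bar>H 3 y2\<bar> \<le> 1 * (3 * N + N ^ 3)" "\<bar>H 1 y1\<bar> * \<bar>H 2 y2\<bar> \<le> N * (1 + N\<^sup>2)"
      "\<bar>H 2 y1\<bar> * \<bar>H 1 y2\<bar> \<le> (1 + N\<^sup>2) * N" "\<bar>H 3 y1\<bar> * \<bar>H 0 y2\<bar> \<le> (3 * N + N ^ 3) * 1"
      by (rule mult_mono[OF b1(1) b2(2) pos(1) abs_ge_zero] mult_mono[OF b1(2) b2(1) N0 abs_ge_zero]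
          mult_mono[OF b1(1) b2(4) pos(1) abs_ge_zero] mult_mono[OF b1(2) b2(3) N0 abs_ge_zero]
          mult_mono[OF b1(3) b2(2) pos(2) abs_ge_zero] mult_mono[OF b1(4) b2(1) pos(3) abs_ge_zero])+
    moreover have "(a = 0 \<and> b = 1) \<or> (a = 1 \<and> b = 0) \<or> (a = 0 \<and> b = 3) \<or> (a = 1 \<and> b = 2)
       \<or> (a = 2 \<and> b = 1) \<or> (a = 3 \<and> b = 0)" using assms by auto
    moreover have "N * (1 + N\<^sup>2) = N + N ^ 3" "(1 + N\<^sup>2) * N = N + N ^ 3"
      by (auto simp: power2_eq_square power3_eq_cube algebra_simps)
    moreover have "z \<le> 4 * (N + P)" if "0 \<le> P" "z \<le> N \<or> z \<le> 3 * N + P \<or> z \<le> N + P" for z P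
      using that N0 by auto
    from this[of "N ^ 3", OF zero_le_power[OF N0]]
    have "z \<le> 4 * (N + N ^ 3)" if "z \<le> N \<or> z \<le> 3 * N + N ^ 3 \<or> z \<le> N + N ^ 3" for z
      using that by blast
    ultimately show ?thesis
      by (elim disjE conjE; simp only: mult_1_left mult_1_right; blast)
  qed
  have ab: "a \<le> 3" "b \<le> 3" using assms by auto
  have "norm (gauss_wave_moment a (fst y) * gauss_wave_moment b (snd y))
      = (\<bar>H a y1\<bar> * \<bar>H b y2\<bar>) * (2 * pi * exp (- N\<^sup>2 / 2))"
  proof -
    have e1: "sqrt (2*pi) * sqrt (2*pi) = 2 * pi" by simp
    have e2: "exp (- y1\<^sup>2 / 2) * exp (- y2\<^sup>2 / 2) = exp (- N\<^sup>2 / 2)"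
      unfolding exp_add[symmetric] N2 by (simp add: add_divide_distrib)
    have e3: "(p * (r * e)) * (q * (r * e')) = (p * q) * ((r * r) * (e * e'))" for p q r e e' :: real
      by simp
    show ?thesis
      unfolding norm_mult y fst_conv snd_conv norm_gw[OF ab(1)] norm_gw[OF ab(2)] e3 e1 e2 ..
  qed
  also have "\<dots> \<le> (4 * (N + N ^ 3)) * (2 * pi * exp (- N\<^sup>2 / 2))"
    by (intro mult_right_mono H) auto
  finally show ?thesis by (simp add: N_def algebra_simps)
qed

text \<open>
  The monomial in front of \<open>f\<close> collects the coordinates that are split off \<open>f\<close> in the induction on its
  degree; the total degree stays fixed.
\<close>

lemma gauss_wave2_odd_bound_aux:
  "hpoly n f \<Longrightarrow> a + b + n = 1 \<or> a + b + n = 3 \<Longrightarrow>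
    \<exists>C\<ge>0. \<forall>y. norm (LINT s|lborel. of_real (fst s ^ a * snd s ^ b * f s) * gauss_wave2 y s)
      \<le> C * ((norm y + norm y ^ 3) * exp (- (norm y)\<^sup>2 / 2))"
proof (induction n arbitrary: f a b)
  case 0
  then obtain c where c: "f = (\<lambda>_. c)" by (elim hpoly_0E)
  have "norm (LINT s|lborel. of_real (fst s ^ a * snd s ^ b * f s) * gauss_wave2 y s)
      \<le> \<bar>c\<bar> * (8 * pi) * ((norm y + norm y ^ 3) * exp (- (norm y)\<^sup>2 / 2))" for y
  proof -
    have "(LINT s|lborel. of_real (fst s ^ a * snd s ^ b * f s) * gauss_wave2 y s)
      = (LINT s|lborel. of_real c * (of_real (fst s ^ a * snd s ^ b) * gauss_wave2 y s))"
      by (simp add: c mult_ac)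
    also have "\<dots> = of_real c * (gauss_wave_moment a (fst y) * gauss_wave_moment b (snd y))"
      by (simp only: integral_mult_right_zero gauss_wave2_monomial)
    finally show ?thesis
      using mult_left_mono[OF gauss_wave_moment_odd_product_bound[of a b y], of "\<bar>c\<bar>"] 0(2)
      by (simp only: norm_mult norm_of_real mult.assoc abs_ge_zero) simp
  qed
  then show ?case by (intro exI[of _ "\<bar>c\<bar> * (8 * pi)"]) auto
next
  case (Suc n)
  from Suc.prems(1) obtain u v where uv: "hpoly n u" "hpoly n v"
    and f: "f = (\<lambda>t. fst t *\<^sub>R u t + snd t *\<^sub>R v t)" by (elim hpoly_SucE)
  obtain A where A: "A \<ge> 0" "\<And>y. norm (LINT s|lborel. of_real (fst s ^ Suc a * snd s ^ b * u s) * gauss_wave2 y s)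
      \<le> A * ((norm y + norm y ^ 3) * exp (- (norm y)\<^sup>2 / 2))"
    using Suc.IH[OF uv(1), of "Suc a" b] Suc.prems(2) by auto
  obtain B where B: "B \<ge> 0" "\<And>y. norm (LINT s|lborel. of_real (fst s ^ a * snd s ^ Suc b * v s) * gauss_wave2 y s)
      \<le> B * ((norm y + norm y ^ 3) * exp (- (norm y)\<^sup>2 / 2))"
    using Suc.IH[OF uv(2), of a "Suc b"] Suc.prems(2) by auto
  have "(LINT s|lborel. of_real (fst s ^ a * snd s ^ b * f s) * gauss_wave2 y s)
     = (LINT s|lborel. of_real (fst s ^ Suc a * snd s ^ b * u s) * gauss_wave2 y s)
      + (LINT s|lborel. of_real (fst s ^ a * snd s ^ Suc b * v s) * gauss_wave2 y s)" for y
    using Bochner_Integration.integral_add[OF gauss_wave2_hpoly_integrable[OF uv(1), of "Suc a" b y]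
      gauss_wave2_hpoly_integrable[OF uv(2), of a "Suc b" y]]
    by (simp add: f algebra_simps)
  then have "norm (LINT s|lborel. of_real (fst s ^ a * snd s ^ b * f s) * gauss_wave2 y s)
    \<le> (A + B) * ((norm y + norm y ^ 3) * exp (- (norm y)\<^sup>2 / 2))" for y
    using A(2)[of y] B(2)[of y] by (simp only: distrib_right) (intro order.trans[OF norm_triangle_ineq] add_mono)
  with A(1) B(1) show ?case by (intro exI[of _ "A + B"]) auto
qed

lemma gauss_wave2_odd_bound:
  assumes "hpoly n f" "n = 1 \<or> n = 3"
  shows "\<exists>C\<ge>0. \<forall>y. norm (LINT s|lborel. of_real (f s) * gauss_wave2 y s)
      \<le> C * ((norm y + norm y ^ 3) * exp (- (norm y)\<^sup>2 / 2))"
  using gauss_wave2_odd_bound_aux[OF assms(1), of 0 0] assms(2) by simp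

section \<open>Gaussian Fourier transforms for a general covariance\<close>

definition quad_form :: "real \<Rightarrow> real \<Rightarrow> real \<Rightarrow> real \<times> real \<Rightarrow> real" where
  "quad_form a b d t = a * (fst t)\<^sup>2 + 2 * b * fst t * snd t + d * (snd t)\<^sup>2"

text \<open>
  For the symmetric matrix \<open>S\<close> with entries \<open>a, b, d\<close>, the Cayley-Hamilton theorem gives
  \<open>tr(S) (t\<cdot>St) - det(S) |t|\<^sup>2 = |St|\<^sup>2 \<ge> 0\<close>.
\<close>

lemma quad_form_lower_bound:
  assumes "a > 0" "a * d - b\<^sup>2 > 0"
  shows "(a * d - b\<^sup>2) / (a + d) * (norm t)\<^sup>2 \<le> quad_form a b d t"
proof -
  obtain x y where t: "t = (x, y)" by (cases t)
  have "a * d > 0" using assms(2) zero_le_power2[of b] by linarith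
  then have "d > 0" using assms(1) by (simp add: zero_less_mult_iff)
  have "(a + d) * quad_form a b d t - (a * d - b\<^sup>2) * (norm t)\<^sup>2 = (a * x + b * y)\<^sup>2 + (b * x + d * y)\<^sup>2"
    by (simp add: t quad_form_def norm_Pair algebra_simps power2_eq_square)
  then have "0 \<le> (a + d) * quad_form a b d t - (a * d - b\<^sup>2) * (norm t)\<^sup>2"
    by simp
  then have "(a * d - b\<^sup>2) * (norm t)\<^sup>2 \<le> quad_form a b d t * (a + d)"
    by (simp only: diff_ge_0_iff_ge mult.commute)
  with \<open>a > 0\<close> \<open>d > 0\<close> show ?thesis
    by (simp only: times_divide_eq_left pos_divide_le_eq add_pos_pos)
qed

definition gauss_fourier :: "(real \<times> real \<Rightarrow> real) \<Rightarrow> real \<Rightarrow> real \<times> real \<Rightarrow> real \<times> real \<Rightarrow> complex" where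
  "gauss_fourier q n x t = of_real (exp (- n * q t / 2)) * cis (- (fst t * fst x + snd t * snd x))"

lemma gauss_fourier_measurable [measurable]:
  "gauss_fourier (quad_form a b d) n x \<in> borel_measurable borel"
  unfolding gauss_fourier_def[abs_def] quad_form_def cis_conv_exp
  by (intro borel_measurable_continuous_onI continuous_intros) simp_all

context
  fixes a b d :: real
  assumes a: "a > 0" and D: "a * d - b\<^sup>2 > 0"
begin

text \<open>
  If \<open>t = L s\<close> is the substitution that turns \<open>quad_form a b d t\<close> into \<open>|s|\<^sup>2\<close>, this is the transpose of
  \<open>L\<close>, so that \<open>t\<cdot>x = s\<cdot>(dual_coord x)\<close>.
\<close>

definition dual_coord :: "real \<times> real \<Rightarrow> real \<times> real" where
  "dual_coord x = (fst x / sqrt a, (snd x - b / a * fst x) / sqrt ((a * d - b\<^sup>2) / a))"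

lemma norm_dual_coord:
  "(norm (dual_coord x))\<^sup>2 = quad_form d (- b) a x / (a * d - b\<^sup>2)"
proof -
  let ?D = "a * d - b\<^sup>2"
  have "(norm (dual_coord x))\<^sup>2 = (fst x)\<^sup>2 / a + (snd x - b / a * fst x)\<^sup>2 / (?D / a)"
    using a D by (simp add: dual_coord_def norm_Pair power_divide)
  also have "\<dots> = quad_form d (- b) a x / ?D"
  proof -
    have "(a * snd x - b * fst x)\<^sup>2 + ?D * (fst x)\<^sup>2 = a * quad_form d (- b) a x"
      by (simp add: quad_form_def algebra_simps power2_eq_square)
    then have "quad_form d (- b) a x = ((a * snd x - b * fst x)\<^sup>2 + ?D * (fst x)\<^sup>2) / a"
      using a by (simp add: field_simps)
    moreover have "(snd x - b / a * fst x)\<^sup>2 / (?D / a) = (a * snd x - b * fst x)\<^sup>2 / a / ?D"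
    proof -
      have "snd x - b / a * fst x = (a * snd x - b * fst x) / a" using a by (simp add: field_simps)
      then show ?thesis using a by (simp add: power_divide power2_eq_square)
    qed
    ultimately show ?thesis
      using D by (simp only: add_divide_distrib) simp
  qed
  finally show ?thesis .
qed

lemma dual_coord_bound: "\<exists>K>0. \<forall>x. norm (dual_coord x) \<le> K * norm x"
proof -
  have "bounded_linear dual_coord"
    unfolding dual_coord_def[abs_def] divide_inverse
    by (intro bounded_linear_Pair bounded_linear_mult_const bounded_linear_sub
        bounded_linear_const_mult bounded_linear_fst bounded_linear_snd)
  from bounded_linear.pos_bounded[OF this] show ?thesis by (auto simp: mult.commute)
qed

lemma gauss_fourier_shear:
  assumes n: "n > (0::real)"
  defines "s1 \<equiv> 1 / sqrt n / sqrt a" and "s2 \<equiv> - (1 / sqrt n * (b / a) / sqrt ((a * d - b\<^sup>2) / a))"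
    and "s3 \<equiv> 1 / sqrt n / sqrt ((a * d - b\<^sup>2) / a)"
  shows "gauss_fourier (quad_form a b d) n x (s1 * fst s + s2 * snd s, s3 * snd s)
    = gauss_wave2 (dual_coord ((1 / sqrt n) *\<^sub>R x)) s"
    and "s1 \<noteq> 0" "s3 \<noteq> 0" "\<bar>s1 * s3\<bar> = 1 / (n * sqrt (a * d - b\<^sup>2))"
proof -
  define e where "e = (a * d - b\<^sup>2) / a"
  have e: "e > 0" using a D by (simp add: e_def)
  have d: "d = e + b\<^sup>2 / a" using a by (simp add: e_def field_simps)
  define t where "t = (s1 * fst s + s2 * snd s, s3 * snd s)"
  have s: "s1 = 1 / (sqrt n * sqrt a)" "s2 = - (b / a / (sqrt n * sqrt e))" "s3 = 1 / (sqrt n * sqrt e)"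
    by (simp_all add: s1_def s2_def s3_def e_def)
  have s23: "s2 = - (b / a) * s3" by (simp add: s)
  have q: "quad_form a b d t = a * (fst t + b / a * snd t)\<^sup>2 + e * (snd t)\<^sup>2"
    using a by (simp add: quad_form_def d power2_eq_square field_simps)
  also have "fst t + b / a * snd t = s1 * fst s" by (simp add: t_def s23)
  also have "a * (s1 * fst s)\<^sup>2 + e * (snd t)\<^sup>2 = (fst s)\<^sup>2 / n + (snd s)\<^sup>2 / n"
    using a e n by (simp add: t_def s power_mult_distrib power_divide)
  finally have Q: "- n * quad_form a b d t / 2 = - (fst s)\<^sup>2 / 2 + - (snd s)\<^sup>2 / 2"
    using n by (simp add: field_simps)
  have dc: "dual_coord z = (fst z / sqrt a, (snd z - b / a * fst z) / sqrt e)" for z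
    by (simp add: dual_coord_def e_def)
  have "fst t * fst x + snd t * snd x
     = fst s * fst (dual_coord ((1 / sqrt n) *\<^sub>R x)) + snd s * snd (dual_coord ((1 / sqrt n) *\<^sub>R x))"
    by (simp add: t_def s23 s dc diff_divide_distrib algebra_simps)
  then have "- (fst t * fst x + snd t * snd x) = - (fst s * fst (dual_coord ((1 / sqrt n) *\<^sub>R x)))
      + - (snd s * snd (dual_coord ((1 / sqrt n) *\<^sub>R x)))" by simp
  then show "gauss_fourier (quad_form a b d) n x t = gauss_wave2 (dual_coord ((1 / sqrt n) *\<^sub>R x)) s"
    unfolding gauss_fourier_def Q gauss_wave2_def gauss_wave_def
    by (simp only: exp_add cis_mult[symmetric] of_real_mult mult_ac)
  show "s1 \<noteq> 0" "s3 \<noteq> 0" using a e n by (auto simp: s)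
  have "sqrt a * sqrt e = sqrt (a * d - b\<^sup>2)"
    using a by (simp add: real_sqrt_mult[symmetric] e_def)
  moreover have "s1 * s3 = 1 / ((sqrt n * sqrt n) * (sqrt a * sqrt e))"
    by (simp add: s)
  ultimately show "\<bar>s1 * s3\<bar> = 1 / (n * sqrt (a * d - b\<^sup>2))"
    using n D by simp
qed

text \<open>
  Rescaling by \<open>1/\<surd>n\<close> multiplies a form of degree \<open>k\<close> by \<open>n\<^sup>-\<^sup>k\<^sup>/\<^sup>2\<close> and the volume by \<open>1/n\<close>; one form \<open>h\<close>
  then serves all \<open>n\<close>.
\<close>

lemma gauss_fourier_hpoly_subst:
  assumes f: "hpoly k f"
  shows "\<exists>h. hpoly k h \<and> (\<forall>n>0::real. \<forall>x.
     integrable lborel (\<lambda>t. of_real (f t) * gauss_fourier (quad_form a b d) n x t) \<and>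
     (LINT t|lborel. of_real (f t) * gauss_fourier (quad_form a b d) n x t)
      = of_real (1 / (n * sqrt (a * d - b\<^sup>2)) * (1 / sqrt n) ^ k) *
        (LINT s|lborel. of_real (h s) * gauss_wave2 (dual_coord ((1 / sqrt n) *\<^sub>R x)) s))"
proof -
  define e where "e = sqrt ((a * d - b\<^sup>2) / a)"
  define h where "h = (\<lambda>s. f (1 / sqrt a * fst s + - (b / a / e) * snd s, 0 * fst s + 1 / e * snd s))"
  have h: "hpoly k h" unfolding h_def by (rule hpoly_linear_subst[OF f])
  have [measurable]: "f \<in> borel_measurable borel" by (rule hpoly_measurable[OF f])
  show ?thesis
  proof (intro exI[of _ h] conjI h allI impI)
    fix n :: real and x :: "real \<times> real" assume n: "n > 0"
    let ?s1 = "1 / sqrt n / sqrt a" and ?s2 = "- (1 / sqrt n * (b / a) / sqrt ((a * d - b\<^sup>2) / a))"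
    let ?s3 = "1 / sqrt n / sqrt ((a * d - b\<^sup>2) / a)"
    let ?F = "\<lambda>t. of_real (f t) * gauss_fourier (quad_form a b d) n x t"
    note shear = gauss_fourier_shear[OF n]
    have [measurable]: "?F \<in> borel_measurable borel" by measurable
    have fh: "f (?s1 * fst s + ?s2 * snd s, ?s3 * snd s) = (1 / sqrt n) ^ k * h s" for s
    proof -
      have "(?s1 * fst s + ?s2 * snd s, ?s3 * snd s)
        = (1 / sqrt n) *\<^sub>R (1 / sqrt a * fst s + - (b / a / e) * snd s, 0 * fst s + 1 / e * snd s)"
        unfolding e_def[symmetric] by (simp add: algebra_simps diff_divide_distrib)
      then show ?thesis
        unfolding h_def by (simp only: hpoly_scale[OF f] real_scaleR_def)
    qed
    have FL: "(\<lambda>s. ?F (?s1 * fst s + ?s2 * snd s, ?s3 * snd s))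
      = (\<lambda>s. of_real ((1 / sqrt n) ^ k) * (of_real (h s) * gauss_wave2 (dual_coord ((1 / sqrt n) *\<^sub>R x)) s))"
      unfolding shear(1) fh by (simp add: mult_ac)
    have int: "integrable lborel (\<lambda>s. of_real ((1 / sqrt n) ^ k) * (of_real (h s) * gauss_wave2 (dual_coord ((1 / sqrt n) *\<^sub>R x)) s))"
      using gauss_wave2_hpoly_integrable[OF h, of 0 0] by (intro integrable_mult_right) simp
    show "integrable lborel ?F"
      by (rule lborel2_integral_shear(2)[of ?F ?s1 ?s3 ?s2]) (use shear(2,3) int FL in \<open>simp_all only:\<close>, measurable)
    have "(LINT t|lborel. ?F t) = \<bar>?s1 * ?s3\<bar> *\<^sub>R (LINT s|lborel. ?F (?s1 * fst s + ?s2 * snd s, ?s3 * snd s))"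
      by (rule lborel2_integral_shear(1)[OF _ shear(2,3)]) measurable
    also have "\<dots> = \<bar>?s1 * ?s3\<bar> *\<^sub>R (of_real ((1 / sqrt n) ^ k) * (LINT s|lborel. of_real (h s) * gauss_wave2 (dual_coord ((1 / sqrt n) *\<^sub>R x)) s))"
      unfolding FL by (simp only: integral_mult_right_zero)
    finally show "(LINT t|lborel. ?F t) = of_real (1 / (n * sqrt (a * d - b\<^sup>2)) * (1 / sqrt n) ^ k) *
        (LINT s|lborel. of_real (h s) * gauss_wave2 (dual_coord ((1 / sqrt n) *\<^sub>R x)) s)"
      unfolding shear(4) scaleR_conv_of_real of_real_mult by (simp only: mult.assoc)
  qed
qed

lemma gauss_fourier_hpoly_integrable:
  assumes "n > 0" "hpoly k f"
  shows "integrable lborel (\<lambda>t. of_real (f t) * gauss_fourier (quad_form a b d) n x t)"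
  using gauss_fourier_hpoly_subst[OF assms(2)] assms(1) by blast

lemma gauss_fourier_transform:
  assumes n: "n > 0"
  shows "integrable lborel (gauss_fourier (quad_form a b d) n x)"
    and "(LINT t|lborel. gauss_fourier (quad_form a b d) n x t)
      = of_real (2 * pi / (n * sqrt (a * d - b\<^sup>2)) * exp (- (quad_form d (- b) a x / (a * d - b\<^sup>2)) / (2 * n)))"
proof -
  show "integrable lborel (gauss_fourier (quad_form a b d) n x)"
    using gauss_fourier_hpoly_integrable[OF n hpoly_const[of 1]] by simp
  let ?y = "dual_coord ((1 / sqrt n) *\<^sub>R x)"
  let ?s1 = "1 / sqrt n / sqrt a" and ?s2 = "- (1 / sqrt n * (b / a) / sqrt ((a * d - b\<^sup>2) / a))"
  let ?s3 = "1 / sqrt n / sqrt ((a * d - b\<^sup>2) / a)"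
  have "(LINT t|lborel. gauss_fourier (quad_form a b d) n x t)
     = of_real (1 / (n * sqrt (a * d - b\<^sup>2))) * (LINT s|lborel. gauss_wave2 ?y s)"
    using lborel2_integral_shear(1)[OF gauss_fourier_measurable gauss_fourier_shear(2,3)[OF n], of a b d n x ?s2]
    unfolding gauss_fourier_shear(1,4)[OF n] scaleR_conv_of_real .
  also have "(LINT s|lborel. gauss_wave2 ?y s) = of_real (2 * pi * exp (- (norm ?y)\<^sup>2 / 2))"
  proof -
    obtain y1 y2 where y: "?y = (y1, y2)" by (cases ?y)
    have e1: "sqrt (2*pi) * sqrt (2*pi) = 2 * pi" by simp
    have e2: "exp (- y1\<^sup>2 / 2) * exp (- y2\<^sup>2 / 2) = exp (- (norm (y1, y2))\<^sup>2 / 2)"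
      unfolding exp_add[symmetric] by (simp add: add_divide_distrib norm_Pair)
    have e3: "(r * e) * (r * e') = (r * r) * (e * e')" for r e e' :: real
      by simp
    show ?thesis
      using gauss_wave2_monomial(2)[of 0 0 ?y]
      unfolding y gauss_wave_moment_0 fst_conv snd_conv of_real_mult[symmetric] e3 e1 e2 by simp
  qed
  also have "(norm ?y)\<^sup>2 = (quad_form d (- b) a x / (a * d - b\<^sup>2)) / n"
  proof -
    have "quad_form d (- b) a ((1 / sqrt n) *\<^sub>R x) = quad_form d (- b) a x / n"
      using n by (simp add: quad_form_def power_divide add_divide_distrib diff_divide_distrib)
    then show ?thesis unfolding norm_dual_coord by simp
  qed
  finally show "(LINT t|lborel. gauss_fourier (quad_form a b d) n x t)
      = of_real (2 * pi / (n * sqrt (a * d - b\<^sup>2)) * exp (- (quad_form d (- b) a x / (a * d - b\<^sup>2)) / (2 * n)))"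
    unfolding of_real_mult[symmetric] by (simp add: mult_ac)
qed

lemma gauss_fourier_odd_bound:
  assumes f: "hpoly k f" and k: "k = 1 \<or> k = 3"
  shows "\<exists>C\<ge>0. \<forall>n>0. \<forall>x. norm (LINT t|lborel. of_real (f t) * gauss_fourier (quad_form a b d) n x t)
    \<le> C * (1 / n * (1 / sqrt n) ^ k * (norm x / sqrt n + (norm x / sqrt n) ^ 3)
         * exp (- (quad_form d (- b) a x / (a * d - b\<^sup>2)) / (2 * n)))"
proof -
  obtain h where h: "hpoly k h" and sub: "\<And>n x. n > 0 \<Longrightarrow> (LINT t|lborel. of_real (f t) * gauss_fourier (quad_form a b d) n x t)
      = of_real (1 / (n * sqrt (a * d - b\<^sup>2)) * (1 / sqrt n) ^ k) *
        (LINT s|lborel. of_real (h s) * gauss_wave2 (dual_coord ((1 / sqrt n) *\<^sub>R x)) s)"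
    using gauss_fourier_hpoly_subst[OF f] by blast
  obtain C where C: "C \<ge> 0" "\<And>y. norm (LINT s|lborel. of_real (h s) * gauss_wave2 y s)
      \<le> C * ((norm y + norm y ^ 3) * exp (- (norm y)\<^sup>2 / 2))"
    using gauss_wave2_odd_bound[OF h k] by blast
  obtain K where K: "K > 0" "\<And>x. norm (dual_coord x) \<le> K * norm x"
    using dual_coord_bound by blast
  let ?D = "sqrt (a * d - b\<^sup>2)"
  have D0: "?D > 0" using D by simp
  show ?thesis
  proof (intro exI[of _ "1 / ?D * C * (K + K ^ 3)"] conjI allI impI)
    show "1 / ?D * C * (K + K ^ 3) \<ge> 0" using C(1) K(1) D0 by simp
    fix n :: real and x :: "real \<times> real" assume n: "n > 0"
    define y where "y = dual_coord ((1 / sqrt n) *\<^sub>R x)"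
    define z where "z = norm x / sqrt n"
    have z0: "z \<ge> 0" using n by (simp add: z_def)
    have yz: "norm y \<le> K * z"
      using K(2)[of "(1 / sqrt n) *\<^sub>R x"] n by (simp add: y_def z_def)
    have y2: "(norm y)\<^sup>2 = (quad_form d (- b) a x / (a * d - b\<^sup>2)) / n"
    proof -
      have "quad_form d (- b) a ((1 / sqrt n) *\<^sub>R x) = quad_form d (- b) a x / n"
        using n by (simp add: quad_form_def power_divide add_divide_distrib diff_divide_distrib)
      then show ?thesis unfolding norm_dual_coord y_def by simp
    qed
    have "norm y + norm y ^ 3 \<le> K * z + (K * z) ^ 3"
      using yz by (intro add_mono power_mono) auto
    also have "\<dots> \<le> (K + K ^ 3) * (z + z ^ 3)"
      using K(1) z0 by (simp add: power_mult_distrib algebra_simps)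
    finally have p: "norm y + norm y ^ 3 \<le> (K + K ^ 3) * (z + z ^ 3)" .
    define E where "E = exp (- (norm y)\<^sup>2 / 2)"
    have EE: "E = exp (- (quad_form d (- b) a x / (a * d - b\<^sup>2)) / (2 * n))"
      unfolding E_def y2 by (simp add: mult.commute)
    have pos: "1 / (n * ?D) * (1 / sqrt n) ^ k \<ge> 0" using n D0 by simp
    have "norm (LINT t|lborel. of_real (f t) * gauss_fourier (quad_form a b d) n x t)
       = (1 / (n * ?D) * (1 / sqrt n) ^ k) * norm (LINT s|lborel. of_real (h s) * gauss_wave2 y s)"
      unfolding sub[OF n] norm_mult norm_of_real y_def abs_of_nonneg[OF pos] ..
    also have "\<dots> \<le> (1 / (n * ?D) * (1 / sqrt n) ^ k) * (C * (((K + K ^ 3) * (z + z ^ 3)) * E))"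
      unfolding E_def
      by (intro mult_left_mono order.trans[OF C(2)] mult_right_mono p C(1) pos) auto
    also have "\<dots> = 1 / ?D * C * (K + K ^ 3) * (1 / n * (1 / sqrt n) ^ k * (z + z ^ 3) * E)"
      by (simp only: divide_inverse inverse_mult_distrib mult_1_left mult_ac)
    finally show "norm (LINT t|lborel. of_real (f t) * gauss_fourier (quad_form a b d) n x t)
      \<le> 1 / ?D * C * (K + K ^ 3) * (1 / n * (1 / sqrt n) ^ k * (norm x / sqrt n + (norm x / sqrt n) ^ 3)
         * exp (- (quad_form d (- b) a x / (a * d - b\<^sup>2)) / (2 * n)))"
      unfolding EE z_def .
  qed
qed

end

lemma gauss_radial_integral:
  assumes c: "c > 0"
  shows "integrable lborel (\<lambda>t::real\<times>real. exp (- c * (norm t)\<^sup>2))"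
    and "(LINT t::real\<times>real|lborel. exp (- c * (norm t)\<^sup>2)) = pi / c"
proof -
  have cD: "2 * c > 0" "2 * c * (2 * c) - 0\<^sup>2 > 0" using c by auto
  have eq: "gauss_fourier (quad_form (2 * c) 0 (2 * c)) 1 0 = (\<lambda>t. of_real (exp (- c * (norm t)\<^sup>2)))"
    by (auto simp: gauss_fourier_def quad_form_def fun_eq_iff norm_Pair algebra_simps)
  have i: "integrable lborel (\<lambda>t::real\<times>real. complex_of_real (exp (- c * (norm t)\<^sup>2)))"
    using gauss_fourier_transform(1)[OF cD, of 1 0] unfolding eq by simp
  show "integrable lborel (\<lambda>t::real\<times>real. exp (- c * (norm t)\<^sup>2))"
    using i complex_of_real_integrable_eq by blast
  have "complex_of_real (LINT t::real\<times>real|lborel. exp (- c * (norm t)\<^sup>2))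
     = of_real (2 * pi / (1 * sqrt (2 * c * (2 * c) - 0\<^sup>2)))"
    using gauss_fourier_transform(2)[OF cD, of 1 0] unfolding eq integral_complex_of_real
    by (simp add: quad_form_def)
  then have "(LINT t::real\<times>real|lborel. exp (- c * (norm t)\<^sup>2)) = 2 * pi / (1 * sqrt (2 * c * (2 * c) - 0\<^sup>2))"
    by (simp only: of_real_eq_iff)
  also have "2 * c * (2 * c) - 0\<^sup>2 = (2 * c)\<^sup>2" by (simp add: power2_eq_square)
  also have "2 * pi / (1 * sqrt ((2 * c)\<^sup>2)) = pi / c"
    unfolding real_sqrt_abs using c by simp
  finally show "(LINT t::real\<times>real|lborel. exp (- c * (norm t)\<^sup>2)) = pi / c" .
qed

section \<open>The Fourier transform of the step kernel\<close>

lemma integral_bind_pmf_bounded_real: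
  fixes f :: "'a \<Rightarrow> real"
  assumes "\<And>x. \<bar>f x\<bar> \<le> B"
  shows "measure_pmf.expectation (bind_pmf M N) f
    = measure_pmf.expectation M (\<lambda>x. measure_pmf.expectation (N x) f)"
  unfolding measure_pmf_bind
proof (rule integral_bind[where B=B and B'=1 and K="count_space UNIV"])
  show "(\<lambda>x. measure_pmf (N x)) \<in> measurable (measure_pmf M) (subprob_algebra (count_space UNIV))"
    using measurable_measure_pmf[of N] by simp
  show "finite_measure (measure_pmf M)" by (rule measure_pmf.finite_measure_axioms)
qed (use assms in \<open>auto simp: measure_pmf.emeasure_space_1[simplified]\<close>)

lemma integral_bind_pmf_bounded:
  fixes f :: "'a \<Rightarrow> complex"
  assumes "\<And>x. norm (f x) \<le> B"
  shows "measure_pmf.expectation (bind_pmf M N) f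
    = measure_pmf.expectation M (\<lambda>x. measure_pmf.expectation (N x) f)"
proof -
  have int: "integrable (measure_pmf K) f" for K :: "'a pmf"
    by (rule measure_pmf.integrable_const_bound[where B=B]) (use assms in auto)
  have bnd: "norm (measure_pmf.expectation K f) \<le> B" for K :: "'a pmf"
    by (rule order.trans[OF integral_norm_bound measure_pmf.integral_le_const])
      (use assms int in auto)
  have int2: "integrable (measure_pmf M) (\<lambda>x. measure_pmf.expectation (N x) f)"
    by (rule measure_pmf.integrable_const_bound[where B=B]) (use bnd in auto)
  have re: "\<bar>Re (f x)\<bar> \<le> B" and im: "\<bar>Im (f x)\<bar> \<le> B" for x
    using assms[of x] abs_Re_le_cmod[of "f x"] abs_Im_le_cmod[of "f x"] by linarith+
  show ?thesis
  proof (rule complex_eqI)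
    show "Re (measure_pmf.expectation (bind_pmf M N) f)
       = Re (measure_pmf.expectation M (\<lambda>x. measure_pmf.expectation (N x) f))"
      unfolding integral_Re[OF int, symmetric] integral_Re[OF int2, symmetric]
      by (rule integral_bind_pmf_bounded_real[OF re])
    show "Im (measure_pmf.expectation (bind_pmf M N) f)
       = Im (measure_pmf.expectation M (\<lambda>x. measure_pmf.expectation (N x) f))"
      unfolding integral_Im[OF int, symmetric] integral_Im[OF int2, symmetric]
      by (rule integral_bind_pmf_bounded_real[OF im])
  qed
qed

definition tdot :: "real \<times> real \<Rightarrow> int ^ 2 \<Rightarrow> real" where
  "tdot t y = fst t * real_of_int (y $ 1) + snd t * real_of_int (y $ 2)"

lemma tdot_simps:
  "tdot t (x + y) = tdot t x + tdot t y" "tdot t (x - y) = tdot t x - tdot t y"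
  "tdot t (- x) = - tdot t x" "tdot t 0 = 0" "tdot 0 y = 0"
  by (simp_all add: tdot_def algebra_simps)

lemma norm_real_vec_2: "norm (real_vec (y :: int ^ 2)) = norm (real_of_int (y $ 1), real_of_int (y $ 2))"
  by (simp add: norm_vec_def L2_set_def norm_Pair UNIV_2 real_vec_def)

lemma abs_tdot_le: "\<bar>tdot t y\<bar> \<le> norm t * norm (real_vec y)"
proof -
  have "tdot t y = t \<bullet> (real_of_int (y $ 1), real_of_int (y $ 2))"
    by (simp add: tdot_def inner_prod_def)
  then show ?thesis using Cauchy_Schwarz_ineq2 norm_real_vec_2 by metis
qed

definition char_op :: "(2, 's::finite) rw_steps \<Rightarrow> real \<times> real \<Rightarrow> ('s \<Rightarrow> complex) \<Rightarrow> 's \<Rightarrow> complex" where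
  "char_op p t v j = measure_pmf.expectation (p j) (\<lambda>z. cis (tdot t (fst z)) * v (snd z))"

lemma integrable_char:
  fixes v :: "'s::finite \<Rightarrow> complex"
  shows "integrable (measure_pmf P) (\<lambda>z. cis (f z) * v (snd z))"
  by (rule measure_pmf.integrable_const_bound[where B="\<Sum>k\<in>UNIV. norm (v k)"])
    (auto simp: norm_mult intro!: member_le_sum[of _ UNIV "\<lambda>k. norm (v k)"])

lemma char_op_pow_eq_expectation:
  fixes p :: "(2, 's::finite) rw_steps"
  shows "(char_op p t ^^ n) v j
    = measure_pmf.expectation (rw_law p n (0, j)) (\<lambda>z. cis (tdot t (fst z)) * v (snd z))"
proof (induction n arbitrary: v)
  case 0
  show ?case by (simp add: integral_measure_pmf[of "{(0,j)}"] tdot_simps)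
next
  case (Suc n)
  have step: "measure_pmf.expectation (rw_kernel p z) (\<lambda>z. cis (tdot t (fst z)) * v (snd z))
     = cis (tdot t (fst z)) * char_op p t v (snd z)" for z :: "(int ^ 2) \<times> 's"
  proof -
    obtain x i where z: "z = (x, i)" by (cases z)
    show ?thesis
      unfolding z rw_kernel_def char_op_def
      by (simp add: case_prod_beta tdot_simps cis_mult[symmetric] mult.assoc)
  qed
  have bnd: "norm (cis (tdot t (fst z)) * v (snd z)) \<le> (\<Sum>k\<in>UNIV. norm (v k))"
    for z :: "(int ^ 2) \<times> 's"
    by (auto simp: norm_mult intro!: member_le_sum[of _ UNIV "\<lambda>k. norm (v k)"])
  have "(char_op p t ^^ Suc n) v j = (char_op p t ^^ n) (char_op p t v) j"
    by (simp only: funpow_Suc_right comp_apply)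
  also have "\<dots> = measure_pmf.expectation (rw_law p n (0, j)) (\<lambda>z. cis (tdot t (fst z)) * char_op p t v (snd z))"
    by (rule Suc.IH)
  also have "\<dots> = measure_pmf.expectation (rw_law p (Suc n) (0, j)) (\<lambda>z. cis (tdot t (fst z)) * v (snd z))"
    unfolding rw_law.simps integral_bind_pmf_bounded[OF bnd] step ..
  finally show ?case .
qed

lemma char_op_add: "char_op p t (\<lambda>k. u k + v k) j = char_op p t u j + char_op p t v j"
  unfolding char_op_def distrib_left
  by (rule Bochner_Integration.integral_add[OF integrable_char integrable_char])

lemma char_op_mult: "char_op p t (\<lambda>k. c * v k) j = c * char_op p t v j"
  unfolding char_op_def by (simp add: mult.left_commute)

lemma char_op_norm_le:
  assumes "\<And>k. norm (v k) \<le> B"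
  shows "norm (char_op p t v j) \<le> B"
  unfolding char_op_def
  by (rule order.trans[OF integral_norm_bound
        measure_pmf.integral_le_const[OF integrable_norm[OF integrable_char]]])
    (use assms in \<open>auto simp: norm_mult\<close>)

lemma char_op_pow_add:
  "(char_op p t ^^ n) (\<lambda>k. u k + v k) j = (char_op p t ^^ n) u j + (char_op p t ^^ n) v j"
  unfolding char_op_pow_eq_expectation distrib_left
  by (rule Bochner_Integration.integral_add[OF integrable_char integrable_char])

lemma char_op_pow_mult:
  "(char_op p t ^^ n) (\<lambda>k. c * v k) j = c * (char_op p t ^^ n) v j"
  unfolding char_op_pow_eq_expectation by (simp add: mult.left_commute)

lemma char_op_pow_norm_le:
  assumes "\<And>k. norm (v k) \<le> B"
  shows "norm ((char_op p t ^^ n) v j) \<le> B"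
  using assms by (induction n arbitrary: j) (auto intro: char_op_norm_le)

definition torus_box :: "(real \<times> real) set" where
  "torus_box = {- pi..pi} \<times> {- pi..pi}"

section \<open>Fourier inversion on the torus\<close>

lemma integral_cis_period:
  fixes m :: int
  shows "integrable lborel (\<lambda>s. indicator {- pi..pi} s *\<^sub>R cis (s * m))"
    and "(LINT s|lborel. indicator {- pi..pi} s *\<^sub>R cis (s * m)) = (if m = 0 then 2 * pi else 0)"
proof -
  have cont: "continuous_on {- pi..pi} (\<lambda>s. cis (s * real_of_int m))"
    by (intro continuous_intros)
  show "integrable lborel (\<lambda>s. indicator {- pi..pi} s *\<^sub>R cis (s * m))"
    using borel_integrable_atLeastAtMost'[OF cont] by (simp add: set_integrable_def)
  show "(LINT s|lborel. indicator {- pi..pi} s *\<^sub>R cis (s * m)) = (if m = 0 then 2 * pi else 0)"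
  proof (cases "m = 0")
    case True
    have "(LINT s|lborel. indicator {- pi..pi} s *\<^sub>R cis (s * m)) = complex_of_real pi - complex_of_real (- pi)"
      using cont
      by (intro integral_FTC_atLeastAtMost[where F="\<lambda>s. of_real s"])
        (auto simp: True intro!: derivative_eq_intros has_vector_derivative_of_real)
    then show ?thesis by (simp add: True)
  next
    case False
    have d: "((\<lambda>s. cis (s * real_of_int m) / (\<i> * of_int m)) has_vector_derivative cis (s * m)) (at s within A)" for s :: real and A
    proof -
      have "((\<lambda>s. \<i> * of_real (s * m)) has_vector_derivative \<i> * of_real m) (at s within A)"
        by (intro has_vector_derivative_mult_right has_vector_derivative_of_real)
           (auto intro!: derivative_eq_intros)
      from field_vector_diff_chain_within[OF this, of exp "exp (\<i> * of_real (s * m))"]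
      have "((\<lambda>s. cis (s * m)) has_vector_derivative \<i> * of_real m * cis (s * m)) (at s within A)"
        by (simp add: cis_conv_exp o_def DERIV_exp has_field_derivative_at_within)
      then have "((\<lambda>s. cis (s * m) / (\<i> * of_int m)) has_vector_derivative \<i> * of_real m * cis (s * m) / (\<i> * of_int m)) (at s within A)"
        by (rule has_vector_derivative_divide)
      then show ?thesis using False by simp
    qed
    have "(LINT s|lborel. indicator {- pi..pi} s *\<^sub>R cis (s * m))
      = cis (pi * m) / (\<i> * of_int m) - cis (- pi * m) / (\<i> * of_int m)"
      by (rule integral_FTC_atLeastAtMost) (use cont d in auto)
    also have "cis (pi * m) = cis (- pi * m)"
      by (rule complex_eqI) (auto simp: mult.commute)
    finally show ?thesis using False by simp
  qed
qed

lemma integral_cis_torus_box: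
  shows "integrable lborel (\<lambda>t. indicator torus_box t *\<^sub>R cis (tdot t y))"
    and "(LINT t|lborel. indicator torus_box t *\<^sub>R cis (tdot t y)) = (if y = 0 then (2 * pi)\<^sup>2 else 0)"
proof -
  have eq: "(\<lambda>t. indicator torus_box t *\<^sub>R cis (tdot t y))
    = (\<lambda>t. (indicator {- pi..pi} (fst t) *\<^sub>R cis (fst t * (y $ 1))) * (indicator {- pi..pi} (snd t) *\<^sub>R cis (snd t * (y $ 2))))"
    by (auto simp: fun_eq_iff torus_box_def indicator_def tdot_def cis_mult mem_Times_iff)
  show "integrable lborel (\<lambda>t. indicator torus_box t *\<^sub>R cis (tdot t y))"
    unfolding eq by (intro lborel2_integral_times integral_cis_period)
  have "y = 0 \<longleftrightarrow> y $ 1 = 0 \<and> y $ 2 = 0"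
    by (auto simp: vec_eq_iff forall_2)
  then show "(LINT t|lborel. indicator torus_box t *\<^sub>R cis (tdot t y)) = (if y = 0 then (2 * pi)\<^sup>2 else 0)"
    unfolding eq lborel2_integral_times(2)[OF integral_cis_period(1) integral_cis_period(1)] integral_cis_period(2)
    by (simp add: power2_eq_square)
qed

lemma tdot_measurable [measurable]: "(\<lambda>t. tdot t y) \<in> borel_measurable borel"
  unfolding tdot_def by (intro borel_measurable_continuous_onI continuous_intros)

lemma torus_box_measurable [measurable]: "torus_box \<in> sets borel"
  unfolding torus_box_def by (intro borel_closed closed_Times) auto

lemma char_kernel_measurable:
  fixes v :: "'s::finite \<Rightarrow> complex"
  shows "(\<lambda>(z, t). cis (tdot t (fst z - x)) * v (snd z)) \<in> borel_measurable (measure_pmf P \<Otimes>\<^sub>M lborel)"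
proof -
  have "(\<lambda>(z, t). cis (tdot t (fst z - x)) * v (snd z)) \<in> borel_measurable (count_space UNIV \<Otimes>\<^sub>M lborel)"
  proof (rule measurable_pair_measure_countable1)
    fix z :: "(int ^ 2) \<times> 's"
    show "(\<lambda>t. case (z, t) of (z, t) \<Rightarrow> cis (tdot t (fst z - x)) * v (snd z)) \<in> borel_measurable lborel"
      unfolding cis_conv_exp by simp
  qed auto
  also have "borel_measurable (count_space UNIV \<Otimes>\<^sub>M lborel) = borel_measurable (measure_pmf P \<Otimes>\<^sub>M (lborel :: (real\<times>real) measure))"
    by (intro measurable_cong_sets sets_pair_measure_cong) auto
  finally show ?thesis .
qed

lemma char_op_pow_measurable [measurable]:
  fixes p :: "(2, 's::finite) rw_steps"
  shows "(\<lambda>t. (char_op p t ^^ n) v j) \<in> borel_measurable borel"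
proof -
  have "(\<lambda>(t, z). cis (tdot t (fst z - 0)) * v (snd z)) \<in> borel_measurable (lborel \<Otimes>\<^sub>M measure_pmf (rw_law p n (0, j)))"
    using char_kernel_measurable[of 0 v "rw_law p n (0, j)"]
    by (subst measurable_pair_swap_iff) (simp add: case_prod_beta)
  from measure_pmf.borel_measurable_lebesgue_integral[OF this] show ?thesis
    unfolding char_op_pow_eq_expectation by simp
qed

text \<open>
  Fubini's theorem moves the integral over the torus inside the expectation, where orthogonality of the
  characters leaves only the atom at \<open>(x, k)\<close>.
\<close>

lemma rw_law_fourier_inversion:
  fixes p :: "(2, 's::finite) rw_steps"
  shows "integrable lborel (\<lambda>t. indicator torus_box t *\<^sub>R (cis (- tdot t x) * (char_op p t ^^ n) (\<lambda>i. of_bool (i = k)) j))"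
    and "complex_of_real ((2 * pi)\<^sup>2 * pmf (rw_law p n (0, j)) (x, k))
    = (LINT t|lborel. indicator torus_box t *\<^sub>R (cis (- tdot t x) * (char_op p t ^^ n) (\<lambda>i. of_bool (i = k)) j))"
proof -
  let ?P = "rw_law p n (0, j)"
  let ?v = "\<lambda>i. of_bool (i = k) :: complex"
  let ?F = "\<lambda>z t. indicator torus_box t *\<^sub>R (cis (tdot t (fst z - x)) * ?v (snd z))"
  interpret pair_sigma_finite "measure_pmf ?P" "lborel :: (real \<times> real) measure" ..
  have box: "emeasure lborel torus_box < \<infinity>"
    unfolding torus_box_def by (simp add: lborel_prod[symmetric] lborel.emeasure_pair_measure_Times ennreal_mult_less_top)
  have int: "integrable (measure_pmf ?P \<Otimes>\<^sub>M lborel) (\<lambda>(z, t). ?F z t)"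
  proof (rule integrableI_bounded_set[where A="UNIV \<times> torus_box" and B=1])
    show "UNIV \<times> torus_box \<in> sets (measure_pmf ?P \<Otimes>\<^sub>M lborel)" by (intro pair_measureI) auto
    show "(\<lambda>(z, t). ?F z t) \<in> borel_measurable (measure_pmf ?P \<Otimes>\<^sub>M lborel)"
      using char_kernel_measurable[of x ?v ?P] unfolding case_prod_beta by measurable
    show "emeasure (measure_pmf ?P \<Otimes>\<^sub>M lborel) (UNIV \<times> torus_box) < \<infinity>"
      using box by (simp add: lborel.emeasure_pair_measure_Times measure_pmf.emeasure_space_1[simplified])
  qed (auto simp: norm_mult indicator_def)
  have inner: "(LINT z|measure_pmf ?P. ?F z t)
      = indicator torus_box t *\<^sub>R (cis (- tdot t x) * (char_op p t ^^ n) ?v j)" for t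
  proof -
    have "(LINT z|measure_pmf ?P. ?F z t)
      = (LINT z|measure_pmf ?P. indicator torus_box t *\<^sub>R (cis (- tdot t x) * (cis (tdot t (fst z)) * ?v (snd z))))"
      by (simp add: tdot_simps mult.assoc[symmetric] cis_mult)
    then show ?thesis
      unfolding char_op_pow_eq_expectation by simp
  qed
  from integrable_snd[OF int] show "integrable lborel (\<lambda>t. indicator torus_box t *\<^sub>R (cis (- tdot t x) * (char_op p t ^^ n) ?v j))"
    unfolding inner .
  have "(LINT t|lborel. indicator torus_box t *\<^sub>R (cis (- tdot t x) * (char_op p t ^^ n) ?v j))
     = (LINT z|measure_pmf ?P. LINT t|lborel. ?F z t)"
    unfolding inner[symmetric] by (rule Fubini_integral[OF int])
  also have "\<dots> = (LINT z|measure_pmf ?P. of_real ((2 * pi)\<^sup>2) * (if z = (x, k) then 1 else 0))"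
  proof (rule Bochner_Integration.integral_cong[OF refl])
    fix z :: "(int ^ 2) \<times> 's"
    have "(LINT t|lborel. ?F z t) = (LINT t|lborel. ?v (snd z) * (indicator torus_box t *\<^sub>R cis (tdot t (fst z - x))))"
      by (simp add: mult.commute)
    also have "\<dots> = ?v (snd z) * (if fst z - x = 0 then (2 * pi)\<^sup>2 else 0)"
      unfolding integral_mult_right_zero integral_cis_torus_box ..
    also have "\<dots> = of_real ((2 * pi)\<^sup>2) * (if z = (x, k) then 1 else 0)"
      by (cases z) auto
    finally show "(LINT t|lborel. ?F z t) = of_real ((2 * pi)\<^sup>2) * (if z = (x, k) then 1 else 0)" .
  qed
  also have "\<dots> = of_real ((2 * pi)\<^sup>2) * of_real (pmf ?P (x, k))"
    by (subst integral_measure_pmf[of "{(x, k)}"]) (auto split: if_splits simp: scaleR_conv_of_real)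
  finally show "complex_of_real ((2 * pi)\<^sup>2 * pmf ?P (x, k))
    = (LINT t|lborel. indicator torus_box t *\<^sub>R (cis (- tdot t x) * (char_op p t ^^ n) ?v j))"
    by simp
qed

lemma set_pmf_rw_law_concat:
  fixes p :: "('d::finite, 's) rw_steps"
  assumes "(x, i) \<in> set_pmf (rw_law p m (0, j))"
  shows "(y, k) \<in> set_pmf (rw_law p n (0, i)) \<Longrightarrow> (x + y, k) \<in> set_pmf (rw_law p (m + n) (0, j))"
proof (induction n arbitrary: y k)
  case 0
  with assms show ?case by simp
next
  case (Suc n)
  then obtain y' k' w where yk: "(y', k') \<in> set_pmf (rw_law p n (0, i))"
    and w: "(w, k) \<in> set_pmf (p k')" "y = y' + w"
    by (auto simp: rw_kernel_def)
  have "(x + y, k) \<in> set_pmf (rw_kernel p (x + y', k'))"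
    using w by (force simp: rw_kernel_def add.assoc)
  with Suc.IH[OF yk] show ?case by auto
qed

section \<open>Moments of the step distribution\<close>

text \<open>
  The matrices \<open>Q\<close>, \<open>M\<^sub>l\<close> and \<open>\<Sigma>\<^bsub>l,m\<^esub>\<close> arise from the weights \<open>1\<close>, \<open>y\<^sub>l\<close> and \<open>y\<^sub>l y\<^sub>m\<close>.
\<close>

definition step_moment :: "(2, 's::finite) rw_steps \<Rightarrow> (int ^ 2 \<Rightarrow> real) \<Rightarrow> real ^ 's ^ 's" where
  "step_moment p w = (\<chi> j k. measure_pmf.expectation (p j) (\<lambda>z. w (fst z) * of_bool (snd z = k)))"

lemma has_sum_pmf_expectation:
  fixes g :: "'a \<Rightarrow> real"
  assumes "integrable (measure_pmf P) g"
  shows "((\<lambda>z. pmf P z * g z) has_sum measure_pmf.expectation P g) UNIV"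
proof -
  have abs: "Infinite_Set_Sum.abs_summable_on (\<lambda>z. pmf P z * g z) UNIV"
    using assms unfolding measure_pmf_eq_density
    by (subst (asm) integrable_density) (auto simp: Infinite_Set_Sum.abs_summable_on_def)
  then have "(\<lambda>z. pmf P z * g z) summable_on UNIV"
    using abs_summable_equivalent abs_summable_summable by blast
  moreover have "infsum (\<lambda>z. pmf P z * g z) UNIV = measure_pmf.expectation P g"
    using infsetsum_infsum[OF abs] by (simp add: pmf_expectation_eq_infsetsum)
  ultimately show ?thesis by (metis has_sum_infsum)
qed

lemma infsum_rw_A:
  fixes p :: "(2, 's::finite) rw_steps"
  assumes int: "\<And>j. integrable (measure_pmf (p j)) (\<lambda>z. w (fst z))"
  shows "(\<Sum>\<^sub>\<infinity>y. w y *\<^sub>R rw_A p y) = step_moment p w"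
proof (rule infsumI)
  have "((\<lambda>y. w y * pmf (p j) (y, k)) has_sum
      measure_pmf.expectation (p j) (\<lambda>z. w (fst z) * of_bool (snd z = k))) UNIV" for j k
  proof -
    have "integrable (measure_pmf (p j)) (\<lambda>z. w (fst z) * of_bool (snd z = k))"
      by (rule Bochner_Integration.integrable_bound[OF int[of j]]) auto
    from has_sum_pmf_expectation[OF this]
    have "((\<lambda>z. pmf (p j) z * (w (fst z) * of_bool (snd z = k))) has_sum
      measure_pmf.expectation (p j) (\<lambda>z. w (fst z) * of_bool (snd z = k))) ((\<lambda>y. (y, k)) ` UNIV)"
      by (rule has_sum_cong_neutral[THEN iffD1, rotated -1]) auto
    then show ?thesis
      by (subst (asm) has_sum_reindex) (auto simp: inj_on_def o_def mult.commute)
  qed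
  then show "((\<lambda>y. w y *\<^sub>R rw_A p y) has_sum step_moment p w) UNIV"
    unfolding has_sum_def
    by (intro vec_tendstoI) (simp add: step_moment_def rw_A_def sum_component)
qed

lemma step_moment_mult_vec:
  assumes int: "integrable (measure_pmf (p j)) (\<lambda>z. w (fst z))"
  shows "integrable (measure_pmf (p j)) (\<lambda>z. w (fst z) * f $ snd z)"
    and "(step_moment p w *v f) $ j = measure_pmf.expectation (p j) (\<lambda>z. w (fst z) * f $ snd z)"
proof -
  have int': "integrable (measure_pmf (p j)) (\<lambda>z. w (fst z) * of_bool (snd z = k))" for k
    by (rule Bochner_Integration.integrable_bound[OF int]) auto
  have eq: "w (fst z) * f $ snd z = (\<Sum>k\<in>UNIV. f $ k * (w (fst z) * of_bool (snd z = k)))" for z :: "(int^2)\<times>'a"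
    by (simp add: if_distrib of_bool_def cong: if_cong)
  show "integrable (measure_pmf (p j)) (\<lambda>z. w (fst z) * f $ snd z)"
    unfolding eq by (intro Bochner_Integration.integrable_sum integrable_mult_right int')
  show "(step_moment p w *v f) $ j = measure_pmf.expectation (p j) (\<lambda>z. w (fst z) * f $ snd z)"
    unfolding eq
    by (subst Bochner_Integration.integral_sum)
      (auto simp: int' step_moment_def matrix_vector_mult_def mult.commute)
qed

lemma moment_converges_integrable:
  fixes p :: "(2, 's::finite) rw_steps"
  assumes "moment_converges r p"
  shows "integrable (measure_pmf (p j)) (\<lambda>z. norm (real_vec (fst z)) ^ r)"
proof -
  let ?w = "\<lambda>y :: int ^ 2. norm (real_vec y) ^ r"
  have "(\<lambda>y. ?w y * pmf (p j) (y, k)) summable_on UNIV" for k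
  proof -
    obtain S where S: "((\<lambda>y. ?w y *\<^sub>R rw_A p y) has_sum S) UNIV"
      using assms unfolding moment_converges_def summable_on_def by blast
    have "bounded_linear (\<lambda>A :: real ^ 's ^ 's. A $ j $ k)"
      by (rule bounded_linear_compose[OF bounded_linear_vec_nth bounded_linear_vec_nth])
    from has_sum_bounded_linear[OF this S] show ?thesis
      by (auto simp: o_def summable_on_def rw_A_def)
  qed
  then have "(\<lambda>z. pmf (p j) z * (?w (fst z) * of_bool (snd z = k))) summable_on UNIV" for k
  proof -
    have "(\<lambda>z. pmf (p j) z * (?w (fst z) * of_bool (snd z = k))) summable_on ((\<lambda>y. (y, k)) ` UNIV)"
      by (subst summable_on_reindex)
         (use \<open>(\<lambda>y. ?w y * pmf (p j) (y, k)) summable_on UNIV\<close> in \<open>auto simp: inj_on_def o_def mult.commute\<close>)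
    then show ?thesis
      by (rule summable_on_cong_neutral[THEN iffD1, rotated -1]) auto
  qed
  then have "integrable (measure_pmf (p j)) (\<lambda>z. ?w (fst z) * of_bool (snd z = k))" for k
  proof -
    assume *: "\<And>k. (\<lambda>z. pmf (p j) z * (?w (fst z) * of_bool (snd z = k))) summable_on UNIV"
    have "Infinite_Sum.abs_summable_on (\<lambda>z. pmf (p j) z * (?w (fst z) * of_bool (snd z = k))) UNIV"
      using *[of k] by (simp add: abs_mult)
    then have "integrable (count_space UNIV) (\<lambda>z. pmf (p j) z * (?w (fst z) * of_bool (snd z = k)))"
      using abs_summable_equivalent unfolding Infinite_Set_Sum.abs_summable_on_def by blast
    then show ?thesis
      unfolding measure_pmf_eq_density by (subst integrable_density) auto
  qed
  then have "integrable (measure_pmf (p j)) (\<lambda>z. \<Sum>k\<in>UNIV. ?w (fst z) * of_bool (snd z = k))"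
    by (intro Bochner_Integration.integrable_sum)
  then show ?thesis
    by (simp add: if_distrib of_bool_def cong: if_cong)
qed

lemma rw_Q_eq: "rw_Q p = step_moment p (\<lambda>_. 1)" for p :: "(2, 's::finite) rw_steps"
  using infsum_rw_A[of p "\<lambda>_. 1"] by (simp add: rw_Q_def)

lemma rw_Q_mult_vec:
  "(rw_Q p *v f) $ j = measure_pmf.expectation (p j) (\<lambda>z. f $ snd z)" for p :: "(2, 's::finite) rw_steps"
  using step_moment_mult_vec(2)[of p j "\<lambda>_. 1" f] by (simp add: rw_Q_eq)

definition cvec :: "real ^ 's \<Rightarrow> 's \<Rightarrow> complex" where
  "cvec f = (\<lambda>j. of_real (f $ j))"

lemma char_op_zero: "char_op p 0 (cvec f) = cvec (rw_Q p *v f)" for p :: "(2, 's::finite) rw_steps"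
  by (rule ext) (simp add: char_op_def cvec_def rw_Q_mult_vec tdot_simps)

lemma char_op_zero_pow:
  "(char_op p 0 ^^ n) (cvec f) = cvec (mat_power (rw_Q p) n *v f)" for p :: "(2, 's::finite) rw_steps"
  by (induction n arbitrary: f)
    (simp_all add: funpow_Suc_right char_op_zero matrix_vector_mul_assoc del: funpow.simps)

lemma mat_power_vec_expectation:
  "(mat_power (rw_Q p) n *v f) $ j = measure_pmf.expectation (rw_law p n (0, j)) (\<lambda>z. f $ snd z)"
  for p :: "(2, 's::finite) rw_steps"
proof -
  have "complex_of_real ((mat_power (rw_Q p) n *v f) $ j) = (char_op p 0 ^^ n) (cvec f) j"
    unfolding char_op_zero_pow by (simp add: cvec_def)
  also have "\<dots> = of_real (measure_pmf.expectation (rw_law p n (0, j)) (\<lambda>z. f $ snd z))"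
    unfolding char_op_pow_eq_expectation by (simp add: cvec_def tdot_simps)
  finally show ?thesis by (simp only: of_real_eq_iff)
qed

lemma mat_power_entry:
  "mat_power (rw_Q p) n $ j $ k = measure_pmf.prob (rw_law p n (0, j)) {z. snd z = k}"
  for p :: "(2, 's::finite) rw_steps"
proof -
  have "mat_power (rw_Q p) n $ j $ k = (mat_power (rw_Q p) n *v axis k 1) $ j"
    by (simp add: matrix_vector_mult_basis column_def)
  also have "\<dots> = measure_pmf.expectation (rw_law p n (0, j)) (indicator {z. snd z = k})"
    unfolding mat_power_vec_expectation
    by (intro Bochner_Integration.integral_cong) (auto simp: axis_def)
  finally show ?thesis by simp
qed

lemma mat_power_pos_iff:
  "mat_power (rw_Q p) n $ j $ k > 0 \<longleftrightarrow> (\<exists>y. (y, k) \<in> set_pmf (rw_law p n (0, j)))"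
  for p :: "(2, 's::finite) rw_steps"
proof
  assume "mat_power (rw_Q p) n $ j $ k > 0"
  then have "set_pmf (rw_law p n (0, j)) \<inter> {z. snd z = k} \<noteq> {}"
    unfolding mat_power_entry by (metis less_irrefl measure_Int_set_pmf measure_empty Int_commute)
  then show "\<exists>y. (y, k) \<in> set_pmf (rw_law p n (0, j))" by auto
next
  assume "\<exists>y. (y, k) \<in> set_pmf (rw_law p n (0, j))"
  then show "mat_power (rw_Q p) n $ j $ k > 0"
    unfolding mat_power_entry by (auto intro: measure_pmf_posI)
qed

lemma mat_power_row_sum: "(\<Sum>k\<in>UNIV. mat_power (rw_Q p) n $ j $ k) = 1"
  for p :: "(2, 's::finite) rw_steps"
  using mat_power_vec_expectation[of p n 1 j] by (simp add: matrix_vector_mult_def)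

section \<open>The chain of internal states\<close>

text \<open>
  Adjoin \<open>0\<close> to \<open>S\<close> and let \<open>d\<close> be the least positive difference of two elements \<open>s, s + d\<close>. Dividing an
  element of \<open>S\<close> by \<open>d\<close> with remainder exhibits the remainder as a difference as well, so \<open>d\<close> divides
  every element and \<open>d = 1\<close>. Finally \<open>s\<close> and \<open>s + 1\<close> generate every number from \<open>s\<^sup>2\<close> on.
\<close>

lemma additive_gcd_1_cofinite:
  fixes S :: "nat set"
  assumes add: "\<And>a b. a \<in> S \<Longrightarrow> b \<in> S \<Longrightarrow> a + b \<in> S" and gcd: "Gcd S = 1"
  shows "\<exists>N. \<forall>n\<ge>N. n \<in> S"
proof -
  define S0 where "S0 = insert 0 S"
  have add0: "a + b \<in> S0" if "a \<in> S0" "b \<in> S0" for a b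
    using that add by (auto simp: S0_def)
  have mult0: "q * a \<in> S0" if "a \<in> S0" for q a
  proof (induction q)
    case (Suc q)
    then show ?case using add0[OF that Suc] by simp
  qed (simp add: S0_def)
  have "\<exists>a\<in>S. a > 0"
  proof (rule ccontr)
    assume "\<not> (\<exists>a\<in>S. a > 0)"
    then have "S \<subseteq> {0}" by auto
    then have "Gcd S = 0" by (metis Gcd_0_iff)
    with gcd show False by simp
  qed
  then obtain a where a: "a \<in> S" "a > 0" by blast
  define d where "d = (LEAST d. d > 0 \<and> (\<exists>s\<in>S0. s + d \<in> S0))"
  have ex: "a > 0 \<and> (\<exists>s\<in>S0. s + a \<in> S0)"
    using a by (auto simp: S0_def)
  have d: "d > 0" "\<exists>s\<in>S0. s + d \<in> S0"
    using LeastI[of "\<lambda>d. d > 0 \<and> (\<exists>s\<in>S0. s + d \<in> S0)", OF ex] by (auto simp: d_def)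
  have least: "d \<le> r" if "r > 0" "s \<in> S0" "s + r \<in> S0" for r s
    unfolding d_def using that by (intro Least_le) auto
  obtain s where s: "s \<in> S0" "s + d \<in> S0" using d(2) by blast
  have "d dvd n" if "n \<in> S" for n
  proof (rule ccontr)
    assume "\<not> d dvd n"
    then have r: "n mod d > 0" by (simp add: mod_greater_zero_iff_not_dvd)
    have "n div d * (s + d) \<in> S0" by (rule mult0[OF s(2)])
    moreover have "n div d * (s + d) + n mod d = n div d * s + n"
      by (simp add: algebra_simps)
    moreover have "n div d * s + n \<in> S0"
      using that by (intro add0 mult0 s(1)) (auto simp: S0_def)
    ultimately have "d \<le> n mod d" using least[OF r] by metis
    with d(1) show False using mod_less_divisor[of d n] by linarith
  qed
  then have "d dvd Gcd S" by (simp add: dvd_Gcd_iff)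
  with gcd have d1: "d = 1" by simp
  have S: "n \<in> S" if "n \<in> S0" "n > 0" for n using that by (auto simp: S0_def)
  show ?thesis
  proof (cases "s = 0")
    case True
    then have "1 \<in> S0" using s d1 by simp
    then have "n \<in> S" if "n \<ge> 1" for n using mult0[of 1 n] that by (intro S) auto
    then show ?thesis by blast
  next
    case False
    have "n \<in> S" if n: "n \<ge> s * s + 1" for n
    proof (rule S)
      have le: "n mod s \<le> n div s"
      proof -
        have "s * s \<le> n" using n by simp
        then have "s \<le> n div s" using False by (simp add: less_eq_div_iff_mult_less_eq)
        then show ?thesis using mod_less_divisor[of s n] False by linarith
      qed
      have "(n div s - n mod s) * s + n mod s * (s + d) = n"
      proof -
        have "(n div s - n mod s) * s + n mod s * (s + 1) = n div s * s + n mod s"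
          using le by (simp add: algebra_simps diff_mult_distrib)
        then show ?thesis using d1 by simp
      qed
      then show "n \<in> S0" using add0[OF mult0[OF s(1)] mult0[OF s(2)]] by metis
    qed (use n in auto)
    then show ?thesis by blast
  qed
qed

lemma eventually_reachable:
  fixes p :: "(2, 's::finite) rw_steps"
  assumes irr: "irreducible_matrix (rw_Q p)" and aper: "aperiodic_matrix (rw_Q p)"
  shows "\<exists>N0. \<forall>n\<ge>N0. \<forall>j k. \<exists>y. (y, k) \<in> set_pmf (rw_law p n (0, j))"
proof -
  have loops: "\<exists>N0. \<forall>n\<ge>N0. \<exists>y. (y, j) \<in> set_pmf (rw_law p n (0, j))" for j
  proof -
    let ?S = "{n. n \<ge> 1 \<and> mat_power (rw_Q p) n $ j $ j > 0}"
    have "a + b \<in> ?S" if "a \<in> ?S" "b \<in> ?S" for a b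
      using that set_pmf_rw_law_concat[of _ j p a j _ j b] unfolding mat_power_pos_iff by fastforce
    from additive_gcd_1_cofinite[OF this] show ?thesis
      using aper unfolding aperiodic_matrix_def mat_power_pos_iff by auto
  qed
  then obtain L where L: "\<And>j n. n \<ge> L j \<Longrightarrow> \<exists>y. (y, j) \<in> set_pmf (rw_law p n (0, j))"
    by metis
  obtain m where m: "\<And>j k. \<exists>y. (y, k) \<in> set_pmf (rw_law p (m j k) (0, j))"
    using irr unfolding irreducible_matrix_def mat_power_pos_iff by metis
  (* Long enough for a path from j to k preceded by a loop at j of any prescribed large length. *)
  define N0 where "N0 = (\<Sum>j\<in>UNIV. L j) + (\<Sum>j\<in>UNIV. \<Sum>k\<in>UNIV. m j k)"
  have "\<exists>y. (y, k) \<in> set_pmf (rw_law p n (0, j))" if "n \<ge> N0" for n j k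
  proof -
    have "L j \<le> (\<Sum>j\<in>UNIV. L j)" by (rule member_le_sum) auto
    moreover have "m j k \<le> (\<Sum>k\<in>UNIV. m j k)" by (rule member_le_sum) auto
    moreover have "(\<Sum>k\<in>UNIV. m j k) \<le> (\<Sum>j\<in>UNIV. \<Sum>k\<in>UNIV. m j k)"
      by (rule member_le_sum) auto
    ultimately have "n - m j k \<ge> L j" "(n - m j k) + m j k = n"
      using that unfolding N0_def by linarith+
    with L[of j "n - m j k"] m[of k j] show ?thesis
      using set_pmf_rw_law_concat by metis
  qed
  then show ?thesis by blast
qed

lemma stationary_inner:
  assumes "stationary_distribution T \<mu>"
  shows "\<mu> \<bullet> (T *v h) = \<mu> \<bullet> h"
  using assms by (simp add: stationary_distribution_def dot_lmul_matrix[symmetric])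

lemma stationary_inner_mat_power:
  assumes "stationary_distribution T \<mu>"
  shows "\<mu> \<bullet> (mat_power T n *v h) = \<mu> \<bullet> h"
  by (induction n arbitrary: h) (simp_all add: matrix_vector_mul_assoc[symmetric] stationary_inner[OF assms])

lemma mat_power_add: "mat_power T (m + n) = mat_power T m ** mat_power T n"
  by (induction n) (simp_all add: matrix_mul_assoc)

lemma mat_power_Suc_left: "mat_power T (Suc n) = T ** mat_power T n"
  using mat_power_add[of T 1 n] by simp

text \<open>
  Doeblin's argument: some power of \<open>Q\<close> has all entries at least \<open>\<epsilon> > 0\<close>, hence at least \<open>\<epsilon> \<mu>\<^sub>k\<close>.
  On \<open>\<mu>\<close>-centred vectors, \<open>\<epsilon> \<mu>\<^sub>k\<close> may be subtracted from each column without any effect, and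
  what is left is a nonnegative matrix with row sums \<open>1 - \<epsilon>\<close>.
\<close>

lemma geometric_ergodicity:
  fixes p :: "(2, 's::finite) rw_steps"
  assumes irr: "irreducible_matrix (rw_Q p)" and aper: "aperiodic_matrix (rw_Q p)"
    and stat: "stationary_distribution (rw_Q p) \<mu>"
  shows "\<exists>\<rho> C. 0 < \<rho> \<and> \<rho> < 1 \<and> C \<ge> 0 \<and>
    (\<forall>h n. \<mu> \<bullet> h = 0 \<longrightarrow> norm (mat_power (rw_Q p) n *v h) \<le> C * \<rho> ^ n * norm h)"
proof -
  let ?Q = "\<lambda>n. mat_power (rw_Q p) n"
  obtain N0 where N0: "\<And>n j k. n \<ge> N0 \<Longrightarrow> \<exists>y. (y, k) \<in> set_pmf (rw_law p n (0, j))"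
    using eventually_reachable[OF irr aper] by blast
  define N where "N = Suc N0"
  have pos: "?Q N $ j $ k > 0" for j k
    unfolding mat_power_pos_iff by (rule N0) (simp add: N_def)
  define \<epsilon> where "\<epsilon> = min (1/2) (Min (range (\<lambda>(j, k). ?Q N $ j $ k)))"
  have \<epsilon>: "\<epsilon> > 0" "\<epsilon> \<le> 1/2" using pos by (auto simp: \<epsilon>_def)
  have \<epsilon>le: "\<epsilon> \<le> ?Q N $ j $ k" for j k
  proof -
    have "Min (range (\<lambda>(j, k). ?Q N $ j $ k)) \<le> (\<lambda>(j, k). ?Q N $ j $ k) (j, k)"
      by (rule Min_le) auto
    then show ?thesis by (simp add: \<epsilon>_def)
  qed
  have mu: "\<mu> $ k \<ge> 0" "(\<Sum>k\<in>UNIV. \<mu> $ k) = 1" for k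
    using stat by (auto simp: stationary_distribution_def)
  have mu1: "\<mu> $ k \<le> 1" for k
    using mu member_le_sum[of k UNIV "\<lambda>k. \<mu> $ k"] by auto
  have contract: "\<bar>(?Q N *v h) $ j\<bar> \<le> (1 - \<epsilon>) * B"
    if h: "\<mu> \<bullet> h = 0" and B: "\<And>k. \<bar>h $ k\<bar> \<le> B" for h B j
  proof -
    have "(?Q N *v h) $ j = (\<Sum>k\<in>UNIV. ?Q N $ j $ k * h $ k) - \<epsilon> * (\<mu> \<bullet> h)"
      by (simp add: h matrix_vector_mult_def)
    also have "\<dots> = (\<Sum>k\<in>UNIV. (?Q N $ j $ k - \<epsilon> * \<mu> $ k) * h $ k)"
      by (simp add: inner_vec_def sum_distrib_left sum_subtractf left_diff_distrib mult.assoc)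
    also have "\<bar>\<dots>\<bar> \<le> (\<Sum>k\<in>UNIV. (?Q N $ j $ k - \<epsilon> * \<mu> $ k) * B)"
    proof (rule order.trans[OF sum_abs sum_mono])
      fix k :: 's
      have "\<epsilon> * \<mu> $ k \<le> \<epsilon> * 1" using \<epsilon> mu1 by (intro mult_left_mono) auto
      then have "?Q N $ j $ k - \<epsilon> * \<mu> $ k \<ge> 0" using \<epsilon>le[of j k] by simp
      then show "\<bar>(?Q N $ j $ k - \<epsilon> * \<mu> $ k) * h $ k\<bar> \<le> (?Q N $ j $ k - \<epsilon> * \<mu> $ k) * B"
        unfolding abs_mult by (intro mult_mono B) auto
    qed
    also have "\<dots> = (1 - \<epsilon>) * B"
      by (simp add: sum_distrib_right[symmetric] sum_subtractf mat_power_row_sum sum_distrib_left[symmetric] mu)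
    finally show ?thesis .
  qed
  have blocks: "\<bar>(?Q (N * m) *v h) $ j\<bar> \<le> (1 - \<epsilon>) ^ m * norm h" if h: "\<mu> \<bullet> h = 0" for h m j
  proof (induction m arbitrary: j)
    case 0
    show ?case using component_le_norm_cart by simp
  next
    case (Suc m)
    have "?Q (N * Suc m) *v h = ?Q N *v (?Q (N * m) *v h)"
      by (simp add: mat_power_add matrix_vector_mul_assoc)
    then show ?case
      using contract[of "?Q (N * m) *v h" "(1 - \<epsilon>) ^ m * norm h" j] Suc
      by (simp add: stationary_inner_mat_power[OF stat] h mult.assoc)
  qed
  have nonexp: "\<bar>(?Q n *v h) $ j\<bar> \<le> B" if B: "\<And>k. \<bar>h $ k\<bar> \<le> B" for h B n j
  proof -
    have "\<bar>(?Q n *v h) $ j\<bar> \<le> (\<Sum>k\<in>UNIV. ?Q n $ j $ k * B)"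
      unfolding matrix_vector_mult_def vec_lambda_beta
      by (rule order.trans[OF sum_abs sum_mono])
        (auto simp: abs_mult mat_power_entry intro!: mult_mono B)
    then show ?thesis by (simp add: sum_distrib_right[symmetric] mat_power_row_sum)
  qed
  define \<rho> where "\<rho> = root N (1 - \<epsilon>)"
  have Npos: "N > 0" by (simp add: N_def)
  have \<rho>: "0 < \<rho>" "\<rho> < 1" "\<rho> ^ N = 1 - \<epsilon>"
    using \<epsilon> Npos by (auto simp: \<rho>_def)
  (* The factor rho^(-N) accounts for the incomplete last block, the number of states
     for passing from the maximum norm to the Euclidean one. *)
  define C where "C = CARD('s) * (1 / \<rho> ^ N)"
  have "norm (?Q n *v h) \<le> C * \<rho> ^ n * norm h" if h: "\<mu> \<bullet> h = 0" for h n
  proof -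
    have "\<bar>(?Q n *v h) $ j\<bar> \<le> 1 / \<rho> ^ N * \<rho> ^ n * norm h" for j
    proof -
      have n: "n = n mod N + N * (n div N)" by simp
      have "\<bar>(?Q n *v h) $ j\<bar> \<le> (1 - \<epsilon>) ^ (n div N) * norm h"
        using nonexp[of "?Q (N * (n div N)) *v h", OF blocks[OF h]]
        by (subst n) (simp only: mat_power_add matrix_vector_mul_assoc)
      also have "(1 - \<epsilon>) ^ (n div N) \<le> 1 / \<rho> ^ N * \<rho> ^ n"
      proof -
        have "\<rho> ^ N * (1 - \<epsilon>) ^ (n div N) = \<rho> ^ (N + N * (n div N))"
          using \<rho>(3) by (simp add: power_add power_mult)
        also have "\<dots> \<le> \<rho> ^ n"
        proof (rule power_decreasing)
          show "n \<le> N + N * (n div N)"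
            using mod_less_divisor[OF Npos, of n] n by linarith
        qed (use \<rho> in auto)
        finally show ?thesis using \<rho>(1) by (simp add: field_simps)
      qed
      finally show ?thesis by (simp add: mult_right_mono)
    qed
    then have "norm (?Q n *v h) \<le> (\<Sum>j\<in>(UNIV::'s set). 1 / \<rho> ^ N * \<rho> ^ n * norm h)"
      by (intro order.trans[OF norm_le_l1_cart sum_mono])
    then show ?thesis by (simp add: C_def mult.assoc)
  qed
  moreover have "C \<ge> 0" using \<rho> \<epsilon> by (simp add: C_def)
  ultimately show ?thesis using \<rho> by blast
qed

section \<open>Decay on the whole torus\<close>

text \<open>
  The probability of a loop at \<open>j\<close> of length \<open>N\<close>, minus the modulus of what survives of it after the oscillating factor
  \<open>exp (i t\<cdot>\<eta>\<^sub>N)\<close> has been inserted.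
\<close>

definition loop_gap :: "(2, 's::finite) rw_steps \<Rightarrow> nat \<Rightarrow> 's \<Rightarrow> real \<times> real \<Rightarrow> real" where
  "loop_gap p N j t = mat_power (rw_Q p) N $ j $ j - norm ((char_op p t ^^ N) (\<lambda>i. of_bool (i = j)) j)"

lemma norm_one_minus_cis_diff: "norm (1 - cis (a - b)) = norm (cis a - cis b)"
proof -
  have "cis a - cis b = - (cis b * (1 - cis (a - b)))"
    by (simp add: right_diff_distrib cis_mult)
  then show ?thesis by (simp add: norm_mult)
qed

text \<open>
  By the parallelogram law the square of the left-hand side is \<open>4 - s\<^sup>2\<close> with
  \<open>s = |cis a - cis b| \<le> 2\<close>, which is at most \<open>(2 - s\<^sup>2/4)\<^sup>2\<close>.
\<close>

lemma norm_cis_add_le: "norm (cis a + cis b) \<le> 2 - (norm (cis a - cis b))\<^sup>2 / 4"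
proof -
  let ?s = "norm (cis a - cis b)"
  have "(norm (x + y))\<^sup>2 + (norm (x - y))\<^sup>2 = 2 * (norm x)\<^sup>2 + 2 * (norm y)\<^sup>2" for x y :: complex
    unfolding cmod_power2 by (simp add: power2_eq_square algebra_simps)
  from this[of "cis a" "cis b"] have "(norm (cis a + cis b))\<^sup>2 = 4 - ?s\<^sup>2"
    by simp
  also have "\<dots> \<le> (2 - ?s\<^sup>2 / 4)\<^sup>2"
    using zero_le_power2[of "?s\<^sup>2"] by (simp add: power2_eq_square algebra_simps)
  finally have "(norm (cis a + cis b))\<^sup>2 \<le> (2 - ?s\<^sup>2 / 4)\<^sup>2" .
  moreover have "?s \<le> 2" using norm_triangle_ineq4[of "cis a" "cis b"] by simp
  then have "?s\<^sup>2 \<le> 2\<^sup>2" by (intro power_mono) auto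
  then have "0 \<le> 2 - ?s\<^sup>2 / 4" by simp
  ultimately show ?thesis by (rule power2_le_imp_le)
qed

text \<open>
  The two atoms have a mass \<open>m\<close> in common; on this part the two waves cancel by \<open>norm_cis_add_le\<close>, on
  the rest of the loops the trivial bound is used.
\<close>

lemma loop_gap_bounds_difference:
  fixes p :: "(2, 's::finite) rw_steps"
  assumes y: "(y, j) \<in> set_pmf (rw_law p N (0, j))" and y': "(y', j) \<in> set_pmf (rw_law p N (0, j))"
  shows "\<exists>K\<ge>0. \<forall>t. (norm (1 - cis (tdot t (y - y'))))\<^sup>2 \<le> K * loop_gap p N j t"
proof (cases "y = y'")
  case True
  then show ?thesis by (intro exI[of _ 0]) (simp add: tdot_simps)
next
  case False
  let ?P = "rw_law p N (0, j)"
  define a where "a = pmf ?P (y, j)"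
  define b where "b = pmf ?P (y', j)"
  define m where "m = min a b"
  have ab: "a > 0" "b > 0" using y y' by (auto simp: a_def b_def pmf_positive)
  then have m: "m > 0" "m \<le> a" "m \<le> b" by (auto simp: m_def)
  show ?thesis
  proof (intro exI[of _ "4 / m"] conjI allI)
    fix t
    let ?A = "{(y, j), (y', j)}" and ?B = "{z. snd z = j} :: ((int^2) \<times> 's) set"
    let ?X = "\<lambda>z. cis (tdot t (fst z)) * of_bool (snd z = j)"
    let ?s = "norm (cis (tdot t y) - cis (tdot t y'))"
    have intA: "integrable (measure_pmf ?P) (\<lambda>z. indicator ?A z *\<^sub>R ?X z)"
      and intB: "integrable (measure_pmf ?P) (\<lambda>z. indicator (?B - ?A) z *\<^sub>R ?X z)"
      by (rule measure_pmf.integrable_const_bound[where B=1]; auto simp: indicator_def norm_mult)+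
    have "(char_op p t ^^ N) (\<lambda>i. of_bool (i = j)) j = measure_pmf.expectation ?P (\<lambda>z. indicator ?A z *\<^sub>R ?X z + indicator (?B - ?A) z *\<^sub>R ?X z)"
      unfolding char_op_pow_eq_expectation
      by (intro Bochner_Integration.integral_cong) (auto simp: indicator_def)
    also have "\<dots> = measure_pmf.expectation ?P (\<lambda>z. indicator ?A z *\<^sub>R ?X z)
        + measure_pmf.expectation ?P (\<lambda>z. indicator (?B - ?A) z *\<^sub>R ?X z)"
      by (rule Bochner_Integration.integral_add[OF intA intB])
    also have "measure_pmf.expectation ?P (\<lambda>z. indicator ?A z *\<^sub>R ?X z)
       = a *\<^sub>R cis (tdot t y) + b *\<^sub>R cis (tdot t y')"
      using False by (subst integral_measure_pmf[of ?A]) (auto simp: indicator_def a_def b_def split: if_splits)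
    finally have "norm ((char_op p t ^^ N) (\<lambda>i. of_bool (i = j)) j)
       \<le> norm (a *\<^sub>R cis (tdot t y) + b *\<^sub>R cis (tdot t y'))
        + norm (measure_pmf.expectation ?P (\<lambda>z. indicator (?B - ?A) z *\<^sub>R ?X z))"
      by (simp only: norm_triangle_ineq)
    also have "norm (measure_pmf.expectation ?P (\<lambda>z. indicator (?B - ?A) z *\<^sub>R ?X z))
       \<le> measure_pmf.expectation ?P (\<lambda>z. norm (indicator (?B - ?A) z *\<^sub>R ?X z))"
      by (rule integral_norm_bound)
    also have "\<dots> = measure_pmf.expectation ?P (indicator (?B - ?A))"
      by (intro Bochner_Integration.integral_cong) (auto simp: indicator_def norm_mult)
    also have "\<dots> = measure_pmf.prob ?P ?B - (a + b)"
    proof -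
      have "measure_pmf.prob ?P (?B - ?A) = measure_pmf.prob ?P ?B - measure_pmf.prob ?P ?A"
        by (rule measure_pmf.finite_measure_Diff) auto
      moreover have "measure_pmf.prob ?P ?A = a + b"
        using False by (simp add: measure_measure_pmf_finite a_def b_def)
      ultimately show ?thesis by simp
    qed
    also have "norm (a *\<^sub>R cis (tdot t y) + b *\<^sub>R cis (tdot t y'))
        \<le> (a - m) + (b - m) + m * (2 - ?s\<^sup>2 / 4)"
    proof -
      have "a *\<^sub>R cis (tdot t y) + b *\<^sub>R cis (tdot t y')
        = ((a - m) *\<^sub>R cis (tdot t y) + (b - m) *\<^sub>R cis (tdot t y')) + m *\<^sub>R (cis (tdot t y) + cis (tdot t y'))"
        by (simp add: algebra_simps)
      then have "norm (a *\<^sub>R cis (tdot t y) + b *\<^sub>R cis (tdot t y'))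
         \<le> (norm ((a - m) *\<^sub>R cis (tdot t y)) + norm ((b - m) *\<^sub>R cis (tdot t y'))) + norm (m *\<^sub>R (cis (tdot t y) + cis (tdot t y')))"
        by (simp only:) (intro order.trans[OF norm_triangle_ineq] add_right_mono norm_triangle_ineq)
      also have "\<dots> = (a - m) + (b - m) + m * norm (cis (tdot t y) + cis (tdot t y'))"
        using m by simp
      finally show ?thesis
        using mult_left_mono[OF norm_cis_add_le[of "tdot t y" "tdot t y'"], of m] m by linarith
    qed
    finally have "m * (?s\<^sup>2 / 4) \<le> loop_gap p N j t"
      unfolding loop_gap_def mat_power_entry by (simp add: algebra_simps)
    then have "?s\<^sup>2 \<le> 4 / m * loop_gap p N j t"
      using m by (simp add: field_simps)
    then show "(norm (1 - cis (tdot t (y - y'))))\<^sup>2 \<le> 4 / m * loop_gap p N j t"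
      by (simp only: tdot_simps norm_one_minus_cis_diff)
  qed (use m in auto)
qed

text \<open>
  The set of \<open>d\<close> with this property is a subgroup: zero and differences are clear from the triangle
  inequality for \<open>cis\<close>. It contains the generators of the arithmetic condition. There the length of
  the loops can be increased to any large \<open>N\<close>, because prolonging both paths by the same loop keeps their
  difference; this is why the bound is asked for all large \<open>N\<close> at once.
\<close>

lemma loop_gap_bounds_lattice:
  fixes p :: "(2, 's::finite) rw_steps"
  assumes irr: "irreducible_matrix (rw_Q p)" and aper: "aperiodic_matrix (rw_Q p)"
    and arith: "trivial_arithmetic p"
  shows "\<exists>N0. \<forall>N\<ge>N0. \<exists>K\<ge>0. \<forall>t. (norm (1 - cis (tdot t d)))\<^sup>2 \<le> K * loop_gap p N j t"
proof -
  let ?S = "{y - y' | y y'. \<exists>n\<ge>1. pmf (rw_law p n (0, j)) (y, j) > 0 \<and> pmf (rw_law p n (0, j)) (y', j) > 0}"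
  have "d \<in> group_closure ?S" using arith unfolding trivial_arithmetic_def by blast
  then show ?thesis
  proof (induction rule: group_closure.induct)
    case (base d)
    show ?case
    proof (cases "d = 0")
      case True
      then show ?thesis by (intro exI[of _ 0] allI impI) (simp add: tdot_simps)
    next
      case False
      with base obtain y y' n where d: "d = y - y'" and y: "(y, j) \<in> set_pmf (rw_law p n (0, j))"
        and y': "(y', j) \<in> set_pmf (rw_law p n (0, j))"
        by (auto simp: pmf_positive_iff)
      obtain N0 where N0: "\<And>n j k. n \<ge> N0 \<Longrightarrow> \<exists>y. (y, k) \<in> set_pmf (rw_law p n (0, j))"
        using eventually_reachable[OF irr aper] by blast
      show ?thesis
      proof (intro exI[of _ "N0 + n"] allI impI)
        fix N assume N: "N \<ge> N0 + n"
        then have "N0 \<le> N - n" by simp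
        then obtain z where z: "(z, j) \<in> set_pmf (rw_law p (N - n) (0, j))"
          using N0 by blast
        have "n + (N - n) = N" using N by simp
        with set_pmf_rw_law_concat[OF y z] set_pmf_rw_law_concat[OF y' z]
        have "(y + z, j) \<in> set_pmf (rw_law p N (0, j))" "(y' + z, j) \<in> set_pmf (rw_law p N (0, j))"
          by simp_all
        from loop_gap_bounds_difference[OF this]
        show "\<exists>K\<ge>0. \<forall>t. (norm (1 - cis (tdot t d)))\<^sup>2 \<le> K * loop_gap p N j t"
          by (simp add: d)
      qed
    qed
  next
    case (diff a b)
    then obtain N1 N2 where
      N1: "\<And>N. N \<ge> N1 \<Longrightarrow> \<exists>K\<ge>0. \<forall>t. (norm (1 - cis (tdot t a)))\<^sup>2 \<le> K * loop_gap p N j t" and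
      N2: "\<And>N. N \<ge> N2 \<Longrightarrow> \<exists>K\<ge>0. \<forall>t. (norm (1 - cis (tdot t b)))\<^sup>2 \<le> K * loop_gap p N j t"
      by blast
    show ?case
    proof (intro exI[of _ "max N1 N2"] allI impI)
      fix N assume "N \<ge> max N1 N2"
      then obtain K1 K2 where K: "K1 \<ge> 0" "K2 \<ge> 0"
        and K1: "\<And>t. (norm (1 - cis (tdot t a)))\<^sup>2 \<le> K1 * loop_gap p N j t"
        and K2: "\<And>t. (norm (1 - cis (tdot t b)))\<^sup>2 \<le> K2 * loop_gap p N j t"
        using N1[of N] N2[of N] by auto
      show "\<exists>K\<ge>0. \<forall>t. (norm (1 - cis (tdot t (a - b))))\<^sup>2 \<le> K * loop_gap p N j t"
      proof (intro exI[of _ "2 * K1 + 2 * K2"] conjI allI)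
        fix t
        let ?u = "norm (1 - cis (tdot t a))" and ?v = "norm (1 - cis (tdot t b))"
        (* The factor 2 in the constant comes from (u + v)^2 <= 2 u^2 + 2 v^2. *)
        have "norm (cis (tdot t a) - cis (tdot t b)) \<le> ?u + ?v"
          using norm_triangle_ineq4[of "1 - cis (tdot t b)" "1 - cis (tdot t a)"] by simp
        then have "(norm (1 - cis (tdot t (a - b))))\<^sup>2 \<le> (?u + ?v)\<^sup>2"
          unfolding tdot_simps norm_one_minus_cis_diff by (intro power_mono) auto
        also have "\<dots> \<le> 2 * ?u\<^sup>2 + 2 * ?v\<^sup>2"
          using zero_le_power2[of "?u - ?v"] unfolding power2_sum power2_diff by linarith
        finally show "(norm (1 - cis (tdot t (a - b))))\<^sup>2 \<le> (2 * K1 + 2 * K2) * loop_gap p N j t"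
          using K1[of t] K2[of t] by (simp add: distrib_right)
      qed (use K in auto)
    qed
  qed
qed

text \<open>
  The right-hand side is \<open>2 |sin (x/2)|\<close>, and \<open>sin y \<ge> y - y\<^sup>3/6 \<ge> y/3\<close> for \<open>0 \<le> y \<le> 2\<close>.
\<close>

lemma norm_one_minus_cis_ge:
  assumes "\<bar>x\<bar> \<le> pi"
  shows "\<bar>x\<bar> / 3 \<le> norm (1 - cis x)"
proof -
  define y where "y = \<bar>x\<bar> / 2"
  have y: "0 \<le> y" "y \<le> pi / 2" using assms by (auto simp: y_def)
  have y2: "y \<le> 2" using y pi_half_less_two by linarith
  have "\<bar>sin y - (\<Sum>m<3. sin_coeff m * y ^ m)\<bar> \<le> inverse (fact 3) * \<bar>y\<bar> ^ 3"
    by (rule Maclaurin_sin_bound)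
  moreover have "(\<Sum>m<3. sin_coeff m * y ^ m) = y"
    by (simp add: numeral_3_eq_3 sin_coeff_def)
  ultimately have "\<bar>sin y - y\<bar> \<le> y ^ 3 / 6"
    using y by (simp add: fact_numeral)
  then have "sin y \<ge> y - y ^ 3 / 6" unfolding abs_le_iff by linarith
  moreover have "y ^ 3 \<le> 4 * y"
  proof -
    have "y\<^sup>2 \<le> 2\<^sup>2" using y y2 by (intro power_mono) auto
    then have "y * y\<^sup>2 \<le> y * 4" using y by (intro mult_left_mono) auto
    then show ?thesis by (simp add: power3_eq_cube power2_eq_square mult.commute mult.assoc)
  qed
  ultimately have sin: "sin y \<ge> y / 3" by simp
  have "(norm (1 - cis x))\<^sup>2 = (2 * sin y)\<^sup>2"
  proof -
    have "(norm (1 - cis x))\<^sup>2 = (1 - cos x)\<^sup>2 + (sin x)\<^sup>2"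
      by (simp add: cmod_power2)
    also have "\<dots> = 2 - 2 * cos x"
      using sin_cos_squared_add[of x] by (simp add: power2_diff)
    also have "cos x = cos (2 * y)" by (simp add: y_def)
    also have "\<dots> = 1 - 2 * (sin y)\<^sup>2" by (rule cos_double_sin)
    finally show ?thesis by (simp add: power_mult_distrib)
  qed
  then have "norm (1 - cis x) = \<bar>2 * sin y\<bar>"
    using power2_eq_iff_nonneg[of "norm (1 - cis x)" "\<bar>2 * sin y\<bar>"] by simp
  then show ?thesis using sin y by (simp add: y_def)
qed

text \<open>
  Applying \<open>loop_gap_bounds_lattice\<close> to the two unit vectors gives one \<open>N\<close> with
  \<open>loop_gap p N j t \<ge> |t|\<^sup>2/K\<close> for every \<open>j\<close>, and \<open>T\<^sub>t\<^sup>N\<close> has norm at most \<open>1 - |t|\<^sup>2/K\<close> because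
  paths that do not close a loop are bounded trivially. The constant \<open>C\<close> pays for the incomplete last block
  of fewer than \<open>N\<close> steps.
\<close>

lemma char_op_torus_decay:
  fixes p :: "(2, 's::finite) rw_steps"
  assumes irr: "irreducible_matrix (rw_Q p)" and aper: "aperiodic_matrix (rw_Q p)"
    and arith: "trivial_arithmetic p"
  shows "\<exists>c C. c > 0 \<and> C \<ge> 1 \<and> (\<forall>t\<in>torus_box. \<forall>v B n j. (\<forall>k. norm (v k) \<le> B) \<longrightarrow>
     norm ((char_op p t ^^ n) v j) \<le> C * exp (- c * (norm t)\<^sup>2) ^ n * B)"
proof -
  have "\<exists>N0. \<forall>N\<ge>N0. \<exists>K\<ge>0. \<forall>t. (norm (1 - cis (tdot t d)))\<^sup>2 \<le> K * loop_gap p N j t" for d j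
    by (rule loop_gap_bounds_lattice[OF assms])
  then obtain N0 where N0: "\<And>d j N. N \<ge> N0 d j \<Longrightarrow> \<exists>K\<ge>0. \<forall>t. (norm (1 - cis (tdot t d)))\<^sup>2 \<le> K * loop_gap p N j t"
    by metis
  define N where "N = Suc ((\<Sum>j\<in>UNIV. N0 (axis 1 1) j) + (\<Sum>j\<in>UNIV. N0 (axis 2 1) j))"
  have Npos: "N > 0" by (simp add: N_def)
  have N1: "N \<ge> N0 (axis 1 1) j" and N2: "N \<ge> N0 (axis 2 1) j" for j
    using member_le_sum[of j UNIV "N0 (axis 1 1)"] member_le_sum[of j UNIV "N0 (axis 2 1)"]
    by (auto simp: N_def)
  obtain K1 K2 where K: "\<And>j. K1 j \<ge> 0" "\<And>j. K2 j \<ge> 0"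
    and K1: "\<And>j t. (norm (1 - cis (tdot t (axis 1 1))))\<^sup>2 \<le> K1 j * loop_gap p N j t"
    and K2: "\<And>j t. (norm (1 - cis (tdot t (axis 2 1))))\<^sup>2 \<le> K2 j * loop_gap p N j t"
    using N0[OF N1] N0[OF N2] by metis
  define K where "K = 1 + (\<Sum>j\<in>UNIV. 9 * (K1 j + K2 j))"
  have Kj: "9 * (K1 j + K2 j) \<le> K" for j
    using member_le_sum[of j UNIV "\<lambda>j. 9 * (K1 j + K2 j)"] K by (simp add: K_def)
  have Kpos: "K > 0" unfolding K_def using K by (intro add_pos_nonneg sum_nonneg) auto
  have gap: "(norm t)\<^sup>2 / K \<le> loop_gap p N j t" if t: "t \<in> torus_box" for t j
  proof -
    have t1: "\<bar>fst t\<bar> \<le> pi" and t2: "\<bar>snd t\<bar> \<le> pi"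
      using t by (auto simp: torus_box_def mem_Times_iff abs_le_iff)
    have e: "tdot t (axis 1 1) = fst t" "tdot t (axis 2 1) = snd t"
      by (simp_all add: tdot_def axis_def)
    have "(\<bar>fst t\<bar> / 3)\<^sup>2 \<le> K1 j * loop_gap p N j t"
      using K1[of t j] norm_one_minus_cis_ge[OF t1] unfolding e
      by (meson order.trans power_mono abs_ge_zero divide_nonneg_nonneg zero_le_numeral)
    moreover have "(\<bar>snd t\<bar> / 3)\<^sup>2 \<le> K2 j * loop_gap p N j t"
      using K2[of t j] norm_one_minus_cis_ge[OF t2] unfolding e
      by (meson order.trans power_mono abs_ge_zero divide_nonneg_nonneg zero_le_numeral)
    ultimately have le: "(norm t)\<^sup>2 \<le> 9 * (K1 j + K2 j) * loop_gap p N j t"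
      by (cases t) (simp add: norm_Pair power_divide algebra_simps)
    have "loop_gap p N j t \<ge> 0"
    proof (rule ccontr)
      assume "\<not> loop_gap p N j t \<ge> 0"
      then have neg: "loop_gap p N j t < 0" by simp
      have "norm ((char_op p t ^^ N) (\<lambda>i. of_bool (i = j)) j) \<le> measure_pmf.expectation (rw_law p N (0, j)) (\<lambda>z. norm (cis (tdot t (fst z)) * of_bool (snd z = j)))"
        unfolding char_op_pow_eq_expectation by (rule integral_norm_bound)
      also have "\<dots> = measure_pmf.expectation (rw_law p N (0, j)) (indicator {z. snd z = j})"
        by (intro Bochner_Integration.integral_cong) (auto simp: norm_mult)
      also have "\<dots> = mat_power (rw_Q p) N $ j $ j" by (simp add: mat_power_entry)
      finally show False using neg by (simp add: loop_gap_def)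
    qed
    then have "(norm t)\<^sup>2 \<le> K * loop_gap p N j t"
      using le mult_right_mono[OF Kj[of j]] by fastforce
    then show ?thesis using Kpos by (simp add: divide_le_eq mult.commute)
  qed
  have block: "norm ((char_op p t ^^ N) v j) \<le> exp (- ((norm t)\<^sup>2 / K)) * B"
    if t: "t \<in> torus_box" and v: "\<And>k. norm (v k) \<le> B" for t v B j
  proof -
    let ?P = "rw_law p N (0, j)"
    have B: "B \<ge> 0" using v[of j] norm_ge_zero order.trans by blast
    define u where "u = (\<lambda>i. v i * of_bool (i \<noteq> j))"
    have "(char_op p t ^^ N) v j = (char_op p t ^^ N) (\<lambda>i. v j * of_bool (i = j) + u i) j"
      by (rule arg_cong[where f="\<lambda>w. (char_op p t ^^ N) w j"]) (auto simp: u_def)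
    also have "\<dots> = v j * (char_op p t ^^ N) (\<lambda>i. of_bool (i = j)) j + (char_op p t ^^ N) u j"
      by (simp only: char_op_pow_add char_op_pow_mult)
    finally have "norm ((char_op p t ^^ N) v j) \<le> B * norm ((char_op p t ^^ N) (\<lambda>i. of_bool (i = j)) j)
        + norm ((char_op p t ^^ N) u j)"
      using v[of j] by (simp only: ) (intro order.trans[OF norm_triangle_ineq] add_mono, auto simp: norm_mult intro!: mult_right_mono)
    also have "norm ((char_op p t ^^ N) u j) \<le> B * (1 - mat_power (rw_Q p) N $ j $ j)"
    proof -
      have "norm ((char_op p t ^^ N) u j) \<le> measure_pmf.expectation ?P (\<lambda>z. norm (cis (tdot t (fst z)) * u (snd z)))"
        unfolding char_op_pow_eq_expectation by (rule integral_norm_bound)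
      also have "\<dots> \<le> measure_pmf.expectation ?P (\<lambda>z. B * indicator (- {z. snd z = j}) z)"
      proof (rule integral_mono)
        show "integrable (measure_pmf ?P) (\<lambda>z. norm (cis (tdot t (fst z)) * u (snd z)))"
          by (intro integrable_norm integrable_char)
        show "integrable (measure_pmf ?P) (\<lambda>z. B * indicator (- {z. snd z = j}) z)"
          by (intro integrable_mult_right integrable_real_indicator) (auto simp: measure_pmf.emeasure_eq_measure)
      qed (use v B in \<open>auto simp: u_def norm_mult indicator_def\<close>)
      also have "\<dots> = B * measure_pmf.prob ?P (- {z. snd z = j})"
        by simp
      also have "measure_pmf.prob ?P (- {z. snd z = j}) = 1 - mat_power (rw_Q p) N $ j $ j"
        unfolding mat_power_entry using measure_pmf.prob_compl[of "{z. snd z = j}" ?P]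
        by (simp add: Compl_eq_Diff_UNIV)
      finally show ?thesis .
    qed
    finally have "norm ((char_op p t ^^ N) v j) \<le> B * (1 - loop_gap p N j t)"
      by (simp add: loop_gap_def algebra_simps)
    also have "\<dots> \<le> B * exp (- ((norm t)\<^sup>2 / K))"
    proof (intro mult_left_mono B)
      have "1 - loop_gap p N j t \<le> 1 + - ((norm t)\<^sup>2 / K)" using gap[OF t, of j] by simp
      also have "\<dots> \<le> exp (- ((norm t)\<^sup>2 / K))" by (rule exp_ge_add_one_self)
      finally show "1 - loop_gap p N j t \<le> exp (- ((norm t)\<^sup>2 / K))" .
    qed
    finally show ?thesis by (simp add: mult.commute)
  qed
  have blocks: "norm ((char_op p t ^^ (N * m)) v j) \<le> exp (- ((norm t)\<^sup>2 / K)) ^ m * B"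
    if t: "t \<in> torus_box" and v: "\<And>k. norm (v k) \<le> B" for t v B j m
  proof (induction m arbitrary: j)
    case (Suc m)
    have "(char_op p t ^^ (N * Suc m)) v = (char_op p t ^^ N) ((char_op p t ^^ (N * m)) v)"
      by (simp add: funpow_add)
    then show ?case using block[OF t Suc] by (simp add: mult.assoc)
  qed (use v in auto)
  define c where "c = 1 / (K * N)"
  define C where "C = exp (2 * pi\<^sup>2 / K)"
  have c: "c > 0" using Kpos Npos by (simp add: c_def)
  show ?thesis
  proof (rule exI[of _ c], rule exI[of _ C], intro conjI ballI allI impI)
    show "C \<ge> 1" using Kpos by (simp add: C_def)
    fix t and v :: "'s \<Rightarrow> complex" and B n j assume t: "t \<in> torus_box" and v: "\<forall>k. norm (v k) \<le> B"
    then have B: "B \<ge> 0" using norm_ge_zero order.trans by blast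
    have "(char_op p t ^^ n) v j = (char_op p t ^^ (n mod N)) ((char_op p t ^^ (N * (n div N))) v) j"
      using funpow_add[of "n mod N" "N * (n div N)" "char_op p t"] by simp
    then have "norm ((char_op p t ^^ n) v j) \<le> exp (- ((norm t)\<^sup>2 / K)) ^ (n div N) * B"
      using blocks[OF t, of v B] v by (metis char_op_pow_norm_le)
    also have "exp (- ((norm t)\<^sup>2 / K)) ^ (n div N) \<le> C * exp (- c * (norm t)\<^sup>2) ^ n"
    proof -
      have tn: "(norm t)\<^sup>2 \<le> 2 * pi\<^sup>2"
      proof -
        have "\<bar>fst t\<bar> \<le> pi" "\<bar>snd t\<bar> \<le> pi"
          using t by (auto simp: torus_box_def mem_Times_iff abs_le_iff)
        then have "(fst t)\<^sup>2 \<le> pi\<^sup>2" "(snd t)\<^sup>2 \<le> pi\<^sup>2" by (simp_all add: abs_le_square_iff[symmetric])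
        then show ?thesis by (cases t) (simp add: norm_Pair)
      qed
      define r where "r = (norm t)\<^sup>2 / K"
      have r: "0 \<le> r" "r \<le> 2 * pi\<^sup>2 / K" using tn Kpos by (auto simp: r_def divide_right_mono)
      have "real n \<le> real N * real (n div N) + real N"
      proof -
        have "n \<le> N * (n div N) + N"
          using mod_less_divisor[OF Npos, of n] mult_div_mod_eq[of N n] by linarith
        then show ?thesis by (metis of_nat_add of_nat_le_iff of_nat_mult)
      qed
      then have "real n / real N \<le> real (n div N) + 1"
        using Npos by (simp add: divide_le_eq algebra_simps)
      then have "real n / real N * r \<le> (real (n div N) + 1) * r"
        using r by (intro mult_right_mono) auto
      then have "real n / real N * r - real (n div N) * r \<le> 2 * pi\<^sup>2 / K"
        using r by (simp add: algebra_simps)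
      moreover have "real n * (- c * (norm t)\<^sup>2) = - (real n / real N * r)"
        by (simp add: c_def r_def mult.commute)
      ultimately have "- real (n div N) * r \<le> 2 * pi\<^sup>2 / K + real n * (- c * (norm t)\<^sup>2)"
        by linarith
      then have "exp (- real (n div N) * r) \<le> exp (2 * pi\<^sup>2 / K + real n * (- c * (norm t)\<^sup>2))"
        by simp
      then show ?thesis
        unfolding C_def exp_add exp_of_nat_mult[symmetric] r_def by simp
    qed
    finally show "norm ((char_op p t ^^ n) v j) \<le> C * exp (- c * (norm t)\<^sup>2) ^ n * B"
      using B by (simp add: mult_right_mono)
  qed (rule c)
qed

section \<open>Expansion of the step kernel at the origin\<close>

lemma step_moment_lincomb:
  fixes p :: "(2, 's::finite) rw_steps"
  assumes "\<And>j. integrable (measure_pmf (p j)) (\<lambda>z. w1 (fst z))"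
    and "\<And>j. integrable (measure_pmf (p j)) (\<lambda>z. w2 (fst z))"
  shows "step_moment p (\<lambda>y. a * w1 y + b * w2 y) = a *\<^sub>R step_moment p w1 + b *\<^sub>R step_moment p w2"
proof -
  have i: "integrable (measure_pmf (p j)) (\<lambda>z. w1 (fst z) * of_bool (snd z = k))"
      "integrable (measure_pmf (p j)) (\<lambda>z. w2 (fst z) * of_bool (snd z = k))" for j k
    by (rule Bochner_Integration.integrable_bound[OF assms(1)[of j]] Bochner_Integration.integrable_bound[OF assms(2)[of j]]; auto)+
  have "measure_pmf.expectation (p j) (\<lambda>z. (a * w1 (fst z) + b * w2 (fst z)) * of_bool (snd z = k))
     = measure_pmf.expectation (p j) (\<lambda>z. a * (w1 (fst z) * of_bool (snd z = k)) + b * (w2 (fst z) * of_bool (snd z = k)))" for j k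
    by (simp add: algebra_simps)
  also have "\<dots> j k = a * measure_pmf.expectation (p j) (\<lambda>z. w1 (fst z) * of_bool (snd z = k))
      + b * measure_pmf.expectation (p j) (\<lambda>z. w2 (fst z) * of_bool (snd z = k))" for j k
    by (subst Bochner_Integration.integral_add) (auto intro!: integrable_mult_right i)
  finally show ?thesis by (simp add: vec_eq_iff step_moment_def)
qed

lemma power_le_one_plus_power4: "(x::real) \<ge> 0 \<Longrightarrow> r \<le> 4 \<Longrightarrow> x ^ r \<le> 1 + x ^ 4"
  by (cases "x \<le> 1") (auto intro: order.trans[OF power_le_one] order.trans[OF power_increasing[of r 4 x]])

locale internal_walk =
  fixes p :: "(2, 's::finite) rw_steps" and \<mu> :: "real ^ 's"
  assumes irreducible: "irreducible_matrix (rw_Q p)"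
    and aperiodic: "aperiodic_matrix (rw_Q p)"
    and stationary: "stationary_distribution (rw_Q p) \<mu>"
    and arithmetic: "trivial_arithmetic p"
    and mean: "zero_mean p \<mu>"
    and fourth_moments: "moment_converges 4 p"
begin

abbreviation Q where "Q \<equiv> rw_Q p"

definition moment_op :: "nat \<Rightarrow> real \<times> real \<Rightarrow> real ^ 's ^ 's" where
  "moment_op r t = step_moment p (\<lambda>y. tdot t y ^ r)"

lemma integrable_power_bound:
  assumes "\<And>y. \<bar>w y\<bar> \<le> B * norm (real_vec y) ^ r" "r \<le> 4"
  shows "integrable (measure_pmf (p j)) (\<lambda>z. w (fst z))"
proof (rule Bochner_Integration.integrable_bound)
  show "integrable (measure_pmf (p j)) (\<lambda>z. \<bar>B\<bar> * (1 + norm (real_vec (fst z)) ^ 4))"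
    using moment_converges_integrable[OF fourth_moments] by simp
  have "\<bar>w y\<bar> \<le> \<bar>B\<bar> * (1 + norm (real_vec y) ^ 4)" for y
  proof -
    have "\<bar>w y\<bar> \<le> \<bar>B\<bar> * norm (real_vec y) ^ r"
      by (rule order.trans[OF assms(1) mult_right_mono]) auto
    also have "\<dots> \<le> \<bar>B\<bar> * (1 + norm (real_vec y) ^ 4)"
      using assms(2) by (intro mult_left_mono power_le_one_plus_power4) auto
    finally show ?thesis .
  qed
  then show "AE z in measure_pmf (p j). norm (w (fst z)) \<le> norm (\<bar>B\<bar> * (1 + norm (real_vec (fst z)) ^ 4))"
    by (auto intro!: AE_I2 simp: abs_mult)
qed auto

lemma abs_tdot_power_le: "\<bar>tdot t y ^ r\<bar> \<le> norm t ^ r * norm (real_vec y) ^ r"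
  unfolding power_abs power_mult_distrib[symmetric] by (intro power_mono abs_tdot_le) auto

lemma integrable_tdot_power: "r \<le> 4 \<Longrightarrow> integrable (measure_pmf (p j)) (\<lambda>z. tdot t (fst z) ^ r)"
  by (rule integrable_power_bound[OF abs_tdot_power_le])

lemma moment_op_vec:
  assumes "r \<le> 4"
  shows "integrable (measure_pmf (p j)) (\<lambda>z. tdot t (fst z) ^ r * f $ snd z)"
    and "(moment_op r t *v f) $ j = measure_pmf.expectation (p j) (\<lambda>z. tdot t (fst z) ^ r * f $ snd z)"
  unfolding moment_op_def
  using step_moment_mult_vec[where p=p and j=j and w="\<lambda>y. tdot t y ^ r" and f=f, OF integrable_tdot_power[OF assms]]
  by simp_all

lemma moment_op_0: "moment_op 0 t = Q"
  by (simp add: moment_op_def rw_Q_eq)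

lemma hpoly_step_moment:
  assumes "\<And>y. \<bar>w y\<bar> \<le> norm (real_vec y) ^ s" "r + s \<le> 4"
  shows "hpoly r (\<lambda>t. step_moment p (\<lambda>y. tdot t y ^ r * w y))"
  using assms
proof (induction r arbitrary: w s)
  case 0
  show ?case by (simp add: hpoly_const)
next
  case (Suc r)
  have comp: "\<bar>real_of_int (y $ i) * w y\<bar> \<le> norm (real_vec y) ^ Suc s" for y i
  proof -
    have "\<bar>real_of_int (y $ i)\<bar> \<le> norm (real_vec y)"
      using component_le_norm_cart[of "real_vec y" i] by (simp add: real_vec_def)
    then show ?thesis unfolding abs_mult power_Suc by (intro mult_mono Suc.prems) auto
  qed
  have int: "integrable (measure_pmf (p j)) (\<lambda>z. tdot t (fst z) ^ r * (real_of_int (fst z $ i) * w (fst z)))" for t i j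
  proof (rule integrable_power_bound[where w="\<lambda>y. tdot t y ^ r * (real_of_int (y $ i) * w y)" and r="r + Suc s" and B="norm t ^ r"])
    fix y
    have "\<bar>tdot t y ^ r\<bar> * \<bar>real_of_int (y $ i) * w y\<bar> \<le> (norm t ^ r * norm (real_vec y) ^ r) * norm (real_vec y) ^ Suc s"
      by (intro mult_mono abs_tdot_power_le comp) auto
    then show "\<bar>tdot t y ^ r * (real_of_int (y $ i) * w y)\<bar> \<le> norm t ^ r * norm (real_vec y) ^ (r + Suc s)"
      by (simp add: abs_mult power_add mult_ac)
  qed (use Suc.prems in auto)
  have "step_moment p (\<lambda>y. tdot t y ^ Suc r * w y)
     = fst t *\<^sub>R step_moment p (\<lambda>y. tdot t y ^ r * (real_of_int (y $ 1) * w y))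
      + snd t *\<^sub>R step_moment p (\<lambda>y. tdot t y ^ r * (real_of_int (y $ 2) * w y))" for t
  proof -
    have "(\<lambda>y. tdot t y ^ Suc r * w y) = (\<lambda>y. fst t * (tdot t y ^ r * (real_of_int (y $ 1) * w y))
      + snd t * (tdot t y ^ r * (real_of_int (y $ 2) * w y)))"
    proof
      fix y
      show "tdot t y ^ Suc r * w y = fst t * (tdot t y ^ r * (real_of_int (y $ 1) * w y))
      + snd t * (tdot t y ^ r * (real_of_int (y $ 2) * w y))"
        unfolding power_Suc tdot_def[of t y, THEN arg_cong[where f="\<lambda>x. x * tdot t y ^ r"]]
        by (simp add: algebra_simps)
    qed
    then show ?thesis
      using step_moment_lincomb[OF int[where t=t and i=1] int[where t=t and i=2], where a="fst t" and b="snd t"] by simp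
  qed
  then show ?case
    using Suc.IH[OF comp[where i=1]] Suc.IH[OF comp[where i=2]] Suc.prems(2) by (intro hpoly_SucI) auto
qed

lemma hpoly_moment_op: "r \<le> 4 \<Longrightarrow> hpoly r (moment_op r)"
  using hpoly_step_moment[of "\<lambda>_. 1" 0 r] by (simp add: moment_op_def[abs_def])

lemma hpoly_moment_op_vec:
  "r \<le> 4 \<Longrightarrow> hpoly n f \<Longrightarrow> hpoly (r + n) (\<lambda>t. moment_op r t *v f t)"
  by (rule hpoly_bilinear[OF _ hpoly_moment_op])
    (auto simp: bilinear_conv_bounded_bilinear[symmetric] bilinear_def
      intro!: linearI simp: matrix_vector_mult_add_rdistrib matrix_vector_right_distrib
        scaleR_matrix_vector_assoc matrix_vector_mult_scaleR)

text \<open>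
  Taylor's formula for the exponential under the expectation; the remainder of order \<open>m + 1 \<le> 4\<close> is
  where fourth moments enter.
\<close>

lemma char_op_taylor:
  "\<exists>C\<ge>0. \<forall>m\<le>3. \<forall>t f j. norm (char_op p t (cvec f) j - (\<Sum>r\<le>m. \<i> ^ r / fact r * of_real ((moment_op r t *v f) $ j)))
     \<le> C * norm t ^ Suc m * norm f"
proof -
  define C where "C = (\<Sum>j\<in>UNIV. measure_pmf.expectation (p j) (\<lambda>z. 1 + norm (real_vec (fst z)) ^ 4))"
  have int4: "integrable (measure_pmf (p j)) (\<lambda>z. 1 + norm (real_vec (fst z)) ^ 4)" for j
    using moment_converges_integrable[OF fourth_moments] by simp
  have E0: "0 \<le> measure_pmf.expectation (p j) (\<lambda>z. 1 + norm (real_vec (fst z)) ^ 4)" for j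
    by (rule Bochner_Integration.integral_nonneg) auto
  have EC: "measure_pmf.expectation (p j) (\<lambda>z. 1 + norm (real_vec (fst z)) ^ 4) \<le> C" for j
    unfolding C_def by (rule member_le_sum) (auto intro: E0)
  have "norm (char_op p t (cvec f) j - (\<Sum>r\<le>m. \<i> ^ r / fact r * of_real ((moment_op r t *v f) $ j)))
     \<le> C * norm t ^ Suc m * norm f" if m: "m \<le> 3" for m t f j
  proof -
    let ?g = "\<lambda>z. (cis (tdot t (fst z)) - (\<Sum>r\<le>m. (\<i> * tdot t (fst z)) ^ r / fact r)) * cvec f (snd z)"
    have intr: "integrable (measure_pmf (p j)) (\<lambda>z. \<i> ^ r / fact r * complex_of_real (tdot t (fst z) ^ r * f $ snd z))" if "r \<le> m" for r
      using that m by (intro integrable_mult_right integrable_of_real moment_op_vec) auto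
    have intc: "integrable (measure_pmf (p j)) (\<lambda>z. cis (tdot t (fst z)) * cvec f (snd z))"
      by (rule integrable_char)
    have g: "?g z = cis (tdot t (fst z)) * cvec f (snd z) - (\<Sum>r\<le>m. \<i> ^ r / fact r * complex_of_real (tdot t (fst z) ^ r * f $ snd z))" for z
      by (simp add: left_diff_distrib right_diff_distrib cvec_def sum_distrib_right sum_distrib_left power_mult_distrib mult_ac)
    have "char_op p t (cvec f) j - (\<Sum>r\<le>m. \<i> ^ r / fact r * of_real ((moment_op r t *v f) $ j))
       = measure_pmf.expectation (p j) ?g"
    proof -
      have "measure_pmf.expectation (p j) ?g = char_op p t (cvec f) j
         - measure_pmf.expectation (p j) (\<lambda>z. \<Sum>r\<le>m. \<i> ^ r / fact r * complex_of_real (tdot t (fst z) ^ r * f $ snd z))"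
        unfolding g char_op_def
        by (intro Bochner_Integration.integral_diff intc Bochner_Integration.integrable_sum intr) auto
      also have "measure_pmf.expectation (p j) (\<lambda>z. \<Sum>r\<le>m. \<i> ^ r / fact r * complex_of_real (tdot t (fst z) ^ r * f $ snd z))
        = (\<Sum>r\<le>m. measure_pmf.expectation (p j) (\<lambda>z. \<i> ^ r / fact r * complex_of_real (tdot t (fst z) ^ r * f $ snd z)))"
        by (intro Bochner_Integration.integral_sum intr) auto
      also have "\<dots> = (\<Sum>r\<le>m. \<i> ^ r / fact r * of_real ((moment_op r t *v f) $ j))"
      proof (intro sum.cong refl)
        fix r assume "r \<in> {..m}"
        with m have r: "r \<le> 4" by simp
        show "measure_pmf.expectation (p j) (\<lambda>z. \<i> ^ r / fact r * complex_of_real (tdot t (fst z) ^ r * f $ snd z))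
           = \<i> ^ r / fact r * of_real ((moment_op r t *v f) $ j)"
          unfolding integral_mult_right_zero moment_op_vec(2)[OF r] integral_complex_of_real ..
      qed
      finally show ?thesis by simp
    qed
    also have "norm \<dots> \<le> measure_pmf.expectation (p j) (\<lambda>z. norm (?g z))"
      by (rule integral_norm_bound)
    also have "\<dots> \<le> measure_pmf.expectation (p j) (\<lambda>z. norm t ^ Suc m * norm f * (1 + norm (real_vec (fst z)) ^ 4))"
    proof (rule integral_mono)
      show "integrable (measure_pmf (p j)) (\<lambda>z. norm (?g z))"
        unfolding g by (intro integrable_norm Bochner_Integration.integrable_diff intc Bochner_Integration.integrable_sum intr) auto
      show "integrable (measure_pmf (p j)) (\<lambda>z. norm t ^ Suc m * norm f * (1 + norm (real_vec (fst z)) ^ 4))"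
        by (intro integrable_mult_right int4)
      fix z :: "(int ^ 2) \<times> 's"
      have "norm (cis (tdot t (fst z)) - (\<Sum>r\<le>m. (\<i> * tdot t (fst z)) ^ r / fact r)) \<le> \<bar>tdot t (fst z)\<bar> ^ Suc m / fact (Suc m)"
        unfolding cis_conv_exp by (rule iexp_approx1)
      also have "\<dots> \<le> \<bar>tdot t (fst z)\<bar> ^ Suc m"
        by (simp add: divide_le_eq del: fact_Suc power_Suc) (metis fact_ge_1 mult_left_mono mult.right_neutral zero_le_power abs_ge_zero)
      also have "\<dots> \<le> norm t ^ Suc m * norm (real_vec (fst z)) ^ Suc m"
        using abs_tdot_power_le[of t "fst z" "Suc m"] by (simp only: power_abs)
      also have "\<dots> \<le> norm t ^ Suc m * (1 + norm (real_vec (fst z)) ^ 4)"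
        using m by (intro mult_left_mono power_le_one_plus_power4) auto
      finally have 1: "norm (cis (tdot t (fst z)) - (\<Sum>r\<le>m. (\<i> * tdot t (fst z)) ^ r / fact r)) \<le> norm t ^ Suc m * (1 + norm (real_vec (fst z)) ^ 4)" .
      have 2: "norm (cvec f (snd z)) \<le> norm f"
        using component_le_norm_cart[of f "snd z"] by (simp add: cvec_def)
      have "norm (?g z) \<le> (norm t ^ Suc m * (1 + norm (real_vec (fst z)) ^ 4)) * norm f"
        unfolding norm_mult by (intro mult_mono 1 2) auto
      then show "norm (?g z) \<le> norm t ^ Suc m * norm f * (1 + norm (real_vec (fst z)) ^ 4)"
        by (simp only: mult_ac)
    qed
    also have "\<dots> = norm t ^ Suc m * norm f * measure_pmf.expectation (p j) (\<lambda>z. 1 + norm (real_vec (fst z)) ^ 4)"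
      by (rule integral_mult_right_zero)
    also have "\<dots> \<le> norm t ^ Suc m * norm f * C"
      by (intro mult_left_mono EC) auto
    finally show ?thesis by (simp only: mult_ac)
  qed
  moreover have "C \<ge> 0" unfolding C_def by (intro sum_nonneg E0)
  ultimately show ?thesis by blast
qed

lemma Q_one: "Q *v 1 = 1"
  by (simp add: vec_eq_iff rw_Q_mult_vec)

lemma inner_one: "\<mu> \<bullet> 1 = 1"
  using stationary by (simp add: stationary_distribution_def inner_vec_def)

lemmas inner_Q = stationary_inner[OF stationary]

section \<open>The Poisson equation\<close>

lemma Q_fixed_zero:
  assumes "Q *v h = h" "\<mu> \<bullet> h = 0"
  shows "h = 0"
proof -
  obtain \<rho> C where "0 < \<rho>" "\<rho> < 1" and C: "\<And>h n. \<mu> \<bullet> h = 0 \<Longrightarrow> norm (mat_power Q n *v h) \<le> C * \<rho> ^ n * norm h"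
    using geometric_ergodicity[OF irreducible aperiodic stationary] by blast
  have "mat_power Q n *v h = h" for n
    by (induction n) (simp_all add: matrix_vector_mul_assoc[symmetric] assms)
  then have "norm h \<le> C * \<rho> ^ n * norm h" for n using C[OF assms(2), of n] by simp
  moreover have "(\<lambda>n. C * \<rho> ^ n * norm h) \<longlonglongrightarrow> C * 0 * norm h"
    using \<open>0 < \<rho>\<close> \<open>\<rho> < 1\<close> by (intro tendsto_intros LIMSEQ_power_zero) auto
  ultimately have "norm h \<le> C * 0 * norm h" by (intro LIMSEQ_le_const) auto
  then show ?thesis by simp
qed

text \<open>
  The inverse of \<open>1 - Q + \<Pi>\<close>, where \<open>\<Pi> h\<close> is the constant function with value \<open>\<langle>\<mu>, h\<rangle>\<close>. On
  \<open>\<mu>\<close>-centred vectors it inverts \<open>1 - Q\<close>, and unlike \<open>(Q - 1)\<^sup>-\<^sup>1\<close> of the definition of the covariance it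
  is a linear map on the whole space.
\<close>

definition poisson :: "real ^ 's \<Rightarrow> real ^ 's" where
  "poisson = (SOME g. linear g \<and> (\<forall>h. g (h - Q *v h + (\<mu> \<bullet> h) *\<^sub>R 1) = h) \<and>
     (\<forall>h. g h - Q *v g h + (\<mu> \<bullet> g h) *\<^sub>R 1 = h))"

lemma poisson_spec:
  shows "linear poisson" and "poisson (h - Q *v h + (\<mu> \<bullet> h) *\<^sub>R 1) = h"
    and "poisson h - Q *v poisson h + (\<mu> \<bullet> poisson h) *\<^sub>R 1 = h"
proof -
  let ?L = "\<lambda>h. h - Q *v h + (\<mu> \<bullet> h) *\<^sub>R 1"
  have lin: "linear ?L"
    by (rule linearI) (auto simp: algebra_simps inner_add_right matrix_vector_right_distrib matrix_vector_mult_scaleR)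
  have "h = 0" if "?L h = 0" for h
  proof (rule Q_fixed_zero)
    have "\<mu> \<bullet> ?L h = \<mu> \<bullet> h" by (simp add: inner_add_right inner_diff_right inner_Q inner_one)
    then show 0: "\<mu> \<bullet> h = 0" using that by simp
    show "Q *v h = h" using that 0 by simp
  qed
  then have "inj ?L" using linear_injective_0[OF lin] by blast
  then have "\<exists>g. linear g \<and> (\<forall>h. g (?L h) = h) \<and> (\<forall>h. ?L (g h) = h)"
    by (rule linear_injective_isomorphism[OF lin]) (rule refl)
  from someI_ex[OF this] show "linear poisson" "poisson (h - Q *v h + (\<mu> \<bullet> h) *\<^sub>R 1) = h"
    "poisson h - Q *v poisson h + (\<mu> \<bullet> poisson h) *\<^sub>R 1 = h"
    unfolding poisson_def[symmetric] by blast+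
qed

lemma inner_poisson: "\<mu> \<bullet> poisson h = \<mu> \<bullet> h"
  using arg_cong[OF poisson_spec(3), of "\<lambda>v. \<mu> \<bullet> v" h]
  by (simp add: inner_add_right inner_diff_right inner_Q inner_one)

lemma Q_poisson: "\<mu> \<bullet> h = 0 \<Longrightarrow> Q *v poisson h = poisson h - h"
  using poisson_spec(3)[of h] by (simp add: inner_poisson algebra_simps)

lemma poisson_left: "\<mu> \<bullet> h = 0 \<Longrightarrow> poisson (h - Q *v h) = h"
  using poisson_spec(2)[of h] by simp

lemma Q_minus_one_inv_eq:
  assumes "\<mu> \<bullet> b = 0"
  shows "Q_minus_one_inv p \<mu> b = - poisson b"
  unfolding Q_minus_one_inv_def
proof (rule the_equality)
  show "\<mu> \<bullet> (- poisson b) = 0 \<and> Q *v (- poisson b) - (- poisson b) = b"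
    using assms by (simp add: inner_poisson Q_poisson linear_neg[OF matrix_vector_mul_linear])
  fix v assume v: "\<mu> \<bullet> v = 0 \<and> Q *v v - v = b"
  then have "v - Q *v v = - b" by (metis minus_diff_eq)
  then have "v = poisson (- b)" using poisson_left[of v] v by simp
  then show "v = - poisson b" by (simp add: linear_neg[OF poisson_spec(1)])
qed

end

section \<open>The approximate eigenvector and the covariance\<close>

text \<open>
  The form is tested at \<open>(1, 0)\<close> and \<open>(-b, a)\<close>, and, to exclude \<open>a = 0\<close>, at a vector where it would
  equal \<open>-1\<close>.
\<close>

lemma psd_quad_form_nondegenerate:
  assumes psd: "\<And>t. 0 \<le> quad_form a b d t" and det: "a * d - b\<^sup>2 \<noteq> 0"
  shows "a > 0" "a * d - b\<^sup>2 > 0"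
proof -
  have a0: "a \<ge> 0" using psd[of "(1, 0)"] by (simp add: quad_form_def)
  have "a \<noteq> 0"
  proof
    assume a: "a = 0"
    with det have b: "b \<noteq> 0" by auto
    have "quad_form a b d (- (d + 1) / (2 * b), 1) = - 1"
      using a b by (simp add: quad_form_def)
    with psd[of "(- (d + 1) / (2 * b), 1)"] show False by simp
  qed
  with a0 show a: "a > 0" by simp
  have "quad_form a b d (- b, a) = a * (a * d - b\<^sup>2)"
    by (simp add: quad_form_def algebra_simps power2_eq_square)
  with psd[of "(- b, a)"] have "0 \<le> a * (a * d - b\<^sup>2)" by simp
  with a have "0 \<le> a * d - b\<^sup>2" by (simp add: zero_le_mult_iff)
  with det show "a * d - b\<^sup>2 > 0" by simp
qed

text \<open>
The true bound is \<open>\<surd>2 \<pi>\<close>. An integer bound is enough to absorb surplus powers of \<open>|t|\<close>.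
\<close>

lemma norm_torus_le: "t \<in> torus_box \<Longrightarrow> norm t \<le> 8"
proof -
  assume "t \<in> torus_box"
  then have "\<bar>fst t\<bar> \<le> 4" "\<bar>snd t\<bar> \<le> 4"
    using pi_less_4 by (auto simp: torus_box_def mem_Times_iff abs_le_iff)
  then show ?thesis using norm_Pair_le[of "fst t" "snd t"] by simp
qed

lemma real_vec_component_le: "\<bar>real_vec y $ i\<bar> \<le> norm (real_vec y)"
  by (rule component_le_norm_cart)

context internal_walk
begin

lemma integrable_component: "integrable (measure_pmf (p j)) (\<lambda>z. real_vec (fst z) $ l)"
  by (rule integrable_power_bound[where w="\<lambda>y. real_vec y $ l" and r=1 and B=1])
    (auto intro: real_vec_component_le)

lemma integrable_component2: "integrable (measure_pmf (p j)) (\<lambda>z. real_vec (fst z) $ l * real_vec (fst z) $ m)"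
  by (rule integrable_power_bound[where w="\<lambda>y. real_vec y $ l * real_vec y $ m" and r=2 and B=1])
    (auto simp: abs_mult power2_eq_square intro!: mult_mono real_vec_component_le)

lemma rw_M_eq: "rw_M p l = step_moment p (\<lambda>y. real_vec y $ l)"
  unfolding rw_M_def by (rule infsum_rw_A[OF integrable_component])

lemma rw_Sigma_eq: "rw_Sigma p l m = step_moment p (\<lambda>y. real_vec y $ l * real_vec y $ m)"
  unfolding rw_Sigma_def by (rule infsum_rw_A[OF integrable_component2])

lemma moment_op_1: "moment_op 1 t = fst t *\<^sub>R rw_M p 1 + snd t *\<^sub>R rw_M p 2"
proof -
  have "(\<lambda>y. tdot t y ^ 1) = (\<lambda>y. fst t * real_vec y $ 1 + snd t * real_vec y $ 2)"
    by (simp add: tdot_def real_vec_def)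
  then show ?thesis
    unfolding moment_op_def rw_M_eq
    using step_moment_lincomb[OF integrable_component integrable_component] by simp
qed

lemma moment_op_2:
  "moment_op 2 t = (fst t)\<^sup>2 *\<^sub>R rw_Sigma p 1 1 + (2 * fst t * snd t) *\<^sub>R rw_Sigma p 1 2 + (snd t)\<^sup>2 *\<^sub>R rw_Sigma p 2 2"
proof -
  let ?w = "\<lambda>y. (fst t)\<^sup>2 * (real_vec y $ 1 * real_vec y $ 1) + (2 * fst t * snd t) * (real_vec y $ 1 * real_vec y $ 2)"
  have eq: "(\<lambda>y. tdot t y ^ 2) = (\<lambda>y. 1 * ?w y + (snd t)\<^sup>2 * (real_vec y $ 2 * real_vec y $ 2))"
    by (rule ext) (simp add: tdot_def real_vec_def power2_eq_square algebra_simps)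
  have int: "integrable (measure_pmf (p j)) (\<lambda>z. ?w (fst z))" for j
    by (intro Bochner_Integration.integrable_add integrable_mult_right integrable_component2)
  have "moment_op 2 t = 1 *\<^sub>R step_moment p ?w + (snd t)\<^sup>2 *\<^sub>R rw_Sigma p 2 2"
    unfolding moment_op_def eq rw_Sigma_eq by (rule step_moment_lincomb[OF int integrable_component2])
  also have "step_moment p ?w = (fst t)\<^sup>2 *\<^sub>R rw_Sigma p 1 1 + (2 * fst t * snd t) *\<^sub>R rw_Sigma p 1 2"
    unfolding rw_Sigma_eq by (rule step_moment_lincomb[OF integrable_component2 integrable_component2])
  finally show ?thesis by simp
qed

lemma vec_one: "vec 1 = (1 :: real ^ 's)"
  by (simp add: vec_eq_iff)

lemma mean_zero: "\<mu> \<bullet> (rw_M p l *v 1) = 0"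
  using mean by (simp add: zero_mean_def vec_one)

lemma moment_op_1_vec: "moment_op 1 t *v f = fst t *\<^sub>R (rw_M p 1 *v f) + snd t *\<^sub>R (rw_M p 2 *v f)"
  unfolding moment_op_1 by (simp add: matrix_vector_mult_add_rdistrib scaleR_matrix_vector_assoc)

lemma mean_zero_op: "\<mu> \<bullet> (moment_op 1 t *v 1) = 0"
  unfolding moment_op_1_vec by (simp add: inner_add_right mean_zero)

text \<open>
  The ansatz \<open>T\<^sub>t u = \<lambda> u\<close> with \<open>u = 1 + i f\<^sub>1 + f\<^sub>2 + i f\<^sub>3\<close> and \<open>\<lambda> = 1 - \<sigma>/2 + i \<kappa>\<close>, where
  \<open>f\<^sub>i\<close> has degree \<open>i\<close> in \<open>t\<close>, gives one Poisson equation in each order. Its right-hand side has to be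
  \<open>\<mu>\<close>-centred: in first order this is the zero mean assumption, in second and third order it determines
  \<open>\<sigma>\<close> and \<open>\<kappa>\<close>.
\<close>

definition corrector1 :: "real \<times> real \<Rightarrow> real ^ 's" where
  "corrector1 t = poisson (moment_op 1 t *v 1)"

definition variance_form :: "real \<times> real \<Rightarrow> real" where
  "variance_form t = \<mu> \<bullet> (moment_op 2 t *v 1) + 2 * (\<mu> \<bullet> (moment_op 1 t *v corrector1 t))"

definition corrector2 :: "real \<times> real \<Rightarrow> real ^ 's" where
  "corrector2 t = poisson ((variance_form t / 2) *\<^sub>R 1 - moment_op 1 t *v corrector1 t
      - (1 / 2) *\<^sub>R (moment_op 2 t *v 1))"

definition third_order :: "real \<times> real \<Rightarrow> real ^ 's" where
  "third_order t = moment_op 1 t *v corrector2 t - (1 / 2) *\<^sub>R (moment_op 2 t *v corrector1 t)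
      - (1 / 6) *\<^sub>R (moment_op 3 t *v 1)"

definition skewness_form :: "real \<times> real \<Rightarrow> real" where
  "skewness_form t = \<mu> \<bullet> third_order t"

definition corrector3 :: "real \<times> real \<Rightarrow> real ^ 's" where
  "corrector3 t = poisson (third_order t + (variance_form t / 2) *\<^sub>R corrector1 t - skewness_form t *\<^sub>R 1)"

lemma inner_corrector1: "\<mu> \<bullet> corrector1 t = 0"
  by (simp only: corrector1_def inner_poisson mean_zero_op)

lemma Q_corrector1: "Q *v corrector1 t = corrector1 t - moment_op 1 t *v 1"
  unfolding corrector1_def by (rule Q_poisson[OF mean_zero_op])

lemma Q_corrector2:
  "Q *v corrector2 t = corrector2 t - ((variance_form t / 2) *\<^sub>R 1 - moment_op 1 t *v corrector1 t
      - (1 / 2) *\<^sub>R (moment_op 2 t *v 1))"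
  unfolding corrector2_def
  by (rule Q_poisson) (simp add: variance_form_def inner_diff_right inner_one add_divide_distrib)

lemma Q_corrector3:
  "Q *v corrector3 t = corrector3 t
     - (third_order t + (variance_form t / 2) *\<^sub>R corrector1 t - skewness_form t *\<^sub>R 1)"
  unfolding corrector3_def
  by (rule Q_poisson) (simp add: skewness_form_def inner_diff_right inner_add_right inner_one inner_corrector1)

lemma hpoly_inner: "hpoly n f \<Longrightarrow> hpoly n (\<lambda>t. \<mu> \<bullet> f t)"
  by (rule hpoly_linear[OF bounded_linear.linear[OF bounded_linear_inner_right]])

lemma hpoly_corrector1: "hpoly 1 corrector1"
  unfolding corrector1_def[abs_def]
  using hpoly_linear[OF poisson_spec(1) hpoly_moment_op_vec[of 1 0 "\<lambda>_. 1"]] by (simp add: hpoly_const)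

lemma hpoly_variance_form: "hpoly 2 variance_form"
proof -
  have 1: "hpoly 2 (\<lambda>t. \<mu> \<bullet> (moment_op 2 t *v 1))"
    using hpoly_inner[OF hpoly_moment_op_vec[of 2 0 "\<lambda>_. 1"]] by (simp add: hpoly_const)
  have 2: "hpoly 2 (\<lambda>t. \<mu> \<bullet> (moment_op 1 t *v corrector1 t))"
    using hpoly_inner[OF hpoly_moment_op_vec[of 1, OF _ hpoly_corrector1]] by (simp add: numeral_2_eq_2)
  from hpoly_add[OF 1 hpoly_scaleR[OF 2, of 2]] show ?thesis
    by (simp add: variance_form_def[abs_def])
qed

lemma hpoly_corrector2: "hpoly 2 corrector2"
proof -
  have 1: "hpoly 2 (\<lambda>t. (moment_op 2 t *v 1))"
    using hpoly_moment_op_vec[of 2 0 "\<lambda>_. 1"] by (simp add: hpoly_const)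
  have 2: "hpoly 2 (\<lambda>t. (moment_op 1 t *v corrector1 t))"
    using hpoly_moment_op_vec[of 1, OF _ hpoly_corrector1] by (simp add: numeral_2_eq_2)
  have 3: "hpoly 2 (\<lambda>t. (variance_form t / 2) *\<^sub>R (1 :: real ^ 's))"
    by (rule hpoly_linear[OF _ hpoly_variance_form]) (auto intro!: linearI simp: algebra_simps add_divide_distrib)
  show ?thesis
    unfolding corrector2_def[abs_def]
    by (intro hpoly_linear[OF poisson_spec(1)] hpoly_diff hpoly_scaleR 1 2 3)
qed

lemma hpoly_third_order: "hpoly 3 third_order"
proof -
  have 1: "hpoly 3 (\<lambda>t. (moment_op 3 t *v 1))"
    using hpoly_moment_op_vec[of 3 0 "\<lambda>_. 1"] by (simp add: hpoly_const)
  have 2: "hpoly 3 (\<lambda>t. (moment_op 1 t *v corrector2 t))"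
    using hpoly_moment_op_vec[of 1, OF _ hpoly_corrector2] by (simp add: numeral_3_eq_3)
  have 3: "hpoly 3 (\<lambda>t. (moment_op 2 t *v corrector1 t))"
    using hpoly_moment_op_vec[of 2, OF _ hpoly_corrector1] by simp
  show ?thesis
    unfolding third_order_def[abs_def] by (intro hpoly_diff hpoly_scaleR 1 2 3)
qed

lemma hpoly_skewness_form: "hpoly 3 skewness_form"
  unfolding skewness_form_def[abs_def] by (rule hpoly_inner[OF hpoly_third_order])

lemma hpoly_corrector3: "hpoly 3 corrector3"
proof -
  have 1: "hpoly (2 + 1) (\<lambda>t. (variance_form t / 2) *\<^sub>R corrector1 t)"
    using hpoly_scaleR[OF hpoly_bilinear[OF bounded_bilinear_scaleR hpoly_variance_form hpoly_corrector1], of "1/2"]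
    by simp
  have 2: "hpoly 3 (\<lambda>t. skewness_form t *\<^sub>R (1 :: real ^ 's))"
    by (rule hpoly_linear[OF _ hpoly_skewness_form]) (auto intro!: linearI simp: algebra_simps)
  show ?thesis
    unfolding corrector3_def[abs_def]
    using 1 by (intro hpoly_linear[OF poisson_spec(1)] hpoly_diff hpoly_add hpoly_third_order 2) simp
qed

text \<open>
  By the first Poisson equation \<open>t\<cdot>y + f\<^sub>1(k) - f\<^sub>1(j)\<close> has mean zero under the step distribution of every
  state \<open>j\<close>. Expanding its second moment and averaging over \<open>\<mu>\<close> gives \<open>\<sigma>(t)\<close>.
\<close>

lemma variance_form_nonneg: "variance_form t \<ge> 0"
proof -
  define h where "h = corrector1 t"
  define h2 where "h2 = (\<chi> k. (h $ k)\<^sup>2)"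
  have expect: "measure_pmf.expectation (p j) (\<lambda>z. (tdot t (fst z) + h $ snd z - h $ j)\<^sup>2)
     = (moment_op 2 t *v 1) $ j + 2 * (moment_op 1 t *v h) $ j + (moment_op 0 t *v h2) $ j
       - 2 * h $ j * ((moment_op 1 t *v 1) $ j + (moment_op 0 t *v h) $ j) + (h $ j)\<^sup>2 * (moment_op 0 t *v 1) $ j" for j
  proof -
    have hb: "has_bochner_integral (measure_pmf (p j)) (\<lambda>z. tdot t (fst z) ^ r * f $ snd z) ((moment_op r t *v f) $ j)"
      if "r \<le> 4" for r f
      using moment_op_vec[OF that] by (simp add: has_bochner_integral_iff)
    have "has_bochner_integral (measure_pmf (p j))
       (\<lambda>z. tdot t (fst z) ^ 2 * 1 $ snd z + 2 * (tdot t (fst z) ^ 1 * h $ snd z) + tdot t (fst z) ^ 0 * h2 $ snd z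
          - (2 * h $ j) * (tdot t (fst z) ^ 1 * 1 $ snd z + tdot t (fst z) ^ 0 * h $ snd z)
          + (h $ j)\<^sup>2 * (tdot t (fst z) ^ 0 * 1 $ snd z))
      ((moment_op 2 t *v 1) $ j + 2 * (moment_op 1 t *v h) $ j + (moment_op 0 t *v h2) $ j
       - (2 * h $ j) * ((moment_op 1 t *v 1) $ j + (moment_op 0 t *v h) $ j) + (h $ j)\<^sup>2 * (moment_op 0 t *v 1) $ j)"
      by (intro has_bochner_integral_add has_bochner_integral_diff has_bochner_integral_mult_right hb) simp_all
    also have "(\<lambda>z. tdot t (fst z) ^ 2 * 1 $ snd z + 2 * (tdot t (fst z) ^ 1 * h $ snd z) + tdot t (fst z) ^ 0 * h2 $ snd z
          - (2 * h $ j) * (tdot t (fst z) ^ 1 * 1 $ snd z + tdot t (fst z) ^ 0 * h $ snd z)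
          + (h $ j)\<^sup>2 * (tdot t (fst z) ^ 0 * 1 $ snd z)) = (\<lambda>z. (tdot t (fst z) + h $ snd z - h $ j)\<^sup>2)"
      by (rule ext) (simp add: h2_def power2_eq_square algebra_simps)
    finally show ?thesis by (rule has_bochner_integral_integral_eq)
  qed
  have Qh: "moment_op 1 t *v 1 + moment_op 0 t *v h = h"
    by (simp add: moment_op_0 h_def Q_corrector1)
  have "0 \<le> (\<Sum>j\<in>UNIV. \<mu> $ j * measure_pmf.expectation (p j) (\<lambda>z. (tdot t (fst z) + h $ snd z - h $ j)\<^sup>2))"
    using stationary
    by (intro sum_nonneg mult_nonneg_nonneg Bochner_Integration.integral_nonneg) (auto simp: stationary_distribution_def)
  also have "\<dots> = (\<Sum>j\<in>UNIV. \<mu> $ j * ((moment_op 2 t *v 1 + 2 *\<^sub>R (moment_op 1 t *v h) + Q *v h2 - h2) $ j))"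
  proof (intro sum.cong refl arg_cong[where f="\<lambda>x. _ * x"])
    fix j
    have "(moment_op 1 t *v 1) $ j + (moment_op 0 t *v h) $ j = h $ j"
      using arg_cong[OF Qh, of "\<lambda>v. v $ j"] by simp
    then show "measure_pmf.expectation (p j) (\<lambda>z. (tdot t (fst z) + h $ snd z - h $ j)\<^sup>2)
      = (moment_op 2 t *v 1 + 2 *\<^sub>R (moment_op 1 t *v h) + Q *v h2 - h2) $ j"
      unfolding expect by (simp add: moment_op_0 Q_one h2_def power2_eq_square)
  qed
  also have "\<dots> = \<mu> \<bullet> (moment_op 2 t *v 1 + 2 *\<^sub>R (moment_op 1 t *v h) + Q *v h2 - h2)"
    by (simp add: inner_vec_def)
  also have "\<dots> = variance_form t"
    by (simp add: inner_add_right inner_diff_right inner_Q variance_form_def h_def)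
  finally show ?thesis .
qed

lemma rw_covariance_entry:
  "rw_covariance p \<mu> $ l $ m = \<mu> \<bullet> (rw_Sigma p l m *v 1) + \<mu> \<bullet> (rw_M p l *v poisson (rw_M p m *v 1))
     + \<mu> \<bullet> (rw_M p m *v poisson (rw_M p l *v 1))"
  by (simp add: rw_covariance_def vec_one Q_minus_one_inv_eq mean_zero
      linear_neg[OF matrix_vector_mul_linear])

lemma variance_form_eq_quad_form:
  defines "\<sigma> \<equiv> rw_covariance p \<mu>"
  shows "variance_form t = quad_form (\<sigma> $ 1 $ 1) (\<sigma> $ 1 $ 2) (\<sigma> $ 2 $ 2) t" and "\<sigma> $ 2 $ 1 = \<sigma> $ 1 $ 2"
proof -
  let ?m = "\<lambda>l m. \<mu> \<bullet> (rw_M p l *v poisson (rw_M p m *v 1))"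
  have c1: "corrector1 t = fst t *\<^sub>R poisson (rw_M p 1 *v 1) + snd t *\<^sub>R poisson (rw_M p 2 *v 1)"
    unfolding corrector1_def moment_op_1_vec
    by (simp add: linear_add[OF poisson_spec(1)] linear_scale[OF poisson_spec(1)])
  have "\<mu> \<bullet> (moment_op 1 t *v corrector1 t)
     = (fst t)\<^sup>2 * ?m 1 1 + fst t * snd t * (?m 1 2 + ?m 2 1) + (snd t)\<^sup>2 * ?m 2 2"
    unfolding c1 moment_op_1_vec
    by (simp add: matrix_vector_right_distrib matrix_vector_mult_scaleR inner_add_right algebra_simps power2_eq_square)
  moreover have "\<mu> \<bullet> (moment_op 2 t *v 1) = (fst t)\<^sup>2 * (\<mu> \<bullet> (rw_Sigma p 1 1 *v 1))
     + 2 * fst t * snd t * (\<mu> \<bullet> (rw_Sigma p 1 2 *v 1)) + (snd t)\<^sup>2 * (\<mu> \<bullet> (rw_Sigma p 2 2 *v 1))"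
    unfolding moment_op_2
    by (simp add: matrix_vector_mult_add_rdistrib scaleR_matrix_vector_assoc[symmetric] inner_add_right)
  ultimately show "variance_form t = quad_form (\<sigma> $ 1 $ 1) (\<sigma> $ 1 $ 2) (\<sigma> $ 2 $ 2) t"
    unfolding variance_form_def quad_form_def \<sigma>_def rw_covariance_entry by (simp add: algebra_simps)
  have "rw_Sigma p 2 1 = rw_Sigma p 1 2" by (simp add: rw_Sigma_eq mult.commute)
  then show "\<sigma> $ 2 $ 1 = \<sigma> $ 1 $ 2" by (simp add: \<sigma>_def rw_covariance_entry)
qed

definition eigenvec :: "real \<times> real \<Rightarrow> 's \<Rightarrow> complex" where
  "eigenvec t = (\<lambda>j. ((cvec 1 j + \<i> * cvec (corrector1 t) j) + cvec (corrector2 t) j) + \<i> * cvec (corrector3 t) j)"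

definition eigenval :: "real \<times> real \<Rightarrow> complex" where
  "eigenval t = 1 - of_real (variance_form t / 2) + \<i> * of_real (skewness_form t)"

text \<open>
  The terms that are left over in the eigenvalue equation are products of total degree between four and
  six; on the torus, \<open>T\<^sup>2 \<le> 64\<close> reduces them to degree four.
\<close>

lemma hpoly_product_bound:
  assumes "\<bar>a\<bar> \<le> A * T ^ i" "\<bar>b\<bar> \<le> B * T ^ k" "A \<ge> 0" "B \<ge> 0" "0 \<le> T" "T \<le> (8::real)" "i + k \<ge> 4" "i + k \<le> 6"
  shows "\<bar>a * b\<bar> \<le> 64 * A * B * T ^ 4"
proof -
  obtain r where r: "i + k = 4 + r" "r \<le> 2" using assms(7,8) by (intro that[of "i + k - 4"]) auto
  have "\<bar>a * b\<bar> \<le> (A * T ^ i) * (B * T ^ k)"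
    unfolding abs_mult using assms by (intro mult_mono) auto
  also have "\<dots> = A * B * T ^ (4 + r)" by (simp add: r(1)[symmetric] power_add)
  also have "\<dots> \<le> A * B * (T ^ 4 * 64)"
  proof (intro mult_left_mono)
    have "T ^ r \<le> 8 ^ r" using assms by (intro power_mono) auto
    also have "\<dots> \<le> 8 ^ 2" using r(2) by (intro power_increasing) auto
    finally show "T ^ (4 + r) \<le> T ^ 4 * 64"
      using assms unfolding power_add by (intro mult_left_mono) auto
  qed (use assms in auto)
  finally show ?thesis by (simp add: mult_ac)
qed

text \<open>
  The component \<open>f\<^sub>i\<close> is already of size \<open>|t|\<^sup>i\<close>, so \<open>T\<^sub>t\<close> only has to be expanded to order \<open>3 - i\<close> on
  it. The terms of order at most three cancel by the Poisson equations.
\<close>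

lemma eigenvec_residual:
  "\<exists>C\<ge>0. \<forall>t\<in>torus_box. \<forall>j. norm (char_op p t (eigenvec t) j - eigenval t * eigenvec t j) \<le> C * norm t ^ 4"
proof -
  obtain C where C: "C \<ge> 0" and taylor: "\<And>m t f j. m \<le> 3 \<Longrightarrow>
     norm (char_op p t (cvec f) j - (\<Sum>r\<le>m. \<i> ^ r / fact r * of_real ((moment_op r t *v f) $ j)))
     \<le> C * norm t ^ Suc m * norm f"
    using char_op_taylor by blast
  obtain A1 where A1: "A1 \<ge> 0" "\<And>t. norm (corrector1 t) \<le> A1 * norm t ^ 1"
    using hpoly_bound[OF hpoly_corrector1] by blast
  obtain A2 where A2: "A2 \<ge> 0" "\<And>t. norm (corrector2 t) \<le> A2 * norm t ^ 2"
    using hpoly_bound[OF hpoly_corrector2] by blast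
  obtain A3 where A3: "A3 \<ge> 0" "\<And>t. norm (corrector3 t) \<le> A3 * norm t ^ 3"
    using hpoly_bound[OF hpoly_corrector3] by blast
  obtain V where V: "V \<ge> 0" "\<And>t. \<bar>variance_form t\<bar> \<le> V * norm t ^ 2"
    using hpoly_bound[OF hpoly_variance_form] by auto
  obtain K where K: "K \<ge> 0" "\<And>t. \<bar>skewness_form t\<bar> \<le> K * norm t ^ 3"
    using hpoly_bound[OF hpoly_skewness_form] by auto
  define D where "D = C * norm (1 :: real ^ 's) + C * A1 + C * A2 + C * A3
     + (64 * V * A2 + 64 * V * A3 + 64 * K * A1 + 64 * K * A2 + 64 * K * A3)"
  show ?thesis
  proof (intro exI[of _ D] conjI ballI allI)
    show "D \<ge> 0" unfolding D_def using C A1(1) A2(1) A3(1) V(1) K(1) by (intro add_nonneg_nonneg mult_nonneg_nonneg) auto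
    fix t j assume t: "t \<in> torus_box"
    define T where "T = norm t"
    have T: "0 \<le> T" "T \<le> 8" using norm_torus_le[OF t] by (auto simp: T_def)
    define f1 f2 f3 where "f1 = corrector1 t $ j" and "f2 = corrector2 t $ j" and "f3 = corrector3 t $ j"
    define v where "v = variance_form t"
    define k where "k = skewness_form t"
    define m1 s1 k1 where "m1 = (moment_op 1 t *v 1) $ j" and "s1 = (moment_op 2 t *v 1) $ j" and "k1 = (moment_op 3 t *v 1) $ j"
    define mf1 sf1 mf2 where "mf1 = (moment_op 1 t *v corrector1 t) $ j" and "sf1 = (moment_op 2 t *v corrector1 t) $ j"
      and "mf2 = (moment_op 1 t *v corrector2 t) $ j"
    define e0 where "e0 = char_op p t (cvec 1) j - (1 + \<i> * m1 - s1 / 2 - \<i> * k1 / 6)"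
    define e1 where "e1 = char_op p t (cvec (corrector1 t)) j - (of_real (f1 - m1) + \<i> * mf1 - sf1 / 2)"
    define e2 where "e2 = char_op p t (cvec (corrector2 t)) j - (of_real (f2 - (v / 2 - mf1 - s1 / 2)) + \<i> * mf2)"
    define e3 where "e3 = char_op p t (cvec (corrector3 t)) j - of_real (f3 - (mf2 - sf1 / 2 - k1 / 6 + v / 2 * f1 - k))"
    have q1: "(Q *v corrector1 t) $ j = f1 - m1"
      by (simp add: Q_corrector1 f1_def m1_def)
    have q2: "(Q *v corrector2 t) $ j = f2 - (v / 2 - mf1 - s1 / 2)"
      by (simp add: Q_corrector2 f2_def v_def mf1_def s1_def)
    have q3: "(Q *v corrector3 t) $ j = f3 - (mf2 - sf1 / 2 - k1 / 6 + v / 2 * f1 - k)"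
      by (simp add: Q_corrector3 third_order_def f3_def f1_def v_def mf2_def sf1_def k1_def k_def)
    have i3: "\<i> ^ 3 = - \<i>" by (simp add: power3_eq_cube)
    have n0: "norm e0 \<le> C * norm (1 :: real ^ 's) * T ^ 4"
      using taylor[of 3 t 1 j]
      by (simp add: e0_def sum.atMost_Suc numeral_3_eq_3 moment_op_0 Q_one m1_def s1_def k1_def T_def mult_ac eval_nat_numeral)
    have n1: "norm e1 \<le> C * A1 * T ^ 4"
    proof -
      have "norm e1 \<le> C * T ^ 3 * norm (corrector1 t)"
        using taylor[of 2 t "corrector1 t" j]
        by (simp add: e1_def numeral_2_eq_2 moment_op_0 q1 mf1_def sf1_def T_def eval_nat_numeral mult_ac)
      also have "\<dots> \<le> C * T ^ 3 * (A1 * T ^ 1)"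
        unfolding T_def using C by (intro mult_left_mono A1(2)) auto
      also have "\<dots> = C * A1 * T ^ 4" by (simp add: eval_nat_numeral)
      finally show ?thesis .
    qed
    have n2: "norm e2 \<le> C * A2 * T ^ 4"
    proof -
      have "norm e2 \<le> C * T ^ 2 * norm (corrector2 t)"
        using taylor[of 1 t "corrector2 t" j]
        by (simp add: e2_def moment_op_0 q2 mf2_def T_def eval_nat_numeral mult_ac)
      also have "\<dots> \<le> C * T ^ 2 * (A2 * T ^ 2)"
        unfolding T_def using C by (intro mult_left_mono A2(2)) auto
      also have "\<dots> = C * A2 * T ^ 4" by (simp add: eval_nat_numeral)
      finally show ?thesis .
    qed
    have n3: "norm e3 \<le> C * A3 * T ^ 4"
    proof -
      have "norm e3 \<le> C * T * norm (corrector3 t)"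
        using taylor[of 0 t "corrector3 t" j]
        by (simp add: e3_def moment_op_0 q3 T_def)
      also have "\<dots> \<le> C * T * (A3 * T ^ 3)"
        unfolding T_def using C by (intro mult_left_mono A3(2)) auto
      also have "\<dots> = C * A3 * T ^ 4" by (simp add: eval_nat_numeral)
      finally show ?thesis .
    qed
    have "\<bar>f1\<bar> \<le> A1 * T ^ 1" "\<bar>f2\<bar> \<le> A2 * T ^ 2" "\<bar>f3\<bar> \<le> A3 * T ^ 3"
      using component_le_norm_cart order.trans A1(2)[of t] A2(2)[of t] A3(2)[of t]
      unfolding f1_def f2_def f3_def T_def by blast+
    moreover have "\<bar>v\<bar> \<le> V * T ^ 2" "\<bar>k\<bar> \<le> K * T ^ 3"
      using V(2)[of t] K(2)[of t] by (simp_all add: v_def k_def T_def)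
    ultimately have p: "\<bar>v * f2\<bar> \<le> 64 * V * A2 * T ^ 4" "\<bar>v * f3\<bar> \<le> 64 * V * A3 * T ^ 4"
      "\<bar>k * f1\<bar> \<le> 64 * K * A1 * T ^ 4" "\<bar>k * f2\<bar> \<le> 64 * K * A2 * T ^ 4" "\<bar>k * f3\<bar> \<le> 64 * K * A3 * T ^ 4"
      using T A1(1) A2(1) A3(1) V(1) K(1) by (auto intro!: hpoly_product_bound)
    have ev: "eigenvec t j = 1 + \<i> * f1 + f2 + \<i> * f3"
      by (simp add: eigenvec_def cvec_def f1_def f2_def f3_def)
    have "char_op p t (eigenvec t) j - eigenval t * eigenvec t j
      = ((e0 + \<i> * e1) + e2) + \<i> * e3
        + (of_real (v * f2) / 2 + \<i> * of_real (v * f3) / 2 + of_real (k * f1) - \<i> * of_real (k * f2) + of_real (k * f3))"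
    proof -
      have T: "char_op p t (eigenvec t) j = char_op p t (cvec 1) j + \<i> * char_op p t (cvec (corrector1 t)) j
         + char_op p t (cvec (corrector2 t)) j + \<i> * char_op p t (cvec (corrector3 t)) j"
        unfolding eigenvec_def by (simp only: char_op_add char_op_mult)
      show ?thesis
        unfolding T ev eigenval_def v_def[symmetric] k_def[symmetric] e0_def e1_def e2_def e3_def
        by (simp add: complex_eq_iff) (simp add: algebra_simps)
    qed
    also have "norm \<dots> \<le> (((norm e0 + norm e1) + norm e2) + norm e3)
        + (\<bar>v * f2\<bar> + \<bar>v * f3\<bar> + \<bar>k * f1\<bar> + \<bar>k * f2\<bar> + \<bar>k * f3\<bar>)"
    proof (intro norm_triangle_le add_mono norm_triangle_le_diff)
    qed (auto simp: norm_mult norm_divide abs_mult)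
    also have "\<dots> \<le> D * T ^ 4"
      unfolding D_def distrib_right using n0 n1 n2 n3 p by linarith
    finally show "norm (char_op p t (eigenvec t) j - eigenval t * eigenvec t j) \<le> D * norm t ^ 4"
      by (simp add: T_def)
  qed
qed

end

section \<open>Propagation of the approximations\<close>

text \<open>
  The constants of the decay bounds, adapted to each other: the oscillatory rate \<open>exp (-c |t|\<^sup>2)\<close>
  dominates the Gaussian factor \<open>exp (-\<sigma>(t)/2)\<close> and, on the torus and with a margin from \<open>r\<close> to
  \<open>\<rho>\<close>, the rate of convergence to equilibrium. The margin makes convolutions of the two rates
  comparable with the slower one.
\<close>

locale walk_decay = internal_walk p \<mu> for p :: "(2, 's::finite) rw_steps" and \<mu> +
  fixes c \<rho> r C :: real
  assumes constants: "0 < c" "0 < \<rho>" "\<rho> < r" "r \<le> 1" "1 \<le> C"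
    and decay: "\<And>t v B n j. t \<in> torus_box \<Longrightarrow> (\<And>k. norm (v k) \<le> B) \<Longrightarrow>
      norm ((char_op p t ^^ n) v j) \<le> C * exp (- c * (norm t)\<^sup>2) ^ n * B"
    and rate_ge: "\<And>t. t \<in> torus_box \<Longrightarrow> r \<le> exp (- c * (norm t)\<^sup>2)"
    and variance_rate: "\<And>t. exp (- variance_form t / 2) \<le> exp (- c * (norm t)\<^sup>2)"
    and ergodic: "\<And>h n. \<mu> \<bullet> h = 0 \<Longrightarrow> norm (mat_power Q n *v h) \<le> C * \<rho> ^ n * norm h"
begin

definition rate :: "real \<times> real \<Rightarrow> real" where
  "rate t = exp (- c * (norm t)\<^sup>2)"

lemma rate_pos: "rate t > 0" and rate_le_1: "rate t \<le> 1"
  using constants by (auto simp: rate_def)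

lemma rate_ge_r: "t \<in> torus_box \<Longrightarrow> r \<le> rate t"
  using rate_ge by (simp add: rate_def)

lemma rate_pred_power:
  assumes "t \<in> torus_box" "m < n"
  shows "rate t ^ (n - 1 - m) * rate t ^ m \<le> rate t ^ n / r"
proof -
  have "rate t ^ (n - 1 - m) * rate t ^ m = rate t ^ (n - 1)"
    using assms(2) by (simp add: power_add[symmetric])
  moreover have "rate t ^ (n - 1) * r \<le> rate t ^ (n - 1) * rate t"
    using rate_ge_r[OF assms(1)] rate_pos[of t] by (intro mult_left_mono) auto
  moreover have "rate t ^ (n - 1) * rate t = rate t ^ n"
    using assms(2) by (cases n) auto
  ultimately show ?thesis using constants by (simp add: pos_le_divide_eq)
qed

lemma sum_rate_poly:
  assumes "t \<in> torus_box" "a \<ge> 0" "b \<ge> 0"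
  shows "(\<Sum>m<n. rate t ^ (n - 1 - m) * (rate t ^ m * (a + b * real m))) \<le> (real n * a + (real n)\<^sup>2 * b) / r * rate t ^ n"
proof -
  have "(\<Sum>m<n. rate t ^ (n - 1 - m) * (rate t ^ m * (a + b * real m))) \<le> (\<Sum>m<n. rate t ^ n / r * (a + b * real n))"
  proof (rule sum_mono)
    fix m assume "m \<in> {..<n}"
    then have m: "m < n" by simp
    have "(rate t ^ (n - 1 - m) * rate t ^ m) * (a + b * real m) \<le> rate t ^ n / r * (a + b * real n)"
      using assms m rate_pos[of t] constants
      by (intro mult_mono rate_pred_power[OF assms(1) m] add_mono mult_left_mono) auto
    then show "rate t ^ (n - 1 - m) * (rate t ^ m * (a + b * real m)) \<le> rate t ^ n / r * (a + b * real n)"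
      by (simp only: mult.assoc)
  qed
  also have "\<dots> = (real n * a + (real n)\<^sup>2 * b) / r * rate t ^ n"
    by (simp add: power2_eq_square algebra_simps)
  finally show ?thesis .
qed

lemma sum_rate_geometric:
  assumes t: "t \<in> torus_box"
  shows "(\<Sum>m<n. rate t ^ (n - 1 - m) * \<rho> ^ m) \<le> rate t ^ n / (r - \<rho>)"
proof -
  have strong: "(\<Sum>m<n. rate t ^ (n - 1 - m) * \<rho> ^ m) * (rate t - \<rho>) = rate t ^ n - \<rho> ^ n" for n
  proof (induction n)
    case (Suc n)
    have "(\<Sum>m<Suc n. rate t ^ (Suc n - 1 - m) * \<rho> ^ m) = rate t * (\<Sum>m<n. rate t ^ (n - 1 - m) * \<rho> ^ m) + \<rho> ^ n"
    proof -
      have "(\<Sum>m<n. rate t ^ (n - m) * \<rho> ^ m) = (\<Sum>m<n. rate t * (rate t ^ (n - 1 - m) * \<rho> ^ m))"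
      proof (rule sum.cong[OF refl])
        fix m assume "m \<in> {..<n}"
        then have "n - m = Suc (n - 1 - m)" by auto
        then show "rate t ^ (n - m) * \<rho> ^ m = rate t * (rate t ^ (n - 1 - m) * \<rho> ^ m)" by simp
      qed
      then show ?thesis by (simp add: sum_distrib_left)
    qed
    then have "(\<Sum>m<Suc n. rate t ^ (Suc n - 1 - m) * \<rho> ^ m) * (rate t - \<rho>)
      = rate t * ((\<Sum>m<n. rate t ^ (n - 1 - m) * \<rho> ^ m) * (rate t - \<rho>)) + \<rho> ^ n * (rate t - \<rho>)"
      by (simp only: distrib_right mult.assoc)
    also have "\<dots> = rate t ^ Suc n - \<rho> ^ Suc n"
      unfolding Suc by (simp add: algebra_simps)
    finally show ?case .
  qed simp
  have d: "0 < r - \<rho>" "r - \<rho> \<le> rate t - \<rho>" using constants rate_ge_r[OF t] by auto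
  have "(\<Sum>m<n. rate t ^ (n - 1 - m) * \<rho> ^ m) = (rate t ^ n - \<rho> ^ n) / (rate t - \<rho>)"
    using strong[of n] d by (simp add: eq_divide_eq)
  also have "\<dots> \<le> rate t ^ n / (rate t - \<rho>)"
    using d constants by (intro divide_right_mono) auto
  also have "\<dots> \<le> rate t ^ n / (r - \<rho>)"
    using d rate_pos[of t] by (intro divide_left_mono) auto
  finally show ?thesis .
qed

lemma char_op_sum: "finite A \<Longrightarrow> char_op p t (\<lambda>k. \<Sum>m\<in>A. v m k) j = (\<Sum>m\<in>A. char_op p t (v m) j)"
proof (induction A rule: finite_induct)
  case empty
  show ?case using char_op_mult[of p t 0 "\<lambda>_. 0" j] by simp
qed (simp add: char_op_add)

text \<open>
  If \<open>w\<close> solves the recursion \<open>w (n + 1) = T\<^sub>t (w n)\<close> up to errors \<open>e m\<close>, it differs from the exact solution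
  by the errors, each propagated over the remaining time.
\<close>

lemma duhamel:
  fixes w :: "nat \<Rightarrow> 's \<Rightarrow> complex" and t :: "real \<times> real"
  defines "e \<equiv> \<lambda>m k. char_op p t (w m) k - w (Suc m) k"
  shows "(char_op p t ^^ n) (w 0) j = w n j + (\<Sum>m<n. (char_op p t ^^ (n - 1 - m)) (e m) j)"
proof (induction n arbitrary: j)
  case (Suc n)
  have "(char_op p t ^^ n) (w 0) = (\<lambda>k. w n k + (\<Sum>m<n. (char_op p t ^^ (n - 1 - m)) (e m) k))"
    by (rule ext) (rule Suc)
  then have "(char_op p t ^^ Suc n) (w 0) j = char_op p t (\<lambda>k. w n k + (\<Sum>m<n. (char_op p t ^^ (n - 1 - m)) (e m) k)) j"
    by (simp only: funpow.simps comp_apply)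
  also have "\<dots> = char_op p t (w n) j + (\<Sum>m<n. char_op p t ((char_op p t ^^ (n - 1 - m)) (e m)) j)"
    by (simp only: char_op_add char_op_sum[OF finite_lessThan])
  also have "(\<Sum>m<n. char_op p t ((char_op p t ^^ (n - 1 - m)) (e m)) j) = (\<Sum>m<n. (char_op p t ^^ (n - m)) (e m) j)"
  proof (rule sum.cong[OF refl])
    fix m assume "m \<in> {..<n}"
    then have "n - m = Suc (n - 1 - m)" by auto
    then show "char_op p t ((char_op p t ^^ (n - 1 - m)) (e m)) j = (char_op p t ^^ (n - m)) (e m) j" by simp
  qed
  also have "char_op p t (w n) j = w (Suc n) j + e n j" by (simp add: e_def)
  finally show ?case by simp
qed simp

lemma cvec_norm_le: "norm (cvec h k) \<le> norm h"
  using component_le_norm_cart[of h k] by (simp add: cvec_def)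

text \<open>
  Duhamel's formula with \<open>w m = Q\<^sup>m h\<close>, for which each step has an error \<open>(T\<^sub>t - Q) Q\<^sup>m h = O(|t| \<rho>\<^sup>m)\<close>.
\<close>

lemma mean_zero_relaxation:
  "\<exists>D\<ge>0. \<forall>t\<in>torus_box. \<forall>h n j. \<mu> \<bullet> h = 0 \<longrightarrow>
     norm ((char_op p t ^^ n) (cvec h) j) \<le> D * norm h * (norm t * rate t ^ n + \<rho> ^ n)"
proof -
  obtain K where K: "K \<ge> 0" and taylor: "\<And>m t f j. m \<le> 3 \<Longrightarrow>
     norm (char_op p t (cvec f) j - (\<Sum>r\<le>m. \<i> ^ r / fact r * of_real ((moment_op r t *v f) $ j)))
     \<le> K * norm t ^ Suc m * norm f"
    using char_op_taylor by blast
  define D where "D = C + C * K * C / (r - \<rho>)"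
  have C0: "C \<ge> 0" "r - \<rho> > 0" using constants by auto
  show ?thesis
  proof (intro exI[of _ D] conjI ballI allI impI)
    show "D \<ge> 0" using C0 K by (simp add: D_def)
    fix t and h :: "real ^ 's" and n j assume t: "t \<in> torus_box" and h: "\<mu> \<bullet> h = 0"
    let ?w = "\<lambda>m. cvec (mat_power Q m *v h)"
    have e: "norm (char_op p t (?w m) k - ?w (Suc m) k) \<le> K * norm t * (C * \<rho> ^ m * norm h)" for m k
    proof -
      have "norm (char_op p t (?w m) k - ?w (Suc m) k) \<le> K * norm t * norm (mat_power Q m *v h)"
        using taylor[of 0 t "mat_power Q m *v h" k]
        by (simp add: moment_op_0 cvec_def mat_power_Suc_left matrix_vector_mul_assoc del: mat_power.simps)
      also have "\<dots> \<le> K * norm t * (C * \<rho> ^ m * norm h)"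
        using K by (intro mult_left_mono ergodic h) auto
      finally show ?thesis .
    qed
    have "norm ((char_op p t ^^ n) (?w 0) j)
       \<le> norm (?w n j) + (\<Sum>m<n. norm ((char_op p t ^^ (n - 1 - m)) (\<lambda>k. char_op p t (?w m) k - ?w (Suc m) k) j))"
      unfolding duhamel[where t=t and n=n and w="?w" and j=j]
      by (intro order.trans[OF norm_triangle_ineq] add_left_mono norm_sum)
    also have "norm (?w n j) \<le> C * \<rho> ^ n * norm h"
      by (rule order.trans[OF cvec_norm_le ergodic[OF h]])
    also have "(\<Sum>m<n. norm ((char_op p t ^^ (n - 1 - m)) (\<lambda>k. char_op p t (?w m) k - ?w (Suc m) k) j))
       \<le> (\<Sum>m<n. C * rate t ^ (n - 1 - m) * (K * norm t * (C * \<rho> ^ m * norm h)))"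
      unfolding rate_def by (intro sum_mono decay t e)
    also have "\<dots> = C * K * C * norm t * norm h * (\<Sum>m<n. rate t ^ (n - 1 - m) * \<rho> ^ m)"
      unfolding sum_distrib_left by (intro sum.cong refl) (simp only: mult_ac)
    also have "\<dots> \<le> C * K * C * norm t * norm h * (rate t ^ n / (r - \<rho>))"
      using C0 K by (intro mult_left_mono sum_rate_geometric t mult_nonneg_nonneg) auto
    finally have "norm ((char_op p t ^^ n) (?w 0) j) \<le> C * \<rho> ^ n * norm h + C * K * C * norm t * norm h * (rate t ^ n / (r - \<rho>))"
      by simp
    also have "\<dots> = C * (norm h * \<rho> ^ n) + C * K * C / (r - \<rho>) * (norm h * (norm t * rate t ^ n))"
      by simp
    also have "\<dots> \<le> D * (norm h * \<rho> ^ n) + D * (norm h * (norm t * rate t ^ n))"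
      using C0 K constants rate_pos[of t] unfolding D_def
      by (intro add_mono mult_right_mono mult_nonneg_nonneg) auto
    finally show "norm ((char_op p t ^^ n) (cvec h) j) \<le> D * norm h * (norm t * rate t ^ n + \<rho> ^ n)"
      by (simp add: distrib_left add.commute mult.assoc)
  qed
qed

lemma moment_op_1_bound: "\<exists>B\<ge>0. \<forall>t f. norm (moment_op 1 t *v f) \<le> B * norm t * norm f"
proof -
  obtain B1 where B1: "\<And>f. norm (rw_M p 1 *v f) \<le> norm f * B1" "B1 > 0"
    using bounded_linear.pos_bounded[OF matrix_vector_mul_bounded_linear] by blast
  obtain B2 where B2: "\<And>f. norm (rw_M p 2 *v f) \<le> norm f * B2" "B2 > 0"
    using bounded_linear.pos_bounded[OF matrix_vector_mul_bounded_linear] by blast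
  show ?thesis
  proof (intro exI[of _ "B1 + B2"] conjI allI)
    fix t f
    have "norm (moment_op 1 t *v f) \<le> \<bar>fst t\<bar> * norm (rw_M p 1 *v f) + \<bar>snd t\<bar> * norm (rw_M p 2 *v f)"
      unfolding moment_op_1_vec by (rule norm_triangle_le) simp
    also have "\<dots> \<le> norm t * (norm f * B1) + norm t * (norm f * B2)"
      using norm_fst_le[of "fst t" "snd t"] norm_snd_le[of "snd t" "fst t"]
      by (intro add_mono mult_mono B1 B2) auto
    finally show "norm (moment_op 1 t *v f) \<le> (B1 + B2) * norm t * norm f" by (simp add: algebra_simps)
  qed (use B1 B2 in auto)
qed

text \<open>
  The value \<open>\<Sum>\<^sub>m \<langle>\<mu>, M(t) Q\<^sup>m h\<rangle>\<close>: the amount, to first order in \<open>t\<close>, of the constant function that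
  the evolution of a centred \<open>h\<close> produces in total.
\<close>

definition drift_functional :: "real \<times> real \<Rightarrow> real ^ 's \<Rightarrow> real" where
  "drift_functional t h = \<mu> \<bullet> (moment_op 1 t *v poisson h)"

lemma drift_functional_diff:
  assumes "\<mu> \<bullet> h = 0"
  shows "drift_functional t h - drift_functional t (Q *v h) = \<mu> \<bullet> (moment_op 1 t *v h)"
proof -
  have "poisson h - poisson (Q *v h) = h"
    using poisson_left[OF assms] by (simp add: linear_diff[OF poisson_spec(1)])
  then show ?thesis
    unfolding drift_functional_def inner_diff_right[symmetric]
    by (simp add: matrix_vector_mult_diff_distrib[symmetric])
qed

lemma drift_functional_bound:
  "\<exists>B\<ge>0. \<forall>t h. \<bar>drift_functional t h\<bar> \<le> B * norm t * norm h"
proof -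
  obtain B where B: "B \<ge> 0" "\<And>t f. norm (moment_op 1 t *v f) \<le> B * norm t * norm f"
    using moment_op_1_bound by blast
  obtain P where P: "\<And>h. norm (poisson h) \<le> P * norm h" "P > 0"
    using linear_bounded_pos[OF poisson_spec(1)] by blast
  show ?thesis
  proof (intro exI[of _ "norm \<mu> * B * P"] conjI allI)
    fix t h
    have "\<bar>drift_functional t h\<bar> \<le> norm \<mu> * norm (moment_op 1 t *v poisson h)"
      unfolding drift_functional_def by (rule Cauchy_Schwarz_ineq2)
    also have "\<dots> \<le> norm \<mu> * (B * norm t * (P * norm h))"
      by (intro mult_left_mono order.trans[OF B(2)] P) (auto simp: B(1))
    finally show "\<bar>drift_functional t h\<bar> \<le> norm \<mu> * B * P * norm t * norm h" by (simp add: mult_ac)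
  qed (use B P in auto)
qed

text \<open>
  The term of order \<open>|t|\<close> in \<open>mean_zero_relaxation\<close> comes from the constant functions that
  \<open>(T\<^sub>t - Q) Q\<^sup>m h\<close> contains. With \<open>d m = drift_functional t (Q\<^sup>m h)\<close> they are removed by the choice
  \<open>w m = Q\<^sup>m h - i d m\<close>, because \<open>d m - d (m + 1) = \<langle>\<mu>, M(t) Q\<^sup>m h\<rangle>\<close>. The first-order error that is left
  is centred, so \<open>mean_zero_relaxation\<close> applies to it and gains another factor \<open>|t|\<close>.
\<close>

lemma mean_zero_relaxation_corrected:
  "\<exists>D\<ge>0. \<forall>t\<in>torus_box. \<forall>h n j. \<mu> \<bullet> h = 0 \<longrightarrow>
     norm ((char_op p t ^^ n) (\<lambda>k. cvec h k - \<i> * of_real (drift_functional t h)) j)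
       \<le> D * norm h * ((norm t)\<^sup>2 * rate t ^ n + (real n + 1) * \<rho> ^ n)"
proof -
  obtain K where K: "K \<ge> 0" and taylor: "\<And>m t f j. m \<le> 3 \<Longrightarrow>
     norm (char_op p t (cvec f) j - (\<Sum>r\<le>m. \<i> ^ r / fact r * of_real ((moment_op r t *v f) $ j)))
     \<le> K * norm t ^ Suc m * norm f"
    using char_op_taylor by blast
  obtain D1 where D1: "D1 \<ge> 0" and relax: "\<And>t h n j. t \<in> torus_box \<Longrightarrow> \<mu> \<bullet> h = 0 \<Longrightarrow>
     norm ((char_op p t ^^ n) (cvec h) j) \<le> D1 * norm h * (norm t * rate t ^ n + \<rho> ^ n)"
    using mean_zero_relaxation by blast
  obtain B where B: "B \<ge> 0" "\<And>t f. norm (moment_op 1 t *v f) \<le> B * norm t * norm f"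
    using moment_op_1_bound by blast
  obtain A where A: "A \<ge> 0" "\<And>t h. \<bar>drift_functional t h\<bar> \<le> A * norm t * norm h"
    using drift_functional_bound by blast
  define N1 where "N1 = norm (1 :: real ^ 's)"
  define G where "G = (K + A * K * N1) * C"
  define H where "H = (1 + norm \<mu> * N1) * B * C"
  define D where "D = (C + 8 * A * C) + (C * G / (r - \<rho>) + D1 * H / (r - \<rho>)) + 8 * D1 * H / \<rho>"
  have pos: "C \<ge> 0" "r - \<rho> > 0" "\<rho> > 0" "N1 \<ge> 0" using constants by (auto simp: N1_def)
  have GH: "G \<ge> 0" "H \<ge> 0" using pos K A B by (auto simp: G_def H_def)
  show ?thesis
  proof (intro exI[of _ D] conjI ballI allI impI)
    show "D \<ge> 0" using pos GH D1 A by (simp add: D_def)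
    fix t and h :: "real ^ 's" and n j assume t: "t \<in> torus_box" and h: "\<mu> \<bullet> h = 0"
    define T where "T = norm t"
    have T: "0 \<le> T" "T \<le> 8" using norm_torus_le[OF t] by (auto simp: T_def)
    define hm where "hm = (\<lambda>m. mat_power Q m *v h)"
    have hm0: "\<mu> \<bullet> hm m = 0" for m by (simp add: hm_def stationary_inner_mat_power[OF stationary] h)
    have hm_Suc: "hm (Suc m) = Q *v hm m" for m
      by (simp add: hm_def mat_power_Suc_left matrix_vector_mul_assoc del: mat_power.simps)
    have hm_norm: "norm (hm m) \<le> C * \<rho> ^ m * norm h" for m unfolding hm_def by (rule ergodic[OF h])
    define d where "d = (\<lambda>m. drift_functional t (hm m))"
    define w where "w = (\<lambda>m k. cvec (hm m) k - \<i> * of_real (d m))"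
    define g where "g = (\<lambda>m k. (char_op p t (cvec (hm m)) k - (cvec (hm (Suc m)) k + \<i> * cvec (moment_op 1 t *v hm m) k))
        + (- \<i> * of_real (d m)) * (char_op p t (cvec 1) k - 1))"
    define h' where "h' = (\<lambda>m. moment_op 1 t *v hm m - (\<mu> \<bullet> (moment_op 1 t *v hm m)) *\<^sub>R 1)"
    have h'0: "\<mu> \<bullet> h' m = 0" for m by (simp add: h'_def inner_diff_right inner_one)
    have e: "char_op p t (w m) k - w (Suc m) k = g m k + \<i> * cvec (h' m) k" for m k
    proof -
      have dd: "d m - d (Suc m) = \<mu> \<bullet> (moment_op 1 t *v hm m)"
        unfolding d_def hm_Suc by (rule drift_functional_diff[OF hm0])
      have "w m = (\<lambda>k. cvec (hm m) k + (- \<i> * of_real (d m)) * cvec 1 k)" by (simp add: w_def cvec_def)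
      then have "char_op p t (w m) k = char_op p t (cvec (hm m)) k + (- \<i> * of_real (d m)) * char_op p t (cvec 1) k"
        by (simp only: char_op_add char_op_mult)
      then show ?thesis
        unfolding w_def[of ] g_def h'_def dd[symmetric] by (simp add: cvec_def algebra_simps)
    qed
    have d_bound: "\<bar>d m\<bar> \<le> A * T * (C * \<rho> ^ m * norm h)" for m
      unfolding d_def T_def
      by (rule order.trans[OF A(2)]) (intro mult_left_mono hm_norm mult_nonneg_nonneg A(1) norm_ge_zero)
    have g_bound: "norm (g m k) \<le> G * norm h * T\<^sup>2 * \<rho> ^ m" for m k
    proof -
      have "norm (char_op p t (cvec (hm m)) k - (cvec (hm (Suc m)) k + \<i> * cvec (moment_op 1 t *v hm m) k))
         \<le> K * T\<^sup>2 * norm (hm m)"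
        using taylor[of 1 t "hm m" k] by (simp add: moment_op_0 hm_Suc cvec_def T_def power2_eq_square)
      also have "\<dots> \<le> K * T\<^sup>2 * (C * \<rho> ^ m * norm h)"
        using K by (intro mult_left_mono hm_norm) auto
      finally have 1: "norm (char_op p t (cvec (hm m)) k - (cvec (hm (Suc m)) k + \<i> * cvec (moment_op 1 t *v hm m) k))
         \<le> K * T\<^sup>2 * (C * \<rho> ^ m * norm h)" .
      have one: "norm (char_op p t (cvec 1) k - 1) \<le> K * T * N1"
        using taylor[of 0 t 1 k] by (simp add: moment_op_0 Q_one T_def N1_def)
      have nd: "norm (- \<i> * of_real (d m)) \<le> A * T * (C * \<rho> ^ m * norm h)"
        using d_bound[of m] by (simp add: norm_mult)
      have 2: "norm ((- \<i> * of_real (d m)) * (char_op p t (cvec 1) k - 1)) \<le> (A * T * (C * \<rho> ^ m * norm h)) * (K * T * N1)"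
        unfolding norm_mult[of "- \<i> * of_real (d m)"]
        by (rule mult_mono[OF nd one order.trans[OF norm_ge_zero nd] norm_ge_zero])
      have "norm (g m k) \<le> K * T\<^sup>2 * (C * \<rho> ^ m * norm h) + (A * T * (C * \<rho> ^ m * norm h)) * (K * T * N1)"
        unfolding g_def by (rule norm_triangle_le[OF add_mono[OF 1 2]])
      also have "\<dots> = G * norm h * T\<^sup>2 * \<rho> ^ m"
        by (simp add: G_def power2_eq_square algebra_simps)
      finally show ?thesis .
    qed
    have h'_bound: "norm (h' m) \<le> H * norm h * T * \<rho> ^ m" for m
    proof -
      have "norm (h' m) \<le> norm (moment_op 1 t *v hm m) + \<bar>\<mu> \<bullet> (moment_op 1 t *v hm m)\<bar> * N1"
        unfolding h'_def N1_def by (rule norm_triangle_le_diff) simp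
      also have "\<dots> \<le> norm (moment_op 1 t *v hm m) + (norm \<mu> * norm (moment_op 1 t *v hm m)) * N1"
        by (intro add_left_mono mult_right_mono Cauchy_Schwarz_ineq2 pos)
      also have "\<dots> = (1 + norm \<mu> * N1) * norm (moment_op 1 t *v hm m)" by (simp add: algebra_simps)
      also have "\<dots> \<le> (1 + norm \<mu> * N1) * (B * T * (C * \<rho> ^ m * norm h))"
      proof (rule mult_left_mono)
        show "norm (moment_op 1 t *v hm m) \<le> B * T * (C * \<rho> ^ m * norm h)"
          unfolding T_def by (rule order.trans[OF B(2)]) (intro mult_left_mono hm_norm mult_nonneg_nonneg B(1) norm_ge_zero)
      qed (use pos in auto)
      finally show ?thesis by (simp add: H_def mult_ac)
    qed
    let ?S1 = "\<Sum>m<n. rate t ^ (n - 1 - m) * \<rho> ^ m"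
    have split: "(char_op p t ^^ k) (\<lambda>i. g m i + \<i> * cvec (h' m) i) j
        = (char_op p t ^^ k) (g m) j + \<i> * (char_op p t ^^ k) (cvec (h' m)) j" for k m
      by (simp only: char_op_pow_add char_op_pow_mult)
    have summand: "norm ((char_op p t ^^ (n - 1 - m)) (\<lambda>k. g m k + \<i> * cvec (h' m) k) j)
       \<le> (C * G + D1 * H) * norm h * T\<^sup>2 * (rate t ^ (n - 1 - m) * \<rho> ^ m) + D1 * H * norm h * T * \<rho> ^ (n - 1)"
      if m: "m < n" for m
    proof -
      have 1: "norm ((char_op p t ^^ (n - 1 - m)) (g m) j) \<le> C * rate t ^ (n - 1 - m) * (G * norm h * T\<^sup>2 * \<rho> ^ m)"
        unfolding rate_def by (intro decay t g_bound)
      have "norm ((char_op p t ^^ (n - 1 - m)) (cvec (h' m)) j)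
          \<le> D1 * norm (h' m) * (norm t * rate t ^ (n - 1 - m) + \<rho> ^ (n - 1 - m))"
        by (rule relax[OF t h'0])
      also have "\<dots> \<le> D1 * (H * norm h * T * \<rho> ^ m) * (norm t * rate t ^ (n - 1 - m) + \<rho> ^ (n - 1 - m))"
        using D1 pos rate_pos[of t] by (intro mult_right_mono mult_left_mono h'_bound) auto
      also have "\<dots> = D1 * H * norm h * T\<^sup>2 * (rate t ^ (n - 1 - m) * \<rho> ^ m) + D1 * H * norm h * T * (\<rho> ^ (n - 1 - m) * \<rho> ^ m)"
        by (simp add: T_def power2_eq_square algebra_simps)
      also have "\<rho> ^ (n - 1 - m) * \<rho> ^ m = \<rho> ^ (n - 1)" using m by (simp add: power_add[symmetric])
      finally have 2: "norm (\<i> * (char_op p t ^^ (n - 1 - m)) (cvec (h' m)) j)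
        \<le> D1 * H * norm h * T\<^sup>2 * (rate t ^ (n - 1 - m) * \<rho> ^ m) + D1 * H * norm h * T * \<rho> ^ (n - 1)"
        by (simp add: norm_mult)
      have "norm ((char_op p t ^^ (n - 1 - m)) (\<lambda>k. g m k + \<i> * cvec (h' m) k) j)
        \<le> C * rate t ^ (n - 1 - m) * (G * norm h * T\<^sup>2 * \<rho> ^ m)
          + (D1 * H * norm h * T\<^sup>2 * (rate t ^ (n - 1 - m) * \<rho> ^ m) + D1 * H * norm h * T * \<rho> ^ (n - 1))"
        unfolding split by (rule norm_triangle_le[OF add_mono[OF 1 2]])
      then show ?thesis by (simp add: algebra_simps)
    qed
    have "norm ((char_op p t ^^ n) (w 0) j)
       \<le> norm (w n j) + (\<Sum>m<n. norm ((char_op p t ^^ (n - 1 - m)) (\<lambda>k. g m k + \<i> * cvec (h' m) k) j))"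
      unfolding duhamel[where t=t and n=n and w=w and j=j] e
      by (intro order.trans[OF norm_triangle_ineq] add_left_mono norm_sum)
    also have "(\<Sum>m<n. norm ((char_op p t ^^ (n - 1 - m)) (\<lambda>k. g m k + \<i> * cvec (h' m) k) j))
       \<le> (\<Sum>m<n. (C * G + D1 * H) * norm h * T\<^sup>2 * (rate t ^ (n - 1 - m) * \<rho> ^ m) + D1 * H * norm h * T * \<rho> ^ (n - 1))"
      by (intro sum_mono summand) simp
    also have "\<dots> = (C * G + D1 * H) * norm h * T\<^sup>2 * ?S1 + D1 * H * norm h * T * (real n * \<rho> ^ (n - 1))"
      by (simp add: sum.distrib sum_distrib_left)
    also have "\<dots> \<le> (C * G + D1 * H) * norm h * T\<^sup>2 * (rate t ^ n / (r - \<rho>)) + D1 * H * norm h * 8 * ((real n + 1) * \<rho> ^ n / \<rho>)"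
    proof (intro add_mono mult_left_mono mult_mono sum_rate_geometric t)
      show "real n * \<rho> ^ (n - 1) \<le> (real n + 1) * \<rho> ^ n / \<rho>"
        using pos by (cases n) (auto simp: field_simps)
    qed (use pos GH D1 T in auto)
    also have "norm (w n j) \<le> (C + 8 * A * C) * norm h * ((real n + 1) * \<rho> ^ n)"
    proof -
      have "norm (w n j) \<le> norm (hm n) + \<bar>d n\<bar>"
        unfolding w_def by (rule norm_triangle_le_diff) (use cvec_norm_le[of "hm n" j] in \<open>simp add: norm_mult\<close>)
      also have "\<dots> \<le> C * \<rho> ^ n * norm h + A * 8 * (C * \<rho> ^ n * norm h)"
      proof (intro add_mono hm_norm order.trans[OF d_bound] mult_right_mono mult_left_mono)
      qed (use pos A(1) T in auto)
      also have "\<dots> = (C + 8 * A * C) * norm h * (1 * \<rho> ^ n)" by (simp add: algebra_simps)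
      also have "\<dots> \<le> (C + 8 * A * C) * norm h * ((real n + 1) * \<rho> ^ n)"
        using pos A(1) by (intro mult_left_mono mult_right_mono) auto
      finally show ?thesis .
    qed
    finally have "norm ((char_op p t ^^ n) (w 0) j)
       \<le> (C * G / (r - \<rho>) + D1 * H / (r - \<rho>)) * (norm h * (T\<^sup>2 * rate t ^ n))
         + ((C + 8 * A * C) + 8 * D1 * H / \<rho>) * (norm h * ((real n + 1) * \<rho> ^ n))"
      by (simp add: add_divide_distrib algebra_simps)
    also have "\<dots> \<le> D * (norm h * (T\<^sup>2 * rate t ^ n)) + D * (norm h * ((real n + 1) * \<rho> ^ n))"
    proof -
      have "0 \<le> C + 8 * A * C" "0 \<le> C * G / (r - \<rho>) + D1 * H / (r - \<rho>)" "0 \<le> 8 * D1 * H / \<rho>"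
        using pos GH D1 A(1) by simp_all
      then have "C * G / (r - \<rho>) + D1 * H / (r - \<rho>) \<le> D" "(C + 8 * A * C) + 8 * D1 * H / \<rho> \<le> D"
        unfolding D_def by linarith+
      moreover have "0 \<le> norm h * (T\<^sup>2 * rate t ^ n)" "0 \<le> norm h * ((real n + 1) * \<rho> ^ n)"
        using pos rate_pos[of t] by (simp_all add: less_imp_le)
      ultimately show ?thesis by (blast intro: add_mono mult_right_mono)
    qed
    finally have "norm ((char_op p t ^^ n) (w 0) j) \<le> D * norm h * (T\<^sup>2 * rate t ^ n + (real n + 1) * \<rho> ^ n)"
      by (simp add: distrib_left mult.assoc)
    moreover have "w 0 = (\<lambda>k. cvec h k - \<i> * of_real (drift_functional t h))"
      by (simp add: w_def d_def hm_def)
    ultimately show "norm ((char_op p t ^^ n) (\<lambda>k. cvec h k - \<i> * of_real (drift_functional t h)) j)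
       \<le> D * norm h * ((norm t)\<^sup>2 * rate t ^ n + (real n + 1) * \<rho> ^ n)"
      by (simp add: T_def)
  qed
qed

end

section \<open>Expansion of the powers of the operator\<close>

text \<open>
The upper bound follows from \<open>(1 - s + s\<^sup>2/2) (1 + s + s\<^sup>2/2) = 1 + s\<^sup>4/4 \<ge> 1\<close>.
\<close>

lemma exp_minus_quadratic_bounds:
  assumes "0 \<le> (s::real)"
  shows "0 \<le> exp (- s) - (1 - s)" "exp (- s) - (1 - s) \<le> s\<^sup>2 / 2"
proof -
  show "0 \<le> exp (- s) - (1 - s)" using exp_ge_add_one_self[of "- s"] by simp
  have e: "1 + s + s\<^sup>2 / 2 \<le> exp s" by (rule exp_lower_Taylor_quadratic[OF assms])
  have pos: "0 < 1 + s + s\<^sup>2 / 2" using assms by (simp add: add_pos_nonneg)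
  have "(1 - s + s\<^sup>2 / 2) * (1 + s + s\<^sup>2 / 2) = 1 + (s\<^sup>2)\<^sup>2 / 4"
    by (simp add: power2_eq_square field_simps)
  then have "1 \<le> (1 - s + s\<^sup>2 / 2) * (1 + s + s\<^sup>2 / 2)" by simp
  then have "1 / (1 + s + s\<^sup>2 / 2) \<le> 1 - s + s\<^sup>2 / 2" using pos by (simp add: pos_divide_le_eq)
  moreover have "exp (- s) \<le> 1 / (1 + s + s\<^sup>2 / 2)"
    using e pos by (simp add: exp_minus field_simps)
  ultimately show "exp (- s) - (1 - s) \<le> s\<^sup>2 / 2" by simp
qed

context walk_decay
begin

lemma exp_variance_power_le: "exp (- real n * variance_form t / 2) \<le> rate t ^ n"
proof -
  have "exp (- real n * variance_form t / 2) = exp (- variance_form t / 2) ^ n"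
    by (simp add: exp_of_nat_mult[symmetric])
  also have "\<dots> \<le> rate t ^ n" unfolding rate_def by (intro power_mono variance_rate) auto
  finally show ?thesis .
qed

lemma corrector_bounds:
  "\<exists>A\<ge>1. \<forall>t. norm (corrector1 t) \<le> A * norm t \<and> norm (corrector2 t) \<le> A * norm t ^ 2 \<and>
    norm (corrector3 t) \<le> A * norm t ^ 3 \<and> variance_form t \<le> A * norm t ^ 2 \<and>
    \<bar>skewness_form t\<bar> \<le> A * norm t ^ 3"
proof -
  obtain A1 where A1: "A1 \<ge> 0" "\<And>t. norm (corrector1 t) \<le> A1 * norm t ^ 1"
    using hpoly_bound[OF hpoly_corrector1] by blast
  obtain A2 where A2: "A2 \<ge> 0" "\<And>t. norm (corrector2 t) \<le> A2 * norm t ^ 2"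
    using hpoly_bound[OF hpoly_corrector2] by blast
  obtain A3 where A3: "A3 \<ge> 0" "\<And>t. norm (corrector3 t) \<le> A3 * norm t ^ 3"
    using hpoly_bound[OF hpoly_corrector3] by blast
  obtain V where V: "V \<ge> 0" "\<And>t. \<bar>variance_form t\<bar> \<le> V * norm t ^ 2"
    using hpoly_bound[OF hpoly_variance_form] by auto
  obtain K where K: "K \<ge> 0" "\<And>t. \<bar>skewness_form t\<bar> \<le> K * norm t ^ 3"
    using hpoly_bound[OF hpoly_skewness_form] by auto
  define A where "A = 1 + A1 + A2 + A3 + V + K"
  have le: "A1 \<le> A" "A2 \<le> A" "A3 \<le> A" "V \<le> A" "K \<le> A" "1 \<le> A"
    using A1(1) A2(1) A3(1) V(1) K(1) by (auto simp: A_def)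
  have mono: "x \<le> A * norm t ^ i" if "x \<le> B * norm t ^ i" "B \<le> A" for x B i and t :: "real \<times> real"
    using that by (meson mult_right_mono norm_ge_zero order.trans zero_le_power)
  show ?thesis
  proof (intro exI[of _ A] conjI allI)
    fix t
    show "norm (corrector1 t) \<le> A * norm t" using mono[OF A1(2)[of t] le(1)] by simp
    show "norm (corrector2 t) \<le> A * norm t ^ 2" by (rule mono[OF A2(2) le(2)])
    show "norm (corrector3 t) \<le> A * norm t ^ 3" by (rule mono[OF A3(2) le(3)])
    show "variance_form t \<le> A * norm t ^ 2" by (rule mono[OF order.trans[OF abs_ge_self V(2)] le(4)])
    show "\<bar>skewness_form t\<bar> \<le> A * norm t ^ 3" by (rule mono[OF K(2) le(5)])
  qed (rule le)
qed

text \<open>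
  A replacement for the \<open>n\<close>-th power of the eigenvalue. It is linear in \<open>\<kappa>\<close> from the start, so that the
  Gaussian integrals of the final step can be evaluated.
\<close>

definition eigen_approx :: "nat \<Rightarrow> real \<times> real \<Rightarrow> complex" where
  "eigen_approx n t = of_real (exp (- real n * variance_form t / 2)) * (1 + \<i> * of_real (real n * skewness_form t))"

text \<open>
  With \<open>s = \<sigma>/2\<close>, the first-order terms cancel and the rest is of size \<open>s |\<kappa>|\<close>, \<open>n \<kappa>\<^sup>2\<close> or \<open>s\<^sup>2 (1 + n |\<kappa>|)\<close>.
\<close>

lemma eigen_approx_step:
  "\<exists>D\<ge>0. \<forall>t\<in>torus_box. \<forall>n. norm (eigen_approx n t * eigenval t - eigen_approx (Suc n) t)
     \<le> rate t ^ n * (D * norm t ^ 4 + D * norm t ^ 6 * real n)"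
proof -
  obtain A where A: "A \<ge> 1" and var: "\<And>t. variance_form t \<le> A * norm t ^ 2"
    and skew: "\<And>t. \<bar>skewness_form t\<bar> \<le> A * norm t ^ 3"
    using corrector_bounds by blast
  define D where "D = 8 * A * A + A\<^sup>2 + (A\<^sup>2 + 520 * A\<^sup>2 * A)"
  show ?thesis
  proof (intro exI[of _ D] conjI ballI allI)
    show "D \<ge> 0" using A by (simp add: D_def)
    fix t n assume t: "t \<in> torus_box"
    define T where "T = norm t"
    have T: "0 \<le> T" "T \<le> 8" using norm_torus_le[OF t] by (auto simp: T_def)
    define s where "s = variance_form t / 2"
    define k where "k = skewness_form t"
    define e where "e = exp (- s) - (1 - s)"
    have s: "0 \<le> s" "s \<le> A * T\<^sup>2"
      using variance_form_nonneg[of t] var[of t] by (auto simp: s_def T_def)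
    have k: "\<bar>k\<bar> \<le> A * T ^ 3" using skew by (simp add: k_def T_def)
    have e: "0 \<le> e" "e \<le> A\<^sup>2 * T ^ 4"
    proof -
      have "e \<le> s\<^sup>2 / 2" "0 \<le> e" using exp_minus_quadratic_bounds[OF s(1)] by (auto simp: e_def)
      moreover have "s\<^sup>2 \<le> (A * T\<^sup>2)\<^sup>2" using s by (intro power_mono) auto
      moreover have "(A * T\<^sup>2)\<^sup>2 = A\<^sup>2 * T ^ 4" by (simp add: power_mult_distrib flip: power_mult)
      moreover have "0 \<le> s\<^sup>2" by simp
      ultimately show "0 \<le> e" "e \<le> A\<^sup>2 * T ^ 4" by linarith+
    qed
    have T5: "T * T ^ 4 \<le> 8 * T ^ 4" and T7: "T * T ^ 6 \<le> 8 * T ^ 6" and T3: "T ^ 3 \<le> 512"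
    proof -
      show "T * T ^ 4 \<le> 8 * T ^ 4" "T * T ^ 6 \<le> 8 * T ^ 6" using T by (auto intro!: mult_right_mono)
      have "T ^ 3 \<le> 8 ^ 3" using T by (intro power_mono) auto
      then show "T ^ 3 \<le> 512" by simp
    qed
    have "eigen_approx (Suc n) t = of_real (exp (- real n * variance_form t / 2)) * (of_real (1 - s + e) * (1 + \<i> * of_real ((real n + 1) * k)))"
    proof -
      have "- real (Suc n) * variance_form t / 2 = - real n * variance_form t / 2 + - s"
        by (simp add: s_def field_simps)
      then have "exp (- real (Suc n) * variance_form t / 2) = exp (- real n * variance_form t / 2) * (1 - s + e)"
        by (simp only: exp_add e_def) simp
      then show ?thesis
        unfolding eigen_approx_def k_def[symmetric] of_real_mult[symmetric] by (simp add: mult_ac add.commute)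
    qed
    then have "eigen_approx n t * eigenval t - eigen_approx (Suc n) t
       = of_real (exp (- real n * variance_form t / 2)) *
         ((1 + \<i> * of_real (real n * k)) * (1 - of_real s + \<i> * of_real k) - of_real (1 - s + e) * (1 + \<i> * of_real ((real n + 1) * k)))"
      unfolding eigen_approx_def eigenval_def k_def[symmetric] s_def[symmetric]
      by (simp only: right_diff_distrib mult.assoc)
    also have "(1 + \<i> * of_real (real n * k)) * (1 - of_real s + \<i> * of_real k) - of_real (1 - s + e) * (1 + \<i> * of_real ((real n + 1) * k))
       = (\<i> * of_real (s * k) - of_real (real n * k\<^sup>2)) - (of_real e + \<i> * of_real (e * ((real n + 1) * k)))"
      by (simp add: complex_eq_iff) (simp add: algebra_simps power2_eq_square)
    finally have "norm (eigen_approx n t * eigenval t - eigen_approx (Suc n) t)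
      = exp (- real n * variance_form t / 2) * norm ((\<i> * of_real (s * k) - of_real (real n * k\<^sup>2)) - (of_real e + \<i> * of_real (e * ((real n + 1) * k))))"
      by (simp only: norm_mult norm_of_real abs_exp_cancel)
    also have "\<dots> \<le> rate t ^ n * (D * T ^ 4 + D * T ^ 6 * real n)"
    proof (rule mult_mono[OF exp_variance_power_le])
      have "norm ((\<i> * complex_of_real (s * k) - of_real (real n * k\<^sup>2)) - (of_real e + \<i> * of_real (e * ((real n + 1) * k))))
        \<le> (norm (\<i> * complex_of_real (s * k)) + norm (complex_of_real (real n * k\<^sup>2))) + (norm (complex_of_real e) + norm (\<i> * complex_of_real (e * ((real n + 1) * k))))"
        by (intro order.trans[OF norm_triangle_ineq4] add_mono norm_triangle_ineq norm_triangle_ineq4)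
      also have "\<dots> = s * \<bar>k\<bar> + real n * k\<^sup>2 + e + e * ((real n + 1) * \<bar>k\<bar>)"
        using s e by (simp add: norm_mult abs_mult del: of_real_mult of_real_power of_real_add)
      also have "\<dots> \<le> 8 * A * A * T ^ 4 + real n * (A\<^sup>2 * T ^ 6) + A\<^sup>2 * T ^ 4 + (512 * A\<^sup>2 * A * T ^ 4 + 8 * A\<^sup>2 * A * T ^ 6 * real n)"
      proof (intro add_mono e(2))
        have "s * \<bar>k\<bar> \<le> (A * T\<^sup>2) * (A * T ^ 3)" using s k A T by (intro mult_mono) auto
        also have "\<dots> = A * A * (T * T ^ 4)" by (simp add: eval_nat_numeral)
        also have "\<dots> \<le> A * A * (8 * T ^ 4)" using A by (intro mult_left_mono T5) auto
        finally show "s * \<bar>k\<bar> \<le> 8 * A * A * T ^ 4" by simp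
        have "k\<^sup>2 \<le> (A * T ^ 3)\<^sup>2" using k by (metis abs_ge_zero power2_abs power_mono)
        also have "\<dots> = A\<^sup>2 * T ^ 6" by (simp add: power_mult_distrib flip: power_mult)
        finally show "real n * k\<^sup>2 \<le> real n * (A\<^sup>2 * T ^ 6)" by (rule mult_left_mono) auto
        have "e * ((real n + 1) * \<bar>k\<bar>) \<le> (A\<^sup>2 * T ^ 4) * ((real n + 1) * (A * T ^ 3))"
          using e k A T by (intro mult_mono) auto
        also have "\<dots> = A\<^sup>2 * A * (T ^ 4 * T ^ 3) + A\<^sup>2 * A * real n * (T * T ^ 6)"
          by (simp add: algebra_simps eval_nat_numeral)
        also have "\<dots> \<le> A\<^sup>2 * A * (T ^ 4 * 512) + A\<^sup>2 * A * real n * (8 * T ^ 6)"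
          using A T by (intro add_mono mult_left_mono T7 T3) auto
        finally show "e * ((real n + 1) * \<bar>k\<bar>) \<le> 512 * A\<^sup>2 * A * T ^ 4 + 8 * A\<^sup>2 * A * T ^ 6 * real n"
          by (simp add: mult_ac)
      qed
      also have "\<dots> = (8 * A * A + A\<^sup>2 + 512 * A\<^sup>2 * A) * T ^ 4 + (A\<^sup>2 + 8 * A\<^sup>2 * A) * (T ^ 6 * real n)"
        by (simp add: algebra_simps)
      also have "\<dots> \<le> D * T ^ 4 + D * (T ^ 6 * real n)"
        using A T by (intro add_mono mult_right_mono) (auto simp: D_def)
      finally show "norm ((\<i> * complex_of_real (s * k) - of_real (real n * k\<^sup>2)) - (of_real e + \<i> * of_real (e * ((real n + 1) * k))))
        \<le> D * T ^ 4 + D * T ^ 6 * real n" by (simp add: mult.assoc)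
    qed (use rate_pos[of t] in auto)
    finally show "norm (eigen_approx n t * eigenval t - eigen_approx (Suc n) t)
       \<le> rate t ^ n * (D * norm t ^ 4 + D * norm t ^ 6 * real n)" by (simp add: T_def)
  qed
qed

lemma eigenvec_bound: "\<exists>U\<ge>0. \<forall>t\<in>torus_box. \<forall>j. norm (eigenvec t j) \<le> U"
proof -
  obtain A where A: "A \<ge> 1" and c: "\<And>t. norm (corrector1 t) \<le> A * norm t" "\<And>t. norm (corrector2 t) \<le> A * norm t ^ 2"
    "\<And>t. norm (corrector3 t) \<le> A * norm t ^ 3"
    using corrector_bounds by blast
  show ?thesis
  proof (intro exI[of _ "1 + A * 8 + A * 8 ^ 2 + A * 8 ^ 3"] conjI ballI allI)
    fix t j assume t: "t \<in> torus_box"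
    note T = norm_torus_le[OF t]
    have "norm (eigenvec t j) \<le> norm (cvec 1 j) + norm (cvec (corrector1 t) j) + norm (cvec (corrector2 t) j) + norm (cvec (corrector3 t) j)"
      unfolding eigenvec_def
      by (intro order.trans[OF norm_triangle_ineq] add_mono) (auto simp: norm_mult)
    also have "\<dots> \<le> 1 + A * norm t + A * norm t ^ 2 + A * norm t ^ 3"
      by (intro add_mono order.trans[OF cvec_norm_le c(1)] order.trans[OF cvec_norm_le c(2)] order.trans[OF cvec_norm_le c(3)])
        (simp add: cvec_def)
    also have "\<dots> \<le> 1 + A * 8 + A * 8 ^ 2 + A * 8 ^ 3"
      using A T by (intro add_mono mult_left_mono power_mono) auto
    finally show "norm (eigenvec t j) \<le> 1 + A * 8 + A * 8 ^ 2 + A * 8 ^ 3" .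
  qed (use A in auto)
qed

lemma norm_eigen_approx_le:
  assumes "\<bar>skewness_form t\<bar> \<le> B"
  shows "norm (eigen_approx n t) \<le> rate t ^ n * (1 + real n * B)"
  unfolding eigen_approx_def norm_mult norm_of_real abs_exp_cancel
proof (rule mult_mono[OF exp_variance_power_le])
  have "norm (1 + \<i> * complex_of_real (real n * skewness_form t)) \<le> 1 + real n * \<bar>skewness_form t\<bar>"
    by (rule norm_triangle_le) (simp add: norm_mult abs_mult)
  also have "\<dots> \<le> 1 + real n * B" using assms by (intro add_left_mono mult_left_mono) auto
  finally show "norm (1 + \<i> * complex_of_real (real n * skewness_form t)) \<le> 1 + real n * B" .
qed (use rate_pos[of t] in auto)

lemma eigenvec_propagation:
  "\<exists>D\<ge>0. \<forall>t\<in>torus_box. \<forall>n j. norm ((char_op p t ^^ n) (eigenvec t) j - eigen_approx n t * eigenvec t j)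
     \<le> D * (real n * norm t ^ 4 + (real n)\<^sup>2 * norm t ^ 6) * rate t ^ n"
proof -
  obtain D1 where D1: "D1 \<ge> 0" and step: "\<And>t n. t \<in> torus_box \<Longrightarrow> norm (eigen_approx n t * eigenval t - eigen_approx (Suc n) t)
     \<le> rate t ^ n * (D1 * norm t ^ 4 + D1 * norm t ^ 6 * real n)"
    using eigen_approx_step by blast
  obtain D2 where D2: "D2 \<ge> 0" and resid: "\<And>t j. t \<in> torus_box \<Longrightarrow>
     norm (char_op p t (eigenvec t) j - eigenval t * eigenvec t j) \<le> D2 * norm t ^ 4"
    using eigenvec_residual by blast
  obtain A where A: "A \<ge> 1" and skew: "\<And>t. \<bar>skewness_form t\<bar> \<le> A * norm t ^ 3"
    using corrector_bounds by blast
  obtain U where U: "U \<ge> 0" "\<And>t j. t \<in> torus_box \<Longrightarrow> norm (eigenvec t j) \<le> U"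
    using eigenvec_bound by blast
  define E where "E = D2 + 8 * A * D2 + D1 * U"
  have E: "E \<ge> 0" using A D1 D2 U by (simp add: E_def)
  show ?thesis
  proof (intro exI[of _ "C * E / r"] conjI ballI allI)
    show "C * E / r \<ge> 0" using E constants by simp
    fix t n j assume t: "t \<in> torus_box"
    define T where "T = norm t"
    have T: "0 \<le> T" "T \<le> 8" using norm_torus_le[OF t] by (auto simp: T_def)
    define w where "w = (\<lambda>m k. eigen_approx m t * eigenvec t k)"
    have q0: "rate t ^ m \<ge> 0" for m using rate_pos[of t] by simp
    have e: "norm (char_op p t (w m) k - w (Suc m) k) \<le> rate t ^ m * (E * T ^ 4 + E * T ^ 6 * real m)" for m k
    proof -
      have "char_op p t (w m) k - w (Suc m) k = eigen_approx m t * (char_op p t (eigenvec t) k - eigenval t * eigenvec t k)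
         + (eigen_approx m t * eigenval t - eigen_approx (Suc m) t) * eigenvec t k"
        unfolding w_def char_op_mult by (simp add: algebra_simps)
      then have "norm (char_op p t (w m) k - w (Suc m) k)
         \<le> norm (eigen_approx m t) * norm (char_op p t (eigenvec t) k - eigenval t * eigenvec t k)
         + norm (eigen_approx m t * eigenval t - eigen_approx (Suc m) t) * norm (eigenvec t k)"
        by (simp only: norm_mult[symmetric] norm_triangle_ineq)
      also have "\<dots> \<le> (rate t ^ m * (1 + real m * (A * T ^ 3))) * (D2 * T ^ 4)
         + (rate t ^ m * (D1 * T ^ 4 + D1 * T ^ 6 * real m)) * U"
        unfolding T_def using A D1 q0
        by (intro add_mono mult_mono norm_eigen_approx_le skew resid step t U mult_nonneg_nonneg add_nonneg_nonneg) auto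
      also have "\<dots> = rate t ^ m * (D2 * T ^ 4 + A * D2 * real m * (T * T ^ 6) + D1 * U * T ^ 4 + D1 * U * (T ^ 6 * real m))"
        by (simp add: algebra_simps eval_nat_numeral)
      also have "\<dots> \<le> rate t ^ m * (D2 * T ^ 4 + A * D2 * real m * (8 * T ^ 6) + D1 * U * T ^ 4 + D1 * U * (T ^ 6 * real m))"
        using A D2 T q0 by (intro mult_left_mono add_mono mult_right_mono order.refl) auto
      also have "\<dots> = rate t ^ m * ((D2 + D1 * U) * T ^ 4 + (8 * A * D2 + D1 * U) * (T ^ 6 * real m))"
        by (simp add: algebra_simps)
      also have "\<dots> \<le> rate t ^ m * (E * T ^ 4 + E * (T ^ 6 * real m))"
        using A D1 D2 U T q0 unfolding E_def
        by (intro mult_left_mono add_mono mult_right_mono) auto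
      finally show ?thesis by (simp only: mult.assoc)
    qed
    have w0: "w 0 = eigenvec t" by (simp add: w_def eigen_approx_def)
    have "norm ((char_op p t ^^ n) (w 0) j - w n j)
       \<le> (\<Sum>m<n. norm ((char_op p t ^^ (n - 1 - m)) (\<lambda>k. char_op p t (w m) k - w (Suc m) k) j))"
      unfolding duhamel[where t=t and n=n and w=w and j=j] by (simp add: norm_sum)
    also have "\<dots> \<le> (\<Sum>m<n. C * rate t ^ (n - 1 - m) * (rate t ^ m * (E * T ^ 4 + E * T ^ 6 * real m)))"
      unfolding rate_def[of t] by (intro sum_mono decay t) (use e in \<open>simp add: rate_def\<close>)
    also have "\<dots> = C * (\<Sum>m<n. rate t ^ (n - 1 - m) * (rate t ^ m * (E * T ^ 4 + E * T ^ 6 * real m)))"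
      by (simp only: sum_distrib_left mult.assoc)
    also have "\<dots> \<le> C * ((real n * (E * T ^ 4) + (real n)\<^sup>2 * (E * T ^ 6)) / r * rate t ^ n)"
      using constants E T by (intro mult_left_mono sum_rate_poly t) auto
    also have "\<dots> = C * E / r * (real n * T ^ 4 + (real n)\<^sup>2 * T ^ 6) * rate t ^ n"
      by (simp add: algebra_simps add_divide_distrib)
    finally show "norm ((char_op p t ^^ n) (eigenvec t) j - eigen_approx n t * eigenvec t j)
     \<le> C * E / r * (real n * norm t ^ 4 + (real n)\<^sup>2 * norm t ^ 6) * rate t ^ n"
      unfolding w0 by (simp add: w_def T_def)
  qed
qed

text \<open>
  The first-order dependence on the initial state \<open>j\<close> comes from the eigenvector, that on the final state
  \<open>k\<close> from the centred part of its indicator function.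
\<close>

definition linear_term :: "'s \<Rightarrow> 's \<Rightarrow> real \<times> real \<Rightarrow> real" where
  "linear_term j k t = drift_functional t (axis k 1 - \<mu> $ k *\<^sub>R 1) + \<mu> $ k * corrector1 t $ j"

lemma hpoly_linear_term: "hpoly 1 (linear_term j k)"
proof -
  have 1: "hpoly 1 (\<lambda>t. drift_functional t h)" for h
    unfolding drift_functional_def
    using hpoly_inner[OF hpoly_moment_op_vec[of 1 0 "\<lambda>_. poisson h"]] by (simp add: hpoly_const)
  have 2: "hpoly 1 (\<lambda>t. corrector1 t $ j)"
    by (rule hpoly_linear[OF bounded_linear.linear[OF bounded_linear_vec_nth] hpoly_corrector1])
  show ?thesis
    unfolding linear_term_def[abs_def]
    using hpoly_add[OF 1 hpoly_scaleR[OF 2, of "\<mu> $ k"]] by simp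
qed

definition main_term :: "nat \<Rightarrow> 's \<Rightarrow> 's \<Rightarrow> real \<times> real \<Rightarrow> complex" where
  "main_term n j k t = of_real (exp (- real n * variance_form t / 2)) *
     (of_real (\<mu> $ k) + \<i> * of_real (linear_term j k t) + \<i> * of_real (real n * \<mu> $ k * skewness_form t))"

text \<open>
  The indicator function of \<open>k\<close> is split as \<open>(h - i a) + (\<mu>\<^sub>k + i a) 1\<close>, where \<open>h\<close> is centred and
  \<open>a = drift_functional t h\<close>, and the constant function as \<open>1 = u - i f\<^sub>1 - f\<^sub>2 - i f\<^sub>3\<close>. The first bracket
  is covered by \<open>mean_zero_relaxation_corrected\<close>, \<open>u\<close> by \<open>eigenvec_propagation\<close>, the centred \<open>f\<^sub>1\<close> by
  \<open>mean_zero_relaxation\<close> and \<open>f\<^sub>2, f\<^sub>3\<close> by the decay bound. In the remaining product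
  \<open>(\<mu>\<^sub>k + i a) (1 + i n \<kappa>) u\<close> only the terms of degree at most one in \<open>(a, f\<^sub>1, n \<kappa>)\<close> are kept.
\<close>

lemma char_op_pow_expansion:
  "\<exists>D\<ge>0. \<forall>t\<in>torus_box. \<forall>n. norm ((char_op p t ^^ n) (\<lambda>i. of_bool (i = k)) j - main_term n j k t)
     \<le> D * (((norm t)\<^sup>2 + real n * norm t ^ 4 + (real n)\<^sup>2 * norm t ^ 6) * rate t ^ n + (real n + 1) * \<rho> ^ n)"
proof -
  obtain A where A: "A \<ge> 1" and c1: "\<And>t. norm (corrector1 t) \<le> A * norm t"
    and c2: "\<And>t. norm (corrector2 t) \<le> A * norm t ^ 2" and c3: "\<And>t. norm (corrector3 t) \<le> A * norm t ^ 3"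
    and skew: "\<And>t. \<bar>skewness_form t\<bar> \<le> A * norm t ^ 3"
    using corrector_bounds by blast
  obtain D1 where D1: "D1 \<ge> 0" and relax: "\<And>t h n j. t \<in> torus_box \<Longrightarrow> \<mu> \<bullet> h = 0 \<Longrightarrow>
     norm ((char_op p t ^^ n) (cvec h) j) \<le> D1 * norm h * (norm t * rate t ^ n + \<rho> ^ n)"
    using mean_zero_relaxation by blast
  obtain D2 where D2: "D2 \<ge> 0" and relax2: "\<And>t h n j. t \<in> torus_box \<Longrightarrow> \<mu> \<bullet> h = 0 \<Longrightarrow>
     norm ((char_op p t ^^ n) (\<lambda>k. cvec h k - \<i> * of_real (drift_functional t h)) j)
       \<le> D2 * norm h * ((norm t)\<^sup>2 * rate t ^ n + (real n + 1) * \<rho> ^ n)"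
    using mean_zero_relaxation_corrected by blast
  obtain D3 where D3: "D3 \<ge> 0" and propagate: "\<And>t n j. t \<in> torus_box \<Longrightarrow>
     norm ((char_op p t ^^ n) (eigenvec t) j - eigen_approx n t * eigenvec t j)
     \<le> D3 * (real n * norm t ^ 4 + (real n)\<^sup>2 * norm t ^ 6) * rate t ^ n"
    using eigenvec_propagation by blast
  obtain B where B: "B \<ge> 0" and drift: "\<And>t h. \<bar>drift_functional t h\<bar> \<le> B * norm t * norm h"
    using drift_functional_bound by blast
  define h where "h = axis k 1 - \<mu> $ k *\<^sub>R (1 :: real ^ 's)"
  have h: "\<mu> \<bullet> h = 0" by (simp add: h_def inner_diff_right inner_one inner_axis)
  have mu: "0 \<le> \<mu> $ k" "\<mu> $ k \<le> 1"
    using stationary member_le_sum[of k UNIV "\<lambda>k. \<mu> $ k"] by (auto simp: stationary_distribution_def)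
  define A' where "A' = B * norm h"
  define M where "M = 1 + 8 * A'"
  have A': "A' \<ge> 0" "M \<ge> 1" using B by (auto simp: A'_def M_def)
  have C0: "C \<ge> 0" "\<rho> > 0" using constants by auto
  define F1 where "F1 = D2 * norm h"
  define F2 where "F2 = M * D3"
  define F3 where "F3 = M * (8 * D1 * A + 9 * C * A)"
  define F4 where "F4 = A' * A + M * A * A + 72 * M * A * A + A' * A + 9 * M * A"
  define D where "D = F1 + F2 + F3 + F4"
  have Fpos: "F1 \<ge> 0" "F2 \<ge> 0" "F3 \<ge> 0" "F4 \<ge> 0"
    using D1 D2 D3 A A' C0 by (auto simp: F1_def F2_def F3_def F4_def)
  show ?thesis
  proof (intro exI[of _ D] conjI ballI allI)
    show "D \<ge> 0" using Fpos by (simp add: D_def)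
    fix t n assume t: "t \<in> torus_box"
    define T where "T = norm t"
    have T: "0 \<le> T" "T \<le> 8" using norm_torus_le[OF t] by (auto simp: T_def)
    define q where "q = rate t ^ n"
    define X where "X = (T\<^sup>2 + real n * T ^ 4 + (real n)\<^sup>2 * T ^ 6) * q"
    define Y where "Y = (real n + 1) * \<rho> ^ n"
    have q0: "q \<ge> 0" using rate_pos[of t] by (simp add: q_def)
    have Y: "0 \<le> Y" "\<rho> ^ n \<le> Y" using C0 by (auto simp: Y_def)
    have X: "T\<^sup>2 * q \<le> X" "real n * T ^ 4 * q \<le> X" "(real n * T ^ 4 + (real n)\<^sup>2 * T ^ 6) * q \<le> X" "0 \<le> X"
      unfolding X_def using q0 T by (auto intro!: mult_right_mono mult_nonneg_nonneg add_nonneg_nonneg)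
    let ?P = "char_op p t ^^ n"
    define a where "a = drift_functional t h"
    define \<theta> where "\<theta> = complex_of_real (\<mu> $ k) + \<i> * of_real a"
    have a: "\<bar>a\<bar> \<le> A' * T" using drift[of t h] by (simp add: a_def A'_def T_def mult_ac)
    have \<theta>: "norm \<theta> \<le> M"
    proof -
      have "norm \<theta> \<le> \<mu> $ k + \<bar>a\<bar>" unfolding \<theta>_def by (rule norm_triangle_le) (use mu in \<open>simp add: norm_mult\<close>)
      also have "\<bar>a\<bar> \<le> A' * 8" using a T A' by (meson mult_left_mono order.trans)
      finally show ?thesis using mu by (simp add: M_def)
    qed
    define x0 where "x0 = ?P (\<lambda>i. cvec h i - \<i> * of_real a) j"
    define x1 where "x1 = ?P (eigenvec t) j - eigen_approx n t * eigenvec t j"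
    define x2 where "x2 = \<i> * ?P (cvec (corrector1 t)) j + ?P (cvec (corrector2 t)) j + \<i> * ?P (cvec (corrector3 t)) j"
    define f1 where "f1 = corrector1 t $ j"
    define g where "g = complex_of_real (corrector2 t $ j) + \<i> * of_real (corrector3 t $ j)"
    define \<kappa> where "\<kappa> = skewness_form t"
    define E where "E = exp (- real n * variance_form t / 2)"
    define x3 where "x3 = - of_real (a * real n * \<kappa>) - of_real (a * f1) - \<theta> * of_real (real n * \<kappa> * f1)
        + \<theta> * (1 + \<i> * of_real (real n * \<kappa>)) * g"
    have E: "0 \<le> E" "E \<le> q" using exp_variance_power_le by (auto simp: E_def q_def)
    have "?P (\<lambda>i. of_bool (i = k)) j = x0 + \<theta> * (?P (eigenvec t) j - x2)"
    proof -
      have 1: "?P (\<lambda>i. of_bool (i = k)) j = x0 + \<theta> * ?P (cvec 1) j"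
      proof -
        have eq: "(\<lambda>i. of_bool (i = k)) = (\<lambda>i. (cvec h i - \<i> * of_real a) + \<theta> * cvec 1 i)"
          by (auto simp: fun_eq_iff h_def cvec_def \<theta>_def axis_def)
        show ?thesis unfolding x0_def by (subst eq) (simp only: char_op_pow_add char_op_pow_mult)
      qed
      have "?P (eigenvec t) j = ?P (cvec 1) j + x2"
        unfolding eigenvec_def x2_def by (simp only: char_op_pow_add char_op_pow_mult) (simp only: add.assoc)
      then show ?thesis using 1 by simp
    qed
    also have "?P (eigenvec t) j = x1 + eigen_approx n t * eigenvec t j" by (simp add: x1_def)
    also have "x0 + \<theta> * (x1 + eigen_approx n t * eigenvec t j - x2)
       = main_term n j k t + (x0 + \<theta> * x1 - \<theta> * x2 + of_real E * x3)"
    proof -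
      have ev: "eigenvec t j = 1 + \<i> * of_real f1 + g"
        by (simp add: eigenvec_def cvec_def f1_def g_def)
      have "\<theta> * ((1 + \<i> * of_real (real n * \<kappa>)) * (1 + \<i> * of_real f1 + g))
         = (of_real (\<mu> $ k) + \<i> * of_real (a + \<mu> $ k * f1) + \<i> * of_real (real n * \<mu> $ k * \<kappa>)) + x3"
        unfolding x3_def \<theta>_def by (simp add: complex_eq_iff) (simp add: algebra_simps)
      then have "\<theta> * (eigen_approx n t * eigenvec t j) = main_term n j k t + of_real E * x3"
        unfolding eigen_approx_def main_term_def linear_term_def ev h_def[symmetric] a_def[symmetric]
          f1_def[symmetric] \<kappa>_def[symmetric] E_def[symmetric]
        by (metis (no_types, lifting) distrib_left mult.assoc mult.left_commute)
      then show ?thesis by (simp add: algebra_simps)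
    qed
    finally have eq: "?P (\<lambda>i. of_bool (i = k)) j - main_term n j k t = x0 + \<theta> * x1 - \<theta> * x2 + of_real E * x3"
      by simp
    have b0: "norm x0 \<le> F1 * (X + Y)"
    proof -
      have "norm x0 \<le> D2 * norm h * (T\<^sup>2 * q + Y)"
        unfolding x0_def a_def T_def q_def Y_def by (rule relax2[OF t h])
      also have "\<dots> \<le> F1 * (X + Y)"
        unfolding F1_def using D2 X by (intro mult_left_mono add_right_mono) auto
      finally show ?thesis .
    qed
    have b1: "norm (\<theta> * x1) \<le> F2 * (X + Y)"
    proof -
      have "norm x1 \<le> D3 * ((real n * T ^ 4 + (real n)\<^sup>2 * T ^ 6) * q)"
        unfolding x1_def T_def q_def mult.assoc[symmetric] by (rule propagate[OF t])
      also have "\<dots> \<le> D3 * (X + Y)" using D3 X Y by (intro mult_left_mono) auto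
      finally have "norm x1 \<le> D3 * (X + Y)" .
      with \<theta> A' D3 show ?thesis
        unfolding norm_mult F2_def mult.assoc by (intro mult_mono) auto
    qed
    have b2: "norm (\<theta> * x2) \<le> F3 * (X + Y)"
    proof -
      have 1: "norm (?P (cvec (corrector1 t)) j) \<le> 8 * D1 * A * (X + Y)"
      proof -
        have "norm (?P (cvec (corrector1 t)) j) \<le> D1 * norm (corrector1 t) * (T * q + \<rho> ^ n)"
          unfolding T_def q_def by (rule relax[OF t inner_corrector1])
        also have "\<dots> \<le> D1 * (A * T) * (T * q + \<rho> ^ n)"
          unfolding T_def using D1 q0 C0 by (intro mult_right_mono mult_left_mono c1) auto
        also have "\<dots> = D1 * A * (T\<^sup>2 * q + T * \<rho> ^ n)" by (simp add: power2_eq_square algebra_simps)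
        also have "\<dots> \<le> D1 * A * (8 * X + 8 * Y)"
        proof (intro mult_left_mono add_mono)
          show "T\<^sup>2 * q \<le> 8 * X" using X by linarith
          show "T * \<rho> ^ n \<le> 8 * Y" using T Y C0 by (intro mult_mono) auto
        qed (use D1 A in auto)
        finally show ?thesis by (simp add: algebra_simps)
      qed
      have 2: "norm (?P (cvec (corrector2 t)) j) \<le> C * A * (X + Y)"
      proof -
        have "norm (?P (cvec (corrector2 t)) j) \<le> C * q * (A * T\<^sup>2)"
          unfolding q_def rate_def T_def by (rule decay[OF t order.trans[OF cvec_norm_le c2]])
        also have "\<dots> = C * A * (T\<^sup>2 * q)" by simp
        also have "\<dots> \<le> C * A * (X + Y)" using C0 A X Y by (intro mult_left_mono) auto
        finally show ?thesis .
      qed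
      have 3: "norm (?P (cvec (corrector3 t)) j) \<le> 8 * C * A * (X + Y)"
      proof -
        have "norm (?P (cvec (corrector3 t)) j) \<le> C * q * (A * T ^ 3)"
          unfolding q_def rate_def T_def by (rule decay[OF t order.trans[OF cvec_norm_le c3]])
        also have "\<dots> = C * A * (T * (T\<^sup>2 * q))" by (simp add: eval_nat_numeral)
        also have "\<dots> \<le> C * A * (8 * (X + Y))"
        proof (intro mult_left_mono mult_mono)
          show "T\<^sup>2 * q \<le> X + Y" using X Y by linarith
        qed (use T C0 A q0 in auto)
        finally show ?thesis by (simp only: mult_ac)
      qed
      have "norm x2 \<le> norm (?P (cvec (corrector1 t)) j) + norm (?P (cvec (corrector2 t)) j) + norm (?P (cvec (corrector3 t)) j)"
        unfolding x2_def by (intro order.trans[OF norm_triangle_ineq] add_mono) (auto simp: norm_mult)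
      also have "\<dots> \<le> (8 * D1 * A + 9 * C * A) * (X + Y)" using 1 2 3 by (simp add: distrib_right)
      finally have "norm x2 \<le> (8 * D1 * A + 9 * C * A) * (X + Y)" .
      with \<theta> A' show ?thesis
        unfolding norm_mult F3_def mult.assoc by (intro mult_mono) auto
    qed
    have b3: "norm (of_real E * x3) \<le> F4 * (X + Y)"
    proof -
      have k: "\<bar>\<kappa>\<bar> \<le> A * T ^ 3" using skew by (simp add: \<kappa>_def T_def)
      have f1: "\<bar>f1\<bar> \<le> A * T"
        using order.trans[OF component_le_norm_cart c1[of t]] by (simp add: f1_def T_def)
      have g: "norm g \<le> 9 * A * T\<^sup>2"
      proof -
        have "norm g \<le> A * T\<^sup>2 + A * T ^ 3"
          unfolding g_def T_def
          using order.trans[OF component_le_norm_cart c2[of t]] order.trans[OF component_le_norm_cart c3[of t]]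
          by (intro norm_triangle_le add_mono) (simp_all add: norm_mult)
        also have "\<dots> = A * (1 + T) * T\<^sup>2" by (simp add: algebra_simps eval_nat_numeral)
        also have "\<dots> \<le> A * 9 * T\<^sup>2" using A T by (intro mult_right_mono mult_left_mono) auto
        finally show ?thesis by (simp add: mult.commute)
      qed
      have y1: "norm (complex_of_real (a * real n * \<kappa>)) \<le> A' * A * (real n * T ^ 4)"
      proof -
        have "\<bar>a\<bar> * real n * \<bar>\<kappa>\<bar> \<le> (A' * T) * real n * (A * T ^ 3)"
          using a k A' T by (intro mult_mono) auto
        then show ?thesis by (simp add: norm_mult abs_mult eval_nat_numeral mult_ac)
      qed
      have y2: "norm (complex_of_real (a * f1)) \<le> A' * A * T\<^sup>2"
      proof -
        have "\<bar>a\<bar> * \<bar>f1\<bar> \<le> (A' * T) * (A * T)" using a f1 A' T by (intro mult_mono) auto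
        then show ?thesis by (simp add: norm_mult abs_mult power2_eq_square mult_ac)
      qed
      have y3: "norm (\<theta> * of_real (real n * \<kappa> * f1)) \<le> M * A * A * (real n * T ^ 4)"
      proof -
        have "norm \<theta> * (real n * \<bar>\<kappa>\<bar> * \<bar>f1\<bar>) \<le> M * (real n * (A * T ^ 3) * (A * T))"
          using \<theta> k f1 A A' T by (intro mult_mono) auto
        then show ?thesis by (simp add: norm_mult abs_mult eval_nat_numeral mult_ac)
      qed
      have y4: "norm (\<theta> * (1 + \<i> * of_real (real n * \<kappa>)) * g) \<le> 9 * M * A * T\<^sup>2 + 72 * M * A * A * (real n * T ^ 4)"
      proof -
        have "norm (1 + \<i> * complex_of_real (real n * \<kappa>)) \<le> 1 + real n * (A * T ^ 3)"
        proof -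
          have "norm (1 + \<i> * complex_of_real (real n * \<kappa>)) \<le> 1 + real n * \<bar>\<kappa>\<bar>"
            by (rule norm_triangle_le) (simp add: norm_mult abs_mult)
          also have "\<dots> \<le> 1 + real n * (A * T ^ 3)" using k by (intro add_left_mono mult_left_mono) auto
          finally show ?thesis .
        qed
        then have "norm (\<theta> * (1 + \<i> * of_real (real n * \<kappa>)) * g) \<le> M * (1 + real n * (A * T ^ 3)) * (9 * A * T\<^sup>2)"
          unfolding norm_mult using \<theta> g A A' T by (intro mult_mono) auto
        also have "\<dots> = 9 * M * A * T\<^sup>2 + 9 * M * A * A * (real n * (T * T ^ 4))"
          by (simp add: algebra_simps eval_nat_numeral)
        also have "\<dots> \<le> 9 * M * A * T\<^sup>2 + 9 * M * A * A * (real n * (8 * T ^ 4))"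
          using A A' T by (intro add_left_mono mult_left_mono mult_right_mono) auto
        finally show ?thesis by simp
      qed
      have "norm x3 \<le> norm (complex_of_real (a * real n * \<kappa>)) + norm (complex_of_real (a * f1))
          + norm (\<theta> * of_real (real n * \<kappa> * f1)) + norm (\<theta> * (1 + \<i> * of_real (real n * \<kappa>)) * g)"
        unfolding x3_def
        by (intro order.trans[OF norm_triangle_ineq] add_mono order.trans[OF norm_triangle_ineq4] order.refl)
          (simp_all only: norm_minus_cancel order.refl)
      also have "\<dots> \<le> (A' * A + M * A * A + 72 * M * A * A) * (real n * T ^ 4) + (A' * A + 9 * M * A) * T\<^sup>2"
        using y1 y2 y3 y4 unfolding distrib_right by linarith
      finally have x3: "norm x3 \<le> (A' * A + M * A * A + 72 * M * A * A) * (real n * T ^ 4) + (A' * A + 9 * M * A) * T\<^sup>2" .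
      have "norm (of_real E * x3) \<le> q * ((A' * A + M * A * A + 72 * M * A * A) * (real n * T ^ 4) + (A' * A + 9 * M * A) * T\<^sup>2)"
        unfolding norm_mult norm_of_real using E x3 q0 by (intro mult_mono) auto
      also have "\<dots> = (A' * A + M * A * A + 72 * M * A * A) * (real n * T ^ 4 * q) + (A' * A + 9 * M * A) * (T\<^sup>2 * q)"
        by (simp add: algebra_simps)
      also have "\<dots> \<le> (A' * A + M * A * A + 72 * M * A * A) * (X + Y) + (A' * A + 9 * M * A) * (X + Y)"
      proof (intro add_mono mult_left_mono)
        show "real n * T ^ 4 * q \<le> X + Y" "T\<^sup>2 * q \<le> X + Y" using X Y by linarith+
      qed (use A A' in auto)
      also have "\<dots> = F4 * (X + Y)" by (simp add: F4_def algebra_simps)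
      finally show ?thesis .
    qed
    have "norm (?P (\<lambda>i. of_bool (i = k)) j - main_term n j k t)
       \<le> norm x0 + norm (\<theta> * x1) + norm (\<theta> * x2) + norm (of_real E * x3)"
      unfolding eq by (intro order.trans[OF norm_triangle_ineq] add_mono order.trans[OF norm_triangle_ineq4] order.refl)
    also have "\<dots> \<le> D * (X + Y)"
      unfolding D_def distrib_right by (intro add_mono b0 b1 b2 b3)
    finally show "norm (?P (\<lambda>i. of_bool (i = k)) j - main_term n j k t)
     \<le> D * (((norm t)\<^sup>2 + real n * norm t ^ 4 + (real n)\<^sup>2 * norm t ^ 6) * rate t ^ n + (real n + 1) * \<rho> ^ n)"
      by (simp add: X_def Y_def T_def q_def)
  qed
qed

end

section \<open>The local limit theorem\<close>

lemma (in internal_walk) walk_decay_exists: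
  assumes a: "0 < a" and det: "0 < a * d - b\<^sup>2" and var: "\<And>t. variance_form t = quad_form a b d t"
  shows "\<exists>c \<rho> r C. walk_decay p \<mu> c \<rho> r C"
proof -
  obtain c0 C0 where c0: "c0 > 0" "C0 \<ge> 1" and dec: "\<And>t v B n j. t \<in> torus_box \<Longrightarrow> (\<And>k. norm (v k) \<le> B) \<Longrightarrow>
     norm ((char_op p t ^^ n) v j) \<le> C0 * exp (- c0 * (norm t)\<^sup>2) ^ n * B"
    using char_op_torus_decay[OF irreducible aperiodic arithmetic] by blast
  obtain \<rho> C1 where rho: "0 < \<rho>" "\<rho> < 1" "C1 \<ge> 0"
    and erg: "\<And>h n. \<mu> \<bullet> h = 0 \<Longrightarrow> norm (mat_power Q n *v h) \<le> C1 * \<rho> ^ n * norm h"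
    using geometric_ergodicity[OF irreducible aperiodic stationary] by blast
  define c1 where "c1 = (a * d - b\<^sup>2) / (a + d)"
  have "a * d > 0" using det zero_le_power2[of b] by linarith
  then have "d > 0" using a by (simp add: zero_less_mult_iff)
  then have c1: "c1 > 0" using a det by (simp add: c1_def)
  have ln: "ln \<rho> < 0" using rho by simp
  (* On the torus the squared norm of t is at most 64, so the last bound gives
     exp (- c * (norm t)^2) >= exp (ln rho / 2) = sqrt rho > rho. *)
  define c where "c = min c0 (min (c1 / 2) (- ln \<rho> / 128))"
  have c: "c > 0" "c \<le> c0" "c \<le> c1 / 2" "c \<le> - ln \<rho> / 128"
    using c0 c1 ln by (auto simp: c_def)
  define r where "r = exp (ln \<rho> / 2)"
  define C where "C = max C0 C1"
  have "walk_decay p \<mu> c \<rho> r C"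
  proof unfold_locales
    show "0 < c" "0 < \<rho>" by fact+
    have "exp (ln \<rho>) < r" unfolding r_def using ln by (simp del: exp_ln)
    then show "\<rho> < r" using rho by simp
    show "r \<le> 1" using ln by (simp add: r_def)
    show "1 \<le> C" using c0 by (simp add: C_def)
    show "norm ((char_op p t ^^ n) v j) \<le> C * exp (- c * (norm t)\<^sup>2) ^ n * B"
      if t: "t \<in> torus_box" and v: "\<And>k. norm (v k) \<le> B" for t v B n j
    proof -
      have B: "B \<ge> 0" using v[of j] norm_ge_zero order.trans by blast
      have "C0 * exp (- c0 * (norm t)\<^sup>2) ^ n * B \<le> C * exp (- c * (norm t)\<^sup>2) ^ n * B"
        using B c0 c by (intro mult_right_mono mult_mono power_mono) (auto simp: C_def intro!: mult_right_mono)
      with dec[where v=v, OF t v] show ?thesis by (rule order.trans)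
    qed
    show "r \<le> exp (- c * (norm t)\<^sup>2)" if t: "t \<in> torus_box" for t
    proof -
      have "(norm t)\<^sup>2 \<le> 8\<^sup>2" using norm_torus_le[OF t] by (intro power_mono) auto
      then have "c * (norm t)\<^sup>2 \<le> (- ln \<rho> / 128) * 64" using c ln by (intro mult_mono) auto
      then show ?thesis by (simp add: r_def)
    qed
    show "exp (- variance_form t / 2) \<le> exp (- c * (norm t)\<^sup>2)" for t
    proof -
      have "c * (norm t)\<^sup>2 \<le> c1 / 2 * (norm t)\<^sup>2" using c by (intro mult_right_mono) auto
      also have "\<dots> \<le> variance_form t / 2"
      proof -
        have "c1 * (norm t)\<^sup>2 \<le> variance_form t"
          using quad_form_lower_bound[OF a det, of t] by (simp add: var c1_def)
        then show ?thesis by simp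
      qed
      finally show ?thesis by simp
    qed
    show "norm (mat_power Q n *v h) \<le> C * \<rho> ^ n * norm h" if "\<mu> \<bullet> h = 0" for h n
    proof -
      have "C1 * \<rho> ^ n * norm h \<le> C * \<rho> ^ n * norm h"
        using rho by (intro mult_right_mono) (auto simp: C_def)
      with erg[OF that] show ?thesis by (rule order.trans)
    qed
  qed
  then show ?thesis by blast
qed

text \<open>
  Three powers of \<open>z\<close> are absorbed by one exponential: with \<open>w = c z/6\<close> one has \<open>w \<le> exp w\<close> and hence
  \<open>w\<^sup>k \<le> exp (3 w) = exp (c z/2)\<close> for \<open>k \<le> 3\<close>.
\<close>

lemma cubic_le_exp:
  fixes c :: real
  assumes c: "c > 0"
  shows "\<exists>P\<ge>0. \<forall>z\<ge>0. z + z\<^sup>2 + z ^ 3 \<le> P * exp (c * z / 2)"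
proof (intro exI[of _ "6 / c + (6 / c)\<^sup>2 + (6 / c) ^ 3"] conjI allI impI)
  fix z :: real assume z: "z \<ge> 0"
  define w where "w = c * z / 6"
  have w: "w \<ge> 0" "z = 6 / c * w" "c * z / 2 = 3 * w" using c z by (auto simp: w_def)
  have "w \<le> exp w" using exp_ge_add_one_self[of w] by linarith
  then have "w ^ k \<le> exp w ^ k" for k using w by (intro power_mono) auto
  moreover have "exp w ^ k \<le> exp (3 * w)" if "k \<le> 3" for k
  proof -
    have "exp w ^ k \<le> exp w ^ 3" using w that by (intro power_increasing) auto
    then show ?thesis by (simp add: exp_of_nat_mult[symmetric])
  qed
  ultimately have "w ^ k \<le> exp (c * z / 2)" if "k \<le> 3" for k
    using that w(3) order.trans by metis
  from this[of 1] this[of 2] this[of 3]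
  have "w \<le> exp (c * z / 2)" "w\<^sup>2 \<le> exp (c * z / 2)" "w ^ 3 \<le> exp (c * z / 2)" by simp_all
  then have "6 / c * w + (6 / c)\<^sup>2 * w\<^sup>2 + (6 / c) ^ 3 * w ^ 3
     \<le> 6 / c * exp (c * z / 2) + (6 / c)\<^sup>2 * exp (c * z / 2) + (6 / c) ^ 3 * exp (c * z / 2)"
    using c by (intro add_mono mult_left_mono) auto
  moreover have "z + z\<^sup>2 + z ^ 3 = 6 / c * w + (6 / c)\<^sup>2 * w\<^sup>2 + (6 / c) ^ 3 * w ^ 3"
    unfolding w(2) by (simp only: power_mult_distrib)
  ultimately show "z + z\<^sup>2 + z ^ 3 \<le> (6 / c + (6 / c)\<^sup>2 + (6 / c) ^ 3) * exp (c * z / 2)"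
    by (simp only: distrib_right)
qed (use c in auto)

lemma geometric_le_inverse_square:
  assumes "0 < \<rho>" "\<rho> < (1::real)"
  shows "\<exists>P\<ge>0. \<forall>n\<ge>1. (real n + 1) * \<rho> ^ n \<le> P / (real n)\<^sup>2"
proof -
  have s: "2 * (- ln \<rho>) > 0" using assms by simp
  obtain P where P: "P \<ge> 0" "\<And>z. z \<ge> 0 \<Longrightarrow> z + z\<^sup>2 + z ^ 3 \<le> P * exp (2 * (- ln \<rho>) * z / 2)"
    using cubic_le_exp[OF s] by blast
  show ?thesis
  proof (intro exI[of _ P] conjI allI impI P)
    fix n :: nat assume n: "n \<ge> 1"
    have e: "exp (2 * (- ln \<rho>) * real n / 2) * \<rho> ^ n = 1"
    proof -
      have "\<rho> ^ n = exp (real n * ln \<rho>)" using assms by (simp add: exp_of_nat_mult)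
      then show ?thesis by (simp add: exp_add[symmetric])
    qed
    have "(real n + 1) * \<rho> ^ n * (real n)\<^sup>2 = ((real n)\<^sup>2 + real n ^ 3) * \<rho> ^ n"
      by (simp add: power2_eq_square power3_eq_cube algebra_simps)
    also have "\<dots> \<le> (P * exp (2 * (- ln \<rho>) * real n / 2)) * \<rho> ^ n"
    proof (rule mult_right_mono)
      show "(real n)\<^sup>2 + real n ^ 3 \<le> P * exp (2 * (- ln \<rho>) * real n / 2)"
        using P(2)[of "real n"] by linarith
    qed (use assms in auto)
    also have "\<dots> = P" using e by simp
    finally show "(real n + 1) * \<rho> ^ n \<le> P / (real n)\<^sup>2"
      using n by (simp add: pos_le_divide_eq)
  qed
qed

lemma norm_ge_1_outside_torus: "t \<notin> torus_box \<Longrightarrow> 1 \<le> norm t"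
proof -
  assume "t \<notin> torus_box"
  then have "pi < \<bar>fst t\<bar> \<or> pi < \<bar>snd t\<bar>"
    by (auto simp: torus_box_def mem_Times_iff)
  moreover have "\<bar>fst t\<bar> \<le> norm t" "\<bar>snd t\<bar> \<le> norm t"
    using norm_fst_le[of "fst t" "snd t"] norm_snd_le[of "snd t" "fst t"] by simp_all
  ultimately show ?thesis using pi_gt3 by linarith
qed

context walk_decay
begin

text \<open>
  Off the torus \<open>|t| \<ge> 1\<close>, so lower powers of \<open>|t|\<close> may be replaced by the higher ones that occur in the
  error of the expansion. Extending the integral of the main term to the plane then costs no more than that
  error.
\<close>

lemma main_term_tail:
  "\<exists>D\<ge>0. \<forall>t n. t \<notin> torus_box \<longrightarrow>
     norm (main_term n j k t) \<le> D * (((norm t)\<^sup>2 + real n * norm t ^ 4 + (real n)\<^sup>2 * norm t ^ 6) * rate t ^ n)"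
proof -
  obtain L where L: "L \<ge> 0" "\<And>t. \<bar>linear_term j k t\<bar> \<le> L * norm t ^ 1"
    using hpoly_bound[OF hpoly_linear_term[of j k]] by auto
  obtain A where A: "A \<ge> 0" "\<And>t. \<bar>skewness_form t\<bar> \<le> A * norm t ^ 3"
    using hpoly_bound[OF hpoly_skewness_form] by auto
  have mu: "0 \<le> \<mu> $ k" "\<mu> $ k \<le> 1"
    using stationary member_le_sum[of k UNIV "\<lambda>k. \<mu> $ k"] by (auto simp: stationary_distribution_def)
  show ?thesis
  proof (intro exI[of _ "1 + L + A"] conjI allI impI)
    fix t n assume t: "t \<notin> torus_box"
    define T where "T = norm t"
    have T: "1 \<le> T" using norm_ge_1_outside_torus[OF t] by (simp add: T_def)
    have pw: "T ^ i \<le> T ^ l" if "i \<le> l" for i l using T that by (rule power_increasing[rotated])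
    have "norm (of_real (\<mu> $ k) + \<i> * of_real (linear_term j k t) + \<i> * of_real (real n * \<mu> $ k * skewness_form t))
      \<le> \<bar>\<mu> $ k\<bar> + \<bar>linear_term j k t\<bar> + \<bar>real n * \<mu> $ k * skewness_form t\<bar>"
      by (intro order.trans[OF norm_triangle_ineq] add_mono) (simp_all only: norm_mult norm_ii norm_of_real mult_1_left order.refl)
    also have "\<dots> \<le> 1 * T\<^sup>2 + L * T\<^sup>2 + A * (real n * T ^ 4)"
    proof (intro add_mono)
      show "\<bar>\<mu> $ k\<bar> \<le> 1 * T\<^sup>2" using mu pw[of 0 2] by simp
      show "\<bar>linear_term j k t\<bar> \<le> L * T\<^sup>2"
        using L(2)[of t] mult_left_mono[OF pw[of 1 2] L(1)] by (simp add: T_def)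
      have "real n * (\<mu> $ k * \<bar>skewness_form t\<bar>) \<le> real n * (1 * (A * T ^ 3))"
        using mu A by (intro mult_left_mono mult_mono) (auto simp: T_def)
      also have "\<dots> \<le> real n * (1 * (A * T ^ 4))"
        using A by (intro mult_left_mono pw) auto
      finally show "\<bar>real n * \<mu> $ k * skewness_form t\<bar> \<le> A * (real n * T ^ 4)"
        using mu by (simp add: abs_mult mult_ac)
    qed
    also have "\<dots> \<le> (1 + L + A) * (T\<^sup>2 + real n * T ^ 4 + (real n)\<^sup>2 * T ^ 6)"
      using L(1) A(1) T by (simp add: algebra_simps)
    finally have "norm (main_term n j k t) \<le> rate t ^ n * ((1 + L + A) * (T\<^sup>2 + real n * T ^ 4 + (real n)\<^sup>2 * T ^ 6))"
      unfolding main_term_def norm_mult[of "of_real _"] norm_of_real abs_exp_cancel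
      using rate_pos[of t] by (intro mult_mono exp_variance_power_le) auto
    then show "norm (main_term n j k t) \<le> (1 + L + A) * (((norm t)\<^sup>2 + real n * norm t ^ 4 + (real n)\<^sup>2 * norm t ^ 6) * rate t ^ n)"
      by (simp only: T_def mult_ac)
  qed (use L A in auto)
qed

text \<open>
  In terms of \<open>z = n |t|\<^sup>2\<close> the polynomial weight of the error is \<open>(z + z\<^sup>2 + z\<^sup>3)/n\<close>. By \<open>cubic_le_exp\<close>
  half of the exponential absorbs the numerator, and the integral of the other half contributes a second
  factor \<open>1/n\<close>.
\<close>

lemma fourier_difference_bound:
  "\<exists>K\<ge>0. \<forall>n\<ge>1. \<forall>x. integrable lborel (\<lambda>t. cis (- tdot t x) * main_term n j k t) \<longrightarrow>
     norm (complex_of_real ((2 * pi)\<^sup>2 * pmf (rw_law p n (0, j)) (x, k))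
        - (LINT t|lborel. cis (- tdot t x) * main_term n j k t)) \<le> K / (real n)\<^sup>2"
proof -
  obtain D1 where D1: "D1 \<ge> 0" and box: "\<And>t n. t \<in> torus_box \<Longrightarrow>
     norm ((char_op p t ^^ n) (\<lambda>i. of_bool (i = k)) j - main_term n j k t)
     \<le> D1 * (((norm t)\<^sup>2 + real n * norm t ^ 4 + (real n)\<^sup>2 * norm t ^ 6) * rate t ^ n + (real n + 1) * \<rho> ^ n)"
    using char_op_pow_expansion by blast
  obtain D2 where D2: "D2 \<ge> 0" and tail: "\<And>t n. t \<notin> torus_box \<Longrightarrow>
     norm (main_term n j k t) \<le> D2 * (((norm t)\<^sup>2 + real n * norm t ^ 4 + (real n)\<^sup>2 * norm t ^ 6) * rate t ^ n)"
    using main_term_tail by blast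
  obtain P where P: "P \<ge> 0" "\<And>z. z \<ge> 0 \<Longrightarrow> z + z\<^sup>2 + z ^ 3 \<le> P * exp (c * z / 2)"
    using cubic_le_exp constants(1) by blast
  obtain R where R: "R \<ge> 0" "\<And>n. n \<ge> 1 \<Longrightarrow> (real n + 1) * \<rho> ^ n \<le> R / (real n)\<^sup>2"
    using geometric_le_inverse_square[of \<rho>] constants by auto
  define D where "D = D1 + D2"
  show ?thesis
  proof (intro exI[of _ "D * P * (2 * pi / c) + D1 * R * (2 * pi)\<^sup>2"] conjI allI impI)
    show "0 \<le> D * P * (2 * pi / c) + D1 * R * (2 * pi)\<^sup>2"
      using D1 D2 P(1) R(1) constants by (simp add: D_def)
    fix n :: nat and x :: "int ^ 2"
    assume n: "n \<ge> 1" and int: "integrable lborel (\<lambda>t. cis (- tdot t x) * main_term n j k t)"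
    let ?F = "\<lambda>t. indicator torus_box t *\<^sub>R (cis (- tdot t x) * (char_op p t ^^ n) (\<lambda>i. of_bool (i = k)) j)"
    let ?M = "\<lambda>t. cis (- tdot t x) * main_term n j k t"
    let ?B = "\<lambda>t. D * P / real n * exp (- (c * real n / 2) * (norm t)\<^sup>2) + D1 * R / (real n)\<^sup>2 * indicator torus_box t"
    have poly: "((norm t)\<^sup>2 + real n * norm t ^ 4 + (real n)\<^sup>2 * norm t ^ 6) * rate t ^ n
        \<le> P / real n * exp (- (c * real n / 2) * (norm t)\<^sup>2)" for t :: "real \<times> real"
    proof -
      define z where "z = real n * (norm t)\<^sup>2"
      have "rate t ^ n = exp (- c * z)"
        by (simp add: rate_def z_def exp_of_nat_mult[symmetric] mult_ac)
      moreover have "(norm t)\<^sup>2 + real n * norm t ^ 4 + (real n)\<^sup>2 * norm t ^ 6 = (z + z\<^sup>2 + z ^ 3) / real n"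
      proof -
        have "z\<^sup>2 = real n * (real n * norm t ^ 4)" "z ^ 3 = real n * ((real n)\<^sup>2 * norm t ^ 6)"
          by (simp_all add: z_def power_mult_distrib flip: power_mult) (simp_all add: eval_nat_numeral)
        then show ?thesis using n by (simp add: z_def add_divide_distrib)
      qed
      moreover have "(z + z\<^sup>2 + z ^ 3) / real n * exp (- c * z) \<le> P * exp (c * z / 2) / real n * exp (- c * z)"
        by (intro mult_right_mono divide_right_mono P(2)) (auto simp: z_def)
      moreover have "exp (c * z / 2) * exp (- c * z) = exp (- (c * real n / 2) * (norm t)\<^sup>2)"
        unfolding exp_add[symmetric] by (simp add: z_def)
      ultimately show ?thesis by (simp add: mult.assoc)
    qed
    have intF: "integrable lborel ?F" by (rule rw_law_fourier_inversion(1))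
    have cn: "c * real n / 2 > 0" using constants n by simp
    have box_int: "integrable lborel (indicator torus_box :: real \<times> real \<Rightarrow> real)" and box_val: "(LINT t|lborel. indicator torus_box t) = (2 * pi)\<^sup>2"
    proof -
      have i: "integrable lborel (\<lambda>t. complex_of_real (indicator torus_box t))"
        using integral_cis_torus_box(1)[of 0] by (simp add: tdot_simps scaleR_conv_of_real)
      then show "integrable lborel (indicator torus_box :: real \<times> real \<Rightarrow> real)"
        using complex_of_real_integrable_eq by blast
      have "complex_of_real (LINT t|lborel. indicator torus_box t) = of_real ((2 * pi)\<^sup>2)"
        using integral_cis_torus_box(2)[of 0] by (simp add: tdot_simps scaleR_conv_of_real)
      then show "(LINT t|lborel. indicator torus_box t) = (2 * pi)\<^sup>2" by (simp only: of_real_eq_iff)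
    qed
    have intB: "integrable lborel ?B"
      by (intro Bochner_Integration.integrable_add integrable_mult_right gauss_radial_integral(1)[OF cn] box_int)
    have "complex_of_real ((2 * pi)\<^sup>2 * pmf (rw_law p n (0, j)) (x, k)) - (LINT t|lborel. ?M t)
      = (LINT t|lborel. ?F t - ?M t)"
      unfolding rw_law_fourier_inversion(2) by (rule Bochner_Integration.integral_diff[OF intF int, symmetric])
    also have "norm \<dots> \<le> (LINT t|lborel. norm (?F t - ?M t))"
      by (rule integral_norm_bound)
    also have "\<dots> \<le> (LINT t|lborel. ?B t)"
    proof (rule integral_mono)
      show "integrable lborel (\<lambda>t. norm (?F t - ?M t))"
        by (intro integrable_norm Bochner_Integration.integrable_diff intF int)
      show "integrable lborel ?B" by (rule intB)
      fix t :: "real \<times> real"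
      show "norm (?F t - ?M t) \<le> ?B t"
      proof (cases "t \<in> torus_box")
        case True
        have "norm (?F t - ?M t) = norm ((char_op p t ^^ n) (\<lambda>i. of_bool (i = k)) j - main_term n j k t)"
          using True by (simp add: right_diff_distrib[symmetric] norm_mult)
        also have "\<dots> \<le> D1 * (((norm t)\<^sup>2 + real n * norm t ^ 4 + (real n)\<^sup>2 * norm t ^ 6) * rate t ^ n + (real n + 1) * \<rho> ^ n)"
          by (rule box[OF True])
        also have "\<dots> \<le> D1 * (P / real n * exp (- (c * real n / 2) * (norm t)\<^sup>2) + R / (real n)\<^sup>2)"
          using D1 n by (intro mult_left_mono add_mono poly R)
        also have "\<dots> = D1 * (P / real n * exp (- (c * real n / 2) * (norm t)\<^sup>2)) + D1 * R / (real n)\<^sup>2"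
          by (simp add: distrib_left)
        also have "\<dots> \<le> D * (P / real n * exp (- (c * real n / 2) * (norm t)\<^sup>2)) + D1 * R / (real n)\<^sup>2"
          using D2 P(1) by (intro add_right_mono mult_right_mono) (auto simp: D_def)
        finally show ?thesis using True by simp
      next
        case False
        have "norm (?F t - ?M t) = norm (main_term n j k t)"
          using False by (simp add: norm_mult)
        also have "\<dots> \<le> D2 * (((norm t)\<^sup>2 + real n * norm t ^ 4 + (real n)\<^sup>2 * norm t ^ 6) * rate t ^ n)"
          by (rule tail[OF False])
        also have "\<dots> \<le> D2 * (P / real n * exp (- (c * real n / 2) * (norm t)\<^sup>2))"
          using D2 by (intro mult_left_mono poly)
        also have "\<dots> \<le> D * (P / real n * exp (- (c * real n / 2) * (norm t)\<^sup>2))"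
          using D1 P(1) by (intro mult_right_mono) (auto simp: D_def)
        finally show ?thesis using False by simp
      qed
    qed
    also have "(LINT t|lborel. ?B t) = D * P / real n * (LINT t::real\<times>real|lborel. exp (- (c * real n / 2) * (norm t)\<^sup>2))
         + D1 * R / (real n)\<^sup>2 * (LINT t|lborel. indicator torus_box t)"
      by (subst Bochner_Integration.integral_add)
        (intro integrable_mult_right gauss_radial_integral(1)[OF cn] box_int, intro integrable_mult_right box_int,
          simp only: integral_mult_right_zero)
    also have "\<dots> = D * P / real n * (pi / (c * real n / 2)) + D1 * R / (real n)\<^sup>2 * (2 * pi)\<^sup>2"
      unfolding gauss_radial_integral(2)[OF cn] box_val ..
    also have "\<dots> = (D * P * (2 * pi / c) + D1 * R * (2 * pi)\<^sup>2) / (real n)\<^sup>2"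
      using n constants by (simp add: power2_eq_square add_divide_distrib mult_ac)
    finally show "norm (complex_of_real ((2 * pi)\<^sup>2 * pmf (rw_law p n (0, j)) (x, k)) - (LINT t|lborel. ?M t))
       \<le> (D * P * (2 * pi / c) + D1 * R * (2 * pi)\<^sup>2) / (real n)\<^sup>2" .
  qed
qed

lemma local_limit_entry:
  assumes a: "0 < a" and det: "0 < a * d - b\<^sup>2" and var: "\<And>t. variance_form t = quad_form a b d t"
  defines "X \<equiv> \<lambda>x :: int ^ 2. (real_of_int (x $ 1), real_of_int (x $ 2))"
  defines "G \<equiv> \<lambda>n x. exp (- (quad_form d (- b) a (X x) / (a * d - b\<^sup>2)) / (2 * real n))"
  shows "\<exists>K\<ge>0. \<forall>n\<ge>1. \<forall>x.
    \<bar>pmf (rw_law p n (0, j)) (x, k) - \<mu> $ k * (1 / (2 * pi * real n * sqrt (a * d - b\<^sup>2)) * G n x)\<bar>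
     \<le> K * (1 / real n * (1 / sqrt (real n)) * (norm (X x) / sqrt (real n) + (norm (X x) / sqrt (real n)) ^ 3) * G n x
            + 1 / (real n)\<^sup>2)"
proof -
  obtain K0 where K0: "K0 \<ge> 0" and diff: "\<And>n x. n \<ge> 1 \<Longrightarrow> integrable lborel (\<lambda>t. cis (- tdot t x) * main_term n j k t) \<Longrightarrow>
     norm (complex_of_real ((2 * pi)\<^sup>2 * pmf (rw_law p n (0, j)) (x, k))
        - (LINT t|lborel. cis (- tdot t x) * main_term n j k t)) \<le> K0 / (real n)\<^sup>2"
    using fourier_difference_bound[of j k] by blast
  let ?gf = "gauss_fourier (quad_form a b d)"
  obtain C1 where C1: "C1 \<ge> 0" and b1: "\<And>n x. n > 0 \<Longrightarrow> norm (LINT t|lborel. of_real (linear_term j k t) * ?gf n x t)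
    \<le> C1 * (1 / n * (1 / sqrt n) ^ 1 * (norm x / sqrt n + (norm x / sqrt n) ^ 3)
         * exp (- (quad_form d (- b) a x / (a * d - b\<^sup>2)) / (2 * n)))"
    using gauss_fourier_odd_bound[OF a det hpoly_linear_term[of j k]] by blast
  obtain C3 where C3: "C3 \<ge> 0" and b3: "\<And>n x. n > 0 \<Longrightarrow> norm (LINT t|lborel. of_real (skewness_form t) * ?gf n x t)
    \<le> C3 * (1 / n * (1 / sqrt n) ^ 3 * (norm x / sqrt n + (norm x / sqrt n) ^ 3)
         * exp (- (quad_form d (- b) a x / (a * d - b\<^sup>2)) / (2 * n)))"
    using gauss_fourier_odd_bound[OF a det hpoly_skewness_form] by blast
  have mu: "0 \<le> \<mu> $ k" "\<mu> $ k \<le> 1"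
    using stationary member_le_sum[of k UNIV "\<lambda>k. \<mu> $ k"] by (auto simp: stationary_distribution_def)
  define K where "K = (C1 + C3 + K0) / (2 * pi)\<^sup>2"
  show ?thesis
  proof (intro exI[of _ K] conjI allI impI)
    show "K \<ge> 0" using C1 C3 K0 by (simp add: K_def)
    fix n :: nat and x :: "int ^ 2" assume n1: "n \<ge> 1"
    then have n: "real n > 0" by simp
    define W where "W = 1 / real n * (1 / sqrt (real n)) * (norm (X x) / sqrt (real n) + (norm (X x) / sqrt (real n)) ^ 3) * G n x"
    have W0: "W \<ge> 0" by (simp add: W_def G_def)
    let ?g = "?gf (real n) (X x)"
    have gi: "integrable lborel ?g" by (rule gauss_fourier_transform(1)[OF a det n])
    have li: "integrable lborel (\<lambda>t. of_real (linear_term j k t) * ?g t)"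
      by (rule gauss_fourier_hpoly_integrable[OF a det n hpoly_linear_term])
    have si: "integrable lborel (\<lambda>t. of_real (skewness_form t) * ?g t)"
      by (rule gauss_fourier_hpoly_integrable[OF a det n hpoly_skewness_form])
    have main: "(\<lambda>t. cis (- tdot t x) * main_term n j k t) = (\<lambda>t. of_real (\<mu> $ k) * ?g t
       + \<i> * (of_real (linear_term j k t) * ?g t) + \<i> * of_real (real n * \<mu> $ k) * (of_real (skewness_form t) * ?g t))"
      by (rule ext) (simp add: main_term_def gauss_fourier_def var X_def tdot_def algebra_simps)
    have mi: "integrable lborel (\<lambda>t. cis (- tdot t x) * main_term n j k t)"
      unfolding main by (intro Bochner_Integration.integrable_add integrable_mult_right gi li si)
    have val: "(LINT t|lborel. cis (- tdot t x) * main_term n j k t) = of_real (\<mu> $ k) * (LINT t|lborel. ?g t)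
       + \<i> * (LINT t|lborel. of_real (linear_term j k t) * ?g t)
       + \<i> * of_real (real n * \<mu> $ k) * (LINT t|lborel. of_real (skewness_form t) * ?g t)"
      unfolding main
      by (subst Bochner_Integration.integral_add,
          (intro Bochner_Integration.integrable_add integrable_mult_right gi li si)+,
          subst Bochner_Integration.integral_add,
          (intro integrable_mult_right gi li si)+) (simp only: integral_mult_right_zero)
    define p0 where "p0 = pmf (rw_law p n (0, j)) (x, k)"
    define g0 where "g0 = 1 / (2 * pi * real n * sqrt (a * d - b\<^sup>2)) * G n x"
    have g0: "(LINT t|lborel. ?g t) = of_real ((2 * pi)\<^sup>2 * g0)"
      unfolding gauss_fourier_transform(2)[OF a det n]
      by (rule arg_cong[where f=of_real]) (simp add: g0_def G_def power2_eq_square)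
    have "(2 * pi)\<^sup>2 * \<bar>p0 - \<mu> $ k * g0\<bar> = norm (complex_of_real ((2 * pi)\<^sup>2 * p0) - of_real (\<mu> $ k) * (LINT t|lborel. ?g t))"
    proof -
      have "complex_of_real ((2 * pi)\<^sup>2 * p0) - of_real (\<mu> $ k) * (LINT t|lborel. ?g t)
        = of_real ((2 * pi)\<^sup>2 * (p0 - \<mu> $ k * g0))"
        unfolding g0 by (simp add: algebra_simps)
      then show ?thesis by (simp only: norm_of_real abs_mult abs_power2)
    qed
    also have "\<dots> = norm ((complex_of_real ((2 * pi)\<^sup>2 * p0) - (LINT t|lborel. cis (- tdot t x) * main_term n j k t))
        + (\<i> * (LINT t|lborel. of_real (linear_term j k t) * ?g t)
       + \<i> * of_real (real n * \<mu> $ k) * (LINT t|lborel. of_real (skewness_form t) * ?g t)))"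
      unfolding val by (simp add: algebra_simps)
    also have "\<dots> \<le> norm (complex_of_real ((2 * pi)\<^sup>2 * p0) - (LINT t|lborel. cis (- tdot t x) * main_term n j k t))
        + (norm (LINT t|lborel. of_real (linear_term j k t) * ?g t)
       + real n * \<mu> $ k * norm (LINT t|lborel. of_real (skewness_form t) * ?g t))"
      using mu by (intro order.trans[OF norm_triangle_ineq] add_mono order.refl)
        (simp_all add: norm_mult abs_mult)
    also have "\<dots> \<le> K0 / (real n)\<^sup>2 + (C1 * W + C3 * W)"
    proof (intro add_mono)
      show "norm (complex_of_real ((2 * pi)\<^sup>2 * p0) - (LINT t|lborel. cis (- tdot t x) * main_term n j k t)) \<le> K0 / (real n)\<^sup>2"
        unfolding p0_def by (rule diff[OF n1 mi])
      show "norm (LINT t|lborel. of_real (linear_term j k t) * ?g t) \<le> C1 * W"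
        using b1[OF n, of "X x"] by (simp add: W_def G_def)
      have "real n * \<mu> $ k * norm (LINT t|lborel. of_real (skewness_form t) * ?g t)
        \<le> real n * 1 * (C3 * (1 / real n * (1 / sqrt (real n)) ^ 3 * (norm (X x) / sqrt (real n) + (norm (X x) / sqrt (real n)) ^ 3) * G n x))"
        unfolding G_def using mu by (intro mult_mono b3 n) auto
      also have "\<dots> = C3 * W"
      proof -
        have "real n * (1 / sqrt (real n)) ^ 3 = 1 / sqrt (real n)"
          using n by (simp add: power3_eq_cube)
        then have "real n * (1 / real n * (1 / sqrt (real n)) ^ 3) = 1 / real n * (1 / sqrt (real n))"
          by (metis (no_types, lifting) mult.left_commute)
        moreover have "u * 1 * (C3 * (v * w * y * z)) = C3 * (u * (v * w) * y * z)" for u v w y z :: real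
          by simp
        ultimately show ?thesis unfolding W_def by (simp only:)
      qed
      finally show "real n * \<mu> $ k * norm (LINT t|lborel. of_real (skewness_form t) * ?g t) \<le> C3 * W" .
    qed
    also have "\<dots> \<le> (C1 + C3 + K0) * (W + 1 / (real n)\<^sup>2)"
    proof -
      have "0 \<le> K0 * W + (C1 + C3) * (1 / (real n)\<^sup>2)" using C1 C3 K0 W0 by simp
      then show ?thesis by (simp add: algebra_simps add_divide_distrib)
    qed
    finally have "\<bar>p0 - \<mu> $ k * g0\<bar> \<le> K * (W + 1 / (real n)\<^sup>2)"
      by (simp add: K_def pos_le_divide_eq mult.commute)
    then show "\<bar>pmf (rw_law p n (0, j)) (x, k) - \<mu> $ k * (1 / (2 * pi * real n * sqrt (a * d - b\<^sup>2)) * G n x)\<bar>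
     \<le> K * (1 / real n * (1 / sqrt (real n)) * (norm (X x) / sqrt (real n) + (norm (X x) / sqrt (real n)) ^ 3) * G n x
            + 1 / (real n)\<^sup>2)"
      unfolding p0_def g0_def W_def .
  qed
qed

end

text \<open>
Cramer's rule for \<open>w = S\<^sup>-\<^sup>1 x\<close>.
\<close>

lemma inner_matrix_inv_2:
  fixes S :: "real ^ 2 ^ 2"
  assumes "invertible S" and sym: "S $ 2 $ 1 = S $ 1 $ 2"
  shows "x \<bullet> (matrix_inv S *v x)
    = quad_form (S $ 2 $ 2) (- (S $ 1 $ 2)) (S $ 1 $ 1) (x $ 1, x $ 2) / (S $ 1 $ 1 * S $ 2 $ 2 - (S $ 1 $ 2)\<^sup>2)"
proof -
  have det: "S $ 1 $ 1 * S $ 2 $ 2 - (S $ 1 $ 2)\<^sup>2 \<noteq> 0"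
    using assms invertible_det_nz[of S] by (simp add: det_2 power2_eq_square)
  define w where "w = matrix_inv S *v x"
  have "S ** matrix_inv S = mat 1"
    using someI_ex[OF assms(1)[unfolded invertible_def]] by (simp add: matrix_inv_def)
  then have "S *v w = x" by (simp add: w_def matrix_vector_mul_assoc)
  then have "x $ 1 = S $ 1 $ 1 * w $ 1 + S $ 1 $ 2 * w $ 2" "x $ 2 = S $ 1 $ 2 * w $ 1 + S $ 2 $ 2 * w $ 2"
    using sym by (auto simp: matrix_vector_mult_def sum_2)
  then have "(S $ 1 $ 1 * S $ 2 $ 2 - (S $ 1 $ 2)\<^sup>2) * (x \<bullet> w) = quad_form (S $ 2 $ 2) (- (S $ 1 $ 2)) (S $ 1 $ 1) (x $ 1, x $ 2)"
    by (simp add: inner_vec_def sum_2 quad_form_def algebra_simps power2_eq_square)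
  then show ?thesis using det by (simp add: w_def eq_divide_eq mult.commute)
qed

theorem proposition2:
  fixes p :: "(2, 's::finite) rw_steps" and \<mu> :: "real ^ 's" and \<sigma> :: "real ^ 2 ^ 2"
  assumes irreducible: "irreducible_matrix (rw_Q p)"
    and aperiodic: "aperiodic_matrix (rw_Q p)"
    and stationary: "stationary_distribution (rw_Q p) \<mu>"
    and arithmetic: "trivial_arithmetic p"
    and mean: "zero_mean p \<mu>"
    and second_moments: "moment_converges 2 p"
    and covariance: "\<sigma> = rw_covariance p \<mu>"
    and nonsingular: "invertible \<sigma>"
    and fourth_moments: "moment_converges 4 p"
  shows "\<exists>C::real. \<forall>n\<ge>1. \<forall>(x :: int ^ 2) j k.
    \<bar>pmf (rw_law p n (0, j)) (x, k)
       - \<mu> $ k * (1 / real n) * gaussian_density \<sigma> (real_vec x /\<^sub>R sqrt (real n))\<bar>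
    \<le> C * (1 / real n powr (3/2)
            * (norm (real_vec x) / real n powr (1/2) + norm (real_vec x) ^ 3 / real n powr (3/2))
            * exp (- (real_vec x \<bullet> (matrix_inv \<sigma> *v real_vec x)) / (2 * real n))
          + 1 / real n ^ 2)"
proof -
  interpret internal_walk p \<mu> by unfold_locales fact+
  define a b d where "a = \<sigma> $ 1 $ 1" and "b = \<sigma> $ 1 $ 2" and "d = \<sigma> $ 2 $ 2"
  have sym: "\<sigma> $ 2 $ 1 = \<sigma> $ 1 $ 2" and var: "variance_form t = quad_form a b d t" for t
    using variance_form_eq_quad_form by (simp_all add: covariance a_def b_def d_def)
  have det_eq: "det \<sigma> = a * d - b\<^sup>2" by (simp add: det_2 sym a_def b_def d_def power2_eq_square)
  have "0 \<le> quad_form a b d t" for t using variance_form_nonneg var by simp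
  moreover have "a * d - b\<^sup>2 \<noteq> 0" using nonsingular invertible_det_nz[of \<sigma>] det_eq by simp
  ultimately have a: "a > 0" and det: "a * d - b\<^sup>2 > 0" by (rule psd_quad_form_nondegenerate)+
  from walk_decay_exists[OF a det var] obtain c \<rho> r C where "walk_decay p \<mu> c \<rho> r C" by blast
  then interpret walk_decay p \<mu> c \<rho> r C .
  define X where "X = (\<lambda>x :: int ^ 2. (real_of_int (x $ 1), real_of_int (x $ 2)))"
  define G where "G = (\<lambda>n x. exp (- (quad_form d (- b) a (X x) / (a * d - b\<^sup>2)) / (2 * real n)))"
  define V where "V = (\<lambda>n x. 1 / real n * (1 / sqrt (real n)) * (norm (X x) / sqrt (real n) + (norm (X x) / sqrt (real n)) ^ 3) * G n x + 1 / (real n)\<^sup>2)"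
  have V0: "V n x \<ge> 0" for n x by (auto simp: V_def G_def)
  have "\<exists>K\<ge>0. \<forall>n\<ge>1. \<forall>x.
    \<bar>pmf (rw_law p n (0, j)) (x, k) - \<mu> $ k * (1 / (2 * pi * real n * sqrt (a * d - b\<^sup>2)) * G n x)\<bar> \<le> K * V n x" for j k
    unfolding G_def V_def X_def by (rule local_limit_entry[OF a det var])
  then obtain K where K0: "\<And>j k. K j k \<ge> 0" and K: "\<And>j k n x. n \<ge> 1 \<Longrightarrow>
    \<bar>pmf (rw_law p n (0, j)) (x, k) - \<mu> $ k * (1 / (2 * pi * real n * sqrt (a * d - b\<^sup>2)) * G n x)\<bar> \<le> K j k * V n x"
    by metis
  define K1 where "K1 = (\<Sum>j\<in>UNIV. \<Sum>k\<in>UNIV. K j k)"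
  have K1: "K j k \<le> K1" for j k
  proof -
    have "K j k \<le> (\<Sum>k\<in>UNIV. K j k)" by (rule member_le_sum) (auto intro: K0)
    also have "\<dots> \<le> K1" unfolding K1_def by (rule member_le_sum) (auto intro: K0 sum_nonneg)
    finally show ?thesis .
  qed
  show ?thesis
  proof (intro exI[of _ K1] allI impI)
    fix n :: nat and x :: "int ^ 2" and j k assume n: "n \<ge> 1"
    define s where "s = sqrt (real n)"
    have s: "s > 0" "s * s = real n" using n by (auto simp: s_def)
    have pw: "real n powr (1/2) = s" "real n powr (3/2) = real n * s"
    proof -
      show 1: "real n powr (1/2) = s" using n by (simp add: powr_half_sqrt s_def)
      have "real n powr (3/2) = real n powr (1 + 1/2)" by simp
      also have "\<dots> = real n * s" unfolding powr_add 1 using n by simp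
      finally show "real n powr (3/2) = real n * s" .
    qed
    have nX: "norm (X x) = norm (real_vec x)" by (simp add: X_def norm_real_vec_2)
    have inner: "real_vec x \<bullet> (matrix_inv \<sigma> *v real_vec x) = quad_form d (- b) a (X x) / (a * d - b\<^sup>2)"
      unfolding inner_matrix_inv_2[OF nonsingular sym] a_def b_def d_def X_def by (simp add: real_vec_def)
    have G: "G n x = exp (- (real_vec x \<bullet> (matrix_inv \<sigma> *v real_vec x)) / (2 * real n))"
      unfolding inner G_def ..
    have density: "1 / (2 * pi * real n * sqrt (a * d - b\<^sup>2)) * G n x
       = (1 / real n) * gaussian_density \<sigma> (real_vec x /\<^sub>R sqrt (real n))"
    proof -
      let ?v = "real_vec x"
      have "(?v /\<^sub>R s) \<bullet> (matrix_inv \<sigma> *v (?v /\<^sub>R s)) = (?v \<bullet> (matrix_inv \<sigma> *v ?v)) / real n"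
        using s by (simp add: matrix_vector_mult_scaleR divide_inverse mult.assoc flip: inverse_mult_distrib)
      moreover have "sqrt ((2 * pi) ^ CARD(2) * det \<sigma>) = 2 * pi * sqrt (a * d - b\<^sup>2)"
        by (simp add: det_eq real_sqrt_mult)
      ultimately show ?thesis
        unfolding gaussian_density_def s_def[symmetric] G by (simp add: mult.commute)
    qed
    have V: "V n x = 1 / real n powr (3/2)
            * (norm (real_vec x) / real n powr (1/2) + norm (real_vec x) ^ 3 / real n powr (3/2))
            * exp (- (real_vec x \<bullet> (matrix_inv \<sigma> *v real_vec x)) / (2 * real n))
          + 1 / real n ^ 2"
    proof -
      have "(norm (real_vec x) / s) ^ 3 = norm (real_vec x) ^ 3 / (real n * s)"
        using s by (simp add: power_divide power3_eq_cube)
      then show ?thesis unfolding V_def pw G[symmetric] nX s_def[symmetric] by simp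
    qed
    have "\<bar>pmf (rw_law p n (0, j)) (x, k) - \<mu> $ k * (1 / (2 * pi * real n * sqrt (a * d - b\<^sup>2)) * G n x)\<bar> \<le> K1 * V n x"
      by (rule order.trans[OF K[OF n] mult_right_mono[OF K1 V0]])
    then show "\<bar>pmf (rw_law p n (0, j)) (x, k)
       - \<mu> $ k * (1 / real n) * gaussian_density \<sigma> (real_vec x /\<^sub>R sqrt (real n))\<bar>
    \<le> K1 * (1 / real n powr (3/2)
            * (norm (real_vec x) / real n powr (1/2) + norm (real_vec x) ^ 3 / real n powr (3/2))
            * exp (- (real_vec x \<bullet> (matrix_inv \<sigma> *v real_vec x)) / (2 * real n))
          + 1 / real n ^ 2)"
      unfolding density V by (simp only: mult.assoc)
  qed
qed

end
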